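(* Let $k$ be a field, let $k\subseteq K$ be a field extension, let $X$ be an affine and finitely presented group scheme over $k$, let $G\subset X$ be a finitely presented closed subgroup scheme over $k$, and let $\mathbf{N}_X(G)$ be the normalizer subgroup scheme of $G\subset X$. Then there exists a natural bijection between the following sets: 1. $X(k)$-conjugacy classes of closed finitely presented $k$-subgroup schemes $H$ of $X$ such that $H_K$ is conjugate to $G_K$ over $X_K$ (that is, by an element of $X(K)$). 2. Isomorphism classes of left $\mathbf{N}_X(G)$-torsors over $k$ that admit an equivariant closed immersion into $X$ and that split over $K$.
   Context: The normalizer subgroup scheme $\mathbf{N}_X(G)$ is the closed subgroup scheme of $X$ given by the functor $$S\mapsto\{x\in X(S)\mid \forall f:T\to S,\ g\in G(T):\ f^*(x)\,g\,f^*(x)^{-1}\in G(T)\}.$$ $\mathbf{N}_X(G)$ acts on $X$ by left multiplication. A torsor $E$ splits over $K$ if $E(K)\neq\emptyset$. *)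

theory Defs
  imports "HOL-Algebra.Algebra"
begin

text \<open>
  Affine schemes over a field \<open>k\<close> are given by their coordinate algebras, and group
  schemes, subgroup schemes, actions and torsors by their functors of points.  The test objects
  are all commutative \<open>k\<close>-algebras whose carrier is a set of elements of one type
  \<open>'u\<close>, which plays the role of the universe.  When \<open>'u\<close> is infinite and
  contains the carriers of \<open>k\<close> and \<open>K\<close>, every finitely generated algebra
  over \<open>k\<close>, over \<open>K\<close>, or over any other test algebra has an isomorphic copy
  among the test algebras, for reasons of cardinality.  By the Yoneda lemma the functor of points
  on test algebras then determines an affine scheme and its morphisms.
\<close>

section \<open>Algebras over a field\<close>

text \<open>
  The homomorphisms are extensional so that distinct functions are distinct homomorphisms.
\<close>

definition alg_hom ::
    "'k ring \<Rightarrow> ('k, 'a) module \<Rightarrow> ('k, 'b) module \<Rightarrow> ('a \<Rightarrow> 'b) set" where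
  "alg_hom k R S = {f \<in> ring_hom R S \<inter> extensional (carrier R).
     \<forall>c\<in>carrier k. \<forall>a\<in>carrier R. f (c \<odot>\<^bsub>R\<^esub> a) = c \<odot>\<^bsub>S\<^esub> f a}"

definition self_alg :: "'k ring \<Rightarrow> ('k, 'k) module" where
  "self_alg k = \<lparr>carrier = carrier k, monoid.mult = monoid.mult k, one = one k,
     ring.zero = ring.zero k, ring.add = ring.add k, smult = monoid.mult k\<rparr>"

definition quot_alg :: "('k, 'a) module \<Rightarrow> 'a set \<Rightarrow> ('k, 'a set) module" where
  "quot_alg A I = \<lparr>carrier = carrier (A Quot I), monoid.mult = monoid.mult (A Quot I), one = one (A Quot I),
     ring.zero = ring.zero (A Quot I), ring.add = ring.add (A Quot I),
     smult = (\<lambda>c C. \<Union>a\<in>C. I +>\<^bsub>A\<^esub> (c \<odot>\<^bsub>A\<^esub> a))\<rparr>"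

text \<open>
  The polynomial algebra \<open>k[x\<^sub>0, \<dots>, x\<^sub>n\<^sub>-\<^sub>1]\<close>; a monomial
  is the multiset of the indices of its variables, and a polynomial is its coefficient function.
\<close>

definition mpoly_alg :: "'k ring \<Rightarrow> nat \<Rightarrow> ('k, nat multiset \<Rightarrow> 'k) module" where
  "mpoly_alg k n = \<lparr>
     carrier = {p. (\<forall>m. p m \<in> carrier k) \<and> finite {m. p m \<noteq> \<zero>\<^bsub>k\<^esub>} \<and>
                   (\<forall>m. p m \<noteq> \<zero>\<^bsub>k\<^esub> \<longrightarrow> set_mset m \<subseteq> {..<n})},
     monoid.mult = (\<lambda>p q m. finsum k (\<lambda>(a, b). p a \<otimes>\<^bsub>k\<^esub> q b) {(a, b). a + b = m}),
     one = (\<lambda>m. if m = {#} then \<one>\<^bsub>k\<^esub> else \<zero>\<^bsub>k\<^esub>),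
     ring.zero = (\<lambda>m. \<zero>\<^bsub>k\<^esub>),
     ring.add = (\<lambda>p q m. p m \<oplus>\<^bsub>k\<^esub> q m),
     smult = (\<lambda>c p m. c \<otimes>\<^bsub>k\<^esub> p m)\<rparr>"

definition finitely_presented :: "'k ring \<Rightarrow> ('k, 'a) module \<Rightarrow> bool" where
  "finitely_presented k A \<longleftrightarrow> algebra k A \<and>
     (\<exists>n. \<exists>\<phi>\<in>alg_hom k (mpoly_alg k n) A.
        \<phi> ` carrier (mpoly_alg k n) = carrier A \<and>
        (\<exists>F. finite F \<and> F \<subseteq> carrier (mpoly_alg k n) \<and>
             a_kernel (mpoly_alg k n) A \<phi> = Idl\<^bsub>mpoly_alg k n\<^esub> F))"

section \<open>Affine group schemes and closed subgroup schemes\<close>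

text \<open>
  The \<open>R\<close>-points of \<open>Spec A\<close> are the homomorphisms \<open>A \<rightarrow> R\<close>.
\<close>

type_synonym 'u alg = "('u, 'u) module"
type_synonym 'u pt = "'u \<Rightarrow> 'u"
type_synonym 'u grp_functor = "'u alg \<Rightarrow> 'u pt monoid"

text \<open>
  For a point \<open>x\<close> of \<open>Spec A\<close> over \<open>R\<close> and an \<open>R\<close>-algebra
  \<open>f : R \<rightarrow> S\<close>, the pullback of \<open>x\<close> to \<open>S\<close> is
  \<open>compose (carrier A) f x\<close>.  A group scheme \<open>X = Spec A\<close> is given by
  its functor of points \<open>Xf\<close>, a natural group structure on the sets of points.
\<close>

definition affine_group_scheme :: "'u ring \<Rightarrow> 'u alg \<Rightarrow> 'u grp_functor \<Rightarrow> bool" where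
  "affine_group_scheme k A Xf \<longleftrightarrow> algebra k A \<and>
     (\<forall>R. algebra k R \<longrightarrow> group (Xf R) \<and> carrier (Xf R) = alg_hom k A R) \<and>
     (\<forall>R S f. algebra k R \<longrightarrow> algebra k S \<longrightarrow> f \<in> alg_hom k R S \<longrightarrow>
        compose (carrier A) f \<in> hom (Xf R) (Xf S))"

text \<open>
  A closed subscheme of \<open>Spec A\<close> is an ideal of \<open>A\<close>; its points are the
  points of \<open>Spec A\<close> vanishing on the ideal.
\<close>

definition closed_points :: "'u ring \<Rightarrow> 'u alg \<Rightarrow> 'u set \<Rightarrow> 'u alg \<Rightarrow> 'u pt set" where
  "closed_points k A I R = {x \<in> alg_hom k A R. \<forall>a\<in>I. x a = \<zero>\<^bsub>R\<^esub>}"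

definition closed_subgroup_scheme ::
    "'u ring \<Rightarrow> 'u alg \<Rightarrow> 'u grp_functor \<Rightarrow> 'u set \<Rightarrow> bool" where
  "closed_subgroup_scheme k A Xf H \<longleftrightarrow> ideal H A \<and>
     (\<forall>R. algebra k R \<longrightarrow> subgroup (closed_points k A H R) (Xf R))"

definition fp_closed_subgroup_scheme ::
    "'u ring \<Rightarrow> 'u alg \<Rightarrow> 'u grp_functor \<Rightarrow> 'u set \<Rightarrow> bool" where
  "fp_closed_subgroup_scheme k A Xf H \<longleftrightarrow>
     closed_subgroup_scheme k A Xf H \<and> finitely_presented k (quot_alg A H)"

text \<open>
  \<open>x H\<^sub>R x\<inverse> = H'\<^sub>R\<close> as subgroup schemes of \<open>X\<^sub>R\<close>,
  for \<open>x \<in> X(R)\<close>.  An \<open>R\<close>-algebra is a \<open>k\<close>-algebra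
  \<open>S\<close> with a homomorphism \<open>f : R \<rightarrow> S\<close>, and the base change
  \<open>H\<^sub>R\<close> has the value \<open>H(S)\<close> on it.
\<close>

definition conjugates ::
    "'u ring \<Rightarrow> 'u alg \<Rightarrow> 'u grp_functor \<Rightarrow> 'u alg \<Rightarrow> 'u pt \<Rightarrow> 'u set \<Rightarrow> 'u set \<Rightarrow> bool" where
  "conjugates k A Xf R x H H' \<longleftrightarrow>
     (\<forall>S f. algebra k S \<longrightarrow> f \<in> alg_hom k R S \<longrightarrow>
        (let y = compose (carrier A) f x in
         (\<lambda>h. y \<otimes>\<^bsub>Xf S\<^esub> h \<otimes>\<^bsub>Xf S\<^esub> inv\<^bsub>Xf S\<^esub> y) ` closed_points k A H S
           = closed_points k A H' S))"

definition conjugate_over ::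
    "'u ring \<Rightarrow> 'u alg \<Rightarrow> 'u grp_functor \<Rightarrow> 'u alg \<Rightarrow> 'u set \<Rightarrow> 'u set \<Rightarrow> bool" where
  "conjugate_over k A Xf R H H' \<longleftrightarrow> (\<exists>x\<in>carrier (Xf R). conjugates k A Xf R x H H')"

text \<open>The points \<open>x\<close> of \<open>X\<close> with \<open>x H x\<inverse> = H'\<close>.\<close>

definition transporter ::
    "'u ring \<Rightarrow> 'u alg \<Rightarrow> 'u grp_functor \<Rightarrow> 'u set \<Rightarrow> 'u set \<Rightarrow> 'u alg \<Rightarrow> 'u pt set" where
  "transporter k A Xf H H' R = {x \<in> carrier (Xf R). conjugates k A Xf R x H H'}"

text \<open>
  Affine test schemes \<open>T = Spec S \<rightarrow> Spec R\<close> suffice, since membership in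
  \<open>G\<close> can be checked on an affine open cover.
\<close>

definition normalizer_points ::
    "'u ring \<Rightarrow> 'u alg \<Rightarrow> 'u grp_functor \<Rightarrow> 'u set \<Rightarrow> 'u alg \<Rightarrow> 'u pt set" where
  "normalizer_points k A Xf G R = {x \<in> carrier (Xf R).
     \<forall>S f. algebra k S \<longrightarrow> f \<in> alg_hom k R S \<longrightarrow>
       (\<forall>g\<in>closed_points k A G S.
          compose (carrier A) f x \<otimes>\<^bsub>Xf S\<^esub> g \<otimes>\<^bsub>Xf S\<^esub> inv\<^bsub>Xf S\<^esub> (compose (carrier A) f x)
            \<in> closed_points k A G S)}"

definition normalizer_scheme ::
    "'u ring \<Rightarrow> 'u alg \<Rightarrow> 'u grp_functor \<Rightarrow> 'u set \<Rightarrow> 'u grp_functor" where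
  "normalizer_scheme k A Xf G R = (Xf R)\<lparr>carrier := normalizer_points k A Xf G R\<rparr>"

section \<open>Torsors\<close>

text \<open>
  An action on \<open>Spec B\<close> is given on points: \<open>act R n e\<close> is
  \<open>n e\<close>, for \<open>n\<close> a point of the group and \<open>e\<close> a point of
  \<open>Spec B\<close>, both over \<open>R\<close>.
\<close>

type_synonym 'u action = "'u alg \<Rightarrow> 'u pt \<Rightarrow> 'u pt \<Rightarrow> 'u pt"

text \<open>
  \<open>N\<close> is a subgroup functor of an affine group scheme with coordinate algebra
  \<open>A\<close>, so points of \<open>N\<close> are pulled back as those of \<open>Spec A\<close>.
\<close>

definition scheme_action ::
    "'u ring \<Rightarrow> 'u alg \<Rightarrow> 'u grp_functor \<Rightarrow> 'u alg \<Rightarrow> 'u action \<Rightarrow> bool" where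
  "scheme_action k A N B act \<longleftrightarrow> algebra k B \<and>
     (\<forall>R. algebra k R \<longrightarrow> group_action (N R) (alg_hom k B R) (act R)) \<and>
     (\<forall>R S f. algebra k R \<longrightarrow> algebra k S \<longrightarrow> f \<in> alg_hom k R S \<longrightarrow>
        (\<forall>n\<in>carrier (N R). \<forall>e\<in>alg_hom k B R.
           act S (compose (carrier A) f n) (compose (carrier B) f e)
             = compose (carrier B) f (act R n e)))"

text \<open>
  A torsor for the fppf topology: a pseudo-torsor with a point over some fppf cover of
  \<open>Spec k\<close>.  Since \<open>k\<close> is a field, every algebra over it is flat, and fppf
  covers of \<open>Spec k\<close> are refined by the spectra of the nonzero finitely presented
  algebras.
\<close>

definition left_torsor ::
    "'u ring \<Rightarrow> 'u alg \<Rightarrow> 'u grp_functor \<Rightarrow> 'u alg \<Rightarrow> 'u action \<Rightarrow> bool" where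
  "left_torsor k A N B act \<longleftrightarrow> scheme_action k A N B act \<and>
     (\<forall>R. algebra k R \<longrightarrow> (\<forall>e\<in>alg_hom k B R. \<forall>e'\<in>alg_hom k B R.
        \<exists>!n. n \<in> carrier (N R) \<and> act R n e = e')) \<and>
     (\<exists>R :: 'u alg. finitely_presented k R \<and> \<one>\<^bsub>R\<^esub> \<noteq> \<zero>\<^bsub>R\<^esub> \<and> alg_hom k B R \<noteq> {})"

text \<open>
  \<open>\<phi> : C \<rightarrow> B\<close> stands for the morphism \<open>Spec B \<rightarrow> Spec C\<close>,
  \<open>e \<mapsto> e \<circ> \<phi>\<close>.
\<close>

definition equivariant ::
    "'u ring \<Rightarrow> 'u grp_functor \<Rightarrow> 'u alg \<Rightarrow> 'u action \<Rightarrow> 'u alg \<Rightarrow> 'u action \<Rightarrow> ('u \<Rightarrow> 'u) \<Rightarrow> bool" where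
  "equivariant k N B act C act' \<phi> \<longleftrightarrow> \<phi> \<in> alg_hom k C B \<and>
     (\<forall>R. algebra k R \<longrightarrow> (\<forall>n\<in>carrier (N R). \<forall>e\<in>alg_hom k B R.
        compose (carrier C) (act R n e) \<phi> = act' R n (compose (carrier C) e \<phi>)))"

definition torsor_iso ::
    "'u ring \<Rightarrow> 'u grp_functor \<Rightarrow> 'u alg \<times> 'u action \<Rightarrow> 'u alg \<times> 'u action \<Rightarrow> bool" where
  "torsor_iso k N E E' \<longleftrightarrow>
     (\<exists>\<phi>. equivariant k N (fst E) (snd E) (fst E') (snd E') \<phi> \<and>
          bij_betw \<phi> (carrier (fst E')) (carrier (fst E)))"

definition equivariant_closed_immersion ::
    "'u ring \<Rightarrow> 'u alg \<Rightarrow> 'u grp_functor \<Rightarrow> 'u grp_functor \<Rightarrow> 'u alg \<times> 'u action \<Rightarrow> ('u \<Rightarrow> 'u) \<Rightarrow> bool" where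
  "equivariant_closed_immersion k A Xf N E \<phi> \<longleftrightarrow>
     equivariant k N (fst E) (snd E) A (\<lambda>R n x. n \<otimes>\<^bsub>Xf R\<^esub> x) \<phi> \<and>
     \<phi> ` carrier A = carrier (fst E)"

definition image_points ::
    "'u ring \<Rightarrow> 'u alg \<Rightarrow> 'u alg \<Rightarrow> ('u \<Rightarrow> 'u) \<Rightarrow> 'u alg \<Rightarrow> 'u pt set" where
  "image_points k A B \<phi> R = (\<lambda>e. compose (carrier A) e \<phi>) ` alg_hom k B R"

section \<open>The two sets\<close>

definition form_subgroups ::
    "'u ring \<Rightarrow> 'u alg \<Rightarrow> 'u alg \<Rightarrow> 'u grp_functor \<Rightarrow> 'u set \<Rightarrow> 'u set set" where
  "form_subgroups k K A Xf G =
     {H. fp_closed_subgroup_scheme k A Xf H \<and> conjugate_over k A Xf K G H}"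

definition conjugacy_rel ::
    "'u ring \<Rightarrow> 'u alg \<Rightarrow> 'u alg \<Rightarrow> 'u grp_functor \<Rightarrow> 'u set \<Rightarrow> ('u set \<times> 'u set) set" where
  "conjugacy_rel k K A Xf G =
     {(H, H'). H \<in> form_subgroups k K A Xf G \<and> H' \<in> form_subgroups k K A Xf G \<and>
               conjugate_over k A Xf (self_alg k) H H'}"

definition split_embedded_torsors ::
    "'u ring \<Rightarrow> 'u alg \<Rightarrow> 'u alg \<Rightarrow> 'u grp_functor \<Rightarrow> 'u grp_functor \<Rightarrow> ('u alg \<times> 'u action) set" where
  "split_embedded_torsors k K A Xf N =
     {(B, act). left_torsor k A N B act \<and>
        (\<exists>\<phi>. equivariant_closed_immersion k A Xf N (B, act) \<phi>) \<and>
        alg_hom k B K \<noteq> {}}"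

definition torsor_iso_rel ::
    "'u ring \<Rightarrow> 'u alg \<Rightarrow> 'u alg \<Rightarrow> 'u grp_functor \<Rightarrow> 'u grp_functor \<Rightarrow>
       (('u alg \<times> 'u action) \<times> ('u alg \<times> 'u action)) set" where
  "torsor_iso_rel k K A Xf N =
     {(E, E'). E \<in> split_embedded_torsors k K A Xf N \<and> E' \<in> split_embedded_torsors k K A Xf N \<and>
               torsor_iso k N E E'}"

text \<open>
  Naturality of the bijection: the class of \<open>H\<close> corresponds to the torsors that embed
  in \<open>X\<close> equivariantly with image the transporter of \<open>H\<close> into
  \<open>G\<close>, on which the normalizer of \<open>G\<close> acts by left multiplication.
\<close>

definition transporter_torsor ::
    "'u ring \<Rightarrow> 'u alg \<Rightarrow> 'u grp_functor \<Rightarrow> 'u set \<Rightarrow> 'u set \<Rightarrow> 'u alg \<times> 'u action \<Rightarrow> bool" where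
  "transporter_torsor k A Xf G H E \<longleftrightarrow>
     (\<exists>\<phi>. equivariant_closed_immersion k A Xf (normalizer_scheme k A Xf G) E \<phi> \<and>
        (\<forall>R. algebra k R \<longrightarrow> image_points k A (fst E) \<phi> R = transporter k A Xf H G R))"

end

theory Submission
  imports Defs
begin

text \<open>
  Let \<open>N\<close> be the normalizer of \<open>G\<close>.  To \<open>H\<close> corresponds the transporter
  \<open>P = {x | x H x\<inverse> = G}\<close>.  It is closed in \<open>X\<close>, because every algebra over
  the field \<open>k\<close> is free as a module and the coordinates in a basis turn the condition on \<open>x\<close>
  into equations.  It is a torsor under \<open>N\<close>, because \<open>x G x\<inverse> \<subseteq> G\<close>, when it
  holds universally, implies equality: a surjective endomorphism of a Noetherian ring is injective.
  Conversely, a torsor \<open>P\<close> embedded in \<open>X\<close> comes from the closed subgroup of all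
  \<open>h\<close> with \<open>p h p\<inverse> \<in> G\<close> for all points \<open>p\<close> of \<open>P\<close>; over a
  base with a point \<open>p\<close> it is \<open>p\<inverse> G p\<close>.  The finiteness conditions are all
  consequences of the Hilbert basis theorem.  If \<open>H' = x H x\<inverse>\<close> with \<open>x\<close> in
  \<open>X(k)\<close>, right translation by \<open>x\<inverse>\<close> is an isomorphism of the transporters; and
  an isomorphism \<open>\<alpha>\<close> of embedded torsors is a right translation, since \<open>p\<inverse> \<alpha>(p)\<close>
  does not depend on \<open>p\<close> and hence descends to \<open>k\<close>.
\<close>

section \<open>Noetherian rings\<close>

text \<open>The normalizer is defined by an inclusion x G x\<inverse> \<subseteq> G over every base
  change, conjugacy of subgroups by an equality. This gap is what calls for the Noetherian argument,
  and closing it makes the normalizer a group functor. From then on only inclusions are handled: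
  \<open>sends\<close> is one half of \<open>conjugates\<close>.

  No comultiplication appears. The group law is a natural family of groups, so conditions are tested
  at universal points of closed subschemes. These live over quotients and tensor products, whose
  elements are cosets and functions, whereas a test algebra has its elements in \<open>'u\<close>;
  hence such algebras are built concretely and then copied into \<open>'u\<close> along injections.

  Flatness enters only through coordinates in a basis. If 1 \<noteq> 0 in C, some coordinate of 1 is
  a unit of k; reading that coordinate shows that R \<rightarrow> R \<otimes> C is injective and
  that b \<otimes> 1 = 1 \<otimes> b forces b to be a scalar. The point over K is what makes the
  coordinate algebra of a torsor nonzero, so that descent along it applies.\<close>

locale adjoin_elt = T?: cring T for T (structure) +
  fixes R :: "'a set" and t :: 'a
  assumes subcring_R: "subcring R T" and t_closed [simp, intro]: "t \<in> carrier T"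
begin

lemma R_sub: "r \<in> R \<Longrightarrow> r \<in> carrier T"
  using subcring.axioms(1)[OF subcring_R] subringE(1) by blast

lemma R_ring: "cring (T\<lparr>carrier := R\<rparr>)"
  using subcring_iff R_sub subcring_R by blast

lemma R_closed [simp, intro]:
  "\<zero> \<in> R" "\<one> \<in> R" "r \<in> R \<Longrightarrow> r' \<in> R \<Longrightarrow> r \<oplus> r' \<in> R" "r \<in> R \<Longrightarrow> r' \<in> R \<Longrightarrow> r \<otimes> r' \<in> R"
  "r \<in> R \<Longrightarrow> \<ominus> r \<in> R"
  using subringE[OF subcring.axioms(1)[OF subcring_R]] by auto

text \<open>The R-combinations of 1, t, ..., t^(d-1). Since t may satisfy relations over R, an
  element can have several such expressions, and this is a filtration rather than a degree.\<close>

primrec low :: "nat \<Rightarrow> 'a set" where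
  "low 0 = {\<zero>}"
| "low (Suc d) = {r \<otimes> t [^] d \<oplus> s | r s. r \<in> R \<and> s \<in> low d}"

lemma low_sub: "s \<in> low d \<Longrightarrow> s \<in> carrier T"
  by (induction d arbitrary: s) (auto simp: R_sub)

lemma low_zero: "\<zero> \<in> low d"
proof (induction d)
  case (Suc d)
  have "\<zero> = \<zero> \<otimes> t [^] d \<oplus> \<zero>" by simp
  then show ?case using Suc R_closed(1) unfolding low.simps by blast
qed simp

lemma low_add: "s \<in> low d \<Longrightarrow> s' \<in> low d \<Longrightarrow> s \<oplus> s' \<in> low d"
proof (induction d arbitrary: s s')
  case (Suc d)
  then obtain r u r' u' where *: "s = r \<otimes> t [^] d \<oplus> u" "s' = r' \<otimes> t [^] d \<oplus> u'" "r \<in> R" "r' \<in> R"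
    "u \<in> low d" "u' \<in> low d" by auto
  then have "s \<oplus> s' = (r \<oplus> r') \<otimes> t [^] d \<oplus> (u \<oplus> u')"
    by (simp add: R_sub low_sub l_distr a_ac)
  with * Suc.IH show ?case by auto
qed simp

lemma low_mult: "r' \<in> R \<Longrightarrow> s \<in> low d \<Longrightarrow> r' \<otimes> s \<in> low d"
proof (induction d arbitrary: s)
  case (Suc d)
  then obtain r u where *: "s = r \<otimes> t [^] d \<oplus> u" "r \<in> R" "u \<in> low d" by auto
  then have "r' \<otimes> s = (r' \<otimes> r) \<otimes> t [^] d \<oplus> (r' \<otimes> u)"
    using Suc.prems by (simp add: R_sub low_sub r_distr m_assoc)
  with * Suc show ?case by auto
qed (auto simp: R_sub)

lemma low_minus: "s \<in> low d \<Longrightarrow> \<ominus> s \<in> low d"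
  using low_mult[of "\<ominus> \<one>" s d] by (simp add: low_sub l_minus)

lemma low_shift: "s \<in> low d \<Longrightarrow> t \<otimes> s \<in> low (Suc d)"
proof (induction d arbitrary: s)
  case 0
  then show ?case using low_zero[of "Suc 0"] by simp
next
  case (Suc d)
  then obtain r u where *: "s = r \<otimes> t [^] d \<oplus> u" "r \<in> R" "u \<in> low d" by auto
  then have "t \<otimes> s = r \<otimes> t [^] Suc d \<oplus> (t \<otimes> u)"
    by (simp add: R_sub low_sub r_distr m_ac)
  with * Suc show ?case unfolding low.simps(2)[of "Suc d"] by blast
qed

lemma low_Suc: "s \<in> low d \<Longrightarrow> s \<in> low (Suc d)"
proof -
  assume s: "s \<in> low d"
  have "s = \<zero> \<otimes> t [^] d \<oplus> s" using low_sub[OF s] by simp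
  with s R_closed(1) show ?thesis unfolding low.simps by blast
qed

lemma low_mono: "s \<in> low d \<Longrightarrow> d \<le> d' \<Longrightarrow> s \<in> low d'"
  by (induction d' rule: nat_induct) (auto simp: le_Suc_eq simp del: low.simps intro: low_Suc)

lemma low_power: "s \<in> low d \<Longrightarrow> t [^] n \<otimes> s \<in> low (n + d)"
proof (induction n)
  case 0
  then show ?case by (simp add: low_sub)
next
  case (Suc n)
  have "t [^] Suc n \<otimes> s = t \<otimes> (t [^] n \<otimes> s)"
    using Suc.prems by (simp add: low_sub m_ac)
  then show ?case using low_shift[OF Suc.IH[OF Suc.prems]] by simp
qed

lemma low_prod:
  assumes "s' \<in> low d'"
  shows "s \<in> low d \<Longrightarrow> \<exists>e. s \<otimes> s' \<in> low e"
proof (induction d arbitrary: s)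
  case 0
  then show ?case using assms low_zero by (auto simp: low_sub)
next
  case (Suc d)
  then obtain r u where *: "s = r \<otimes> t [^] d \<oplus> u" "r \<in> R" "u \<in> low d" by auto
  then obtain e where e: "u \<otimes> s' \<in> low e" using Suc by blast
  have "s \<otimes> s' = r \<otimes> (t [^] d \<otimes> s') \<oplus> u \<otimes> s'"
    using * assms by (simp add: R_sub low_sub l_distr m_assoc)
  moreover have "r \<otimes> (t [^] d \<otimes> s') \<in> low (d + d' + e)"
    by (rule low_mono[OF low_mult[OF \<open>r \<in> R\<close> low_power[OF assms]]]) simp
  moreover have "u \<otimes> s' \<in> low (d + d' + e)" by (rule low_mono[OF e]) simp
  ultimately show ?case using low_add by metis
qed

text \<open>One expression with top term r t^d and value in I is enough for r to count. Thus
  relations satisfied by t do no harm, and multiplication by t makes the sets increase with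
  d.\<close>

definition lead_coeffs :: "'a set \<Rightarrow> nat \<Rightarrow> 'a set" where
  "lead_coeffs I d = {r \<in> R. \<exists>s \<in> low d. r \<otimes> t [^] d \<oplus> s \<in> I}"

lemma lead_coeffs_ideal:
  assumes "ideal I T"
  shows "ideal (lead_coeffs I d) (T\<lparr>carrier := R\<rparr>)"
proof -
  interpret I: ideal I T by fact
  interpret R: cring "T\<lparr>carrier := R\<rparr>" by (rule R_ring)
  have z: "\<zero> \<in> lead_coeffs I d"
  proof -
    have "\<zero> \<otimes> t [^] d \<oplus> \<zero> \<in> I" by simp
    then show ?thesis unfolding lead_coeffs_def using low_zero[of d] R_closed(1) by blast
  qed
  have a: "r \<oplus> r' \<in> lead_coeffs I d" if r: "r \<in> lead_coeffs I d" and r': "r' \<in> lead_coeffs I d" for r r'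
  proof -
    from r r' obtain s s' where *: "s \<in> low d" "s' \<in> low d" "r \<in> R" "r' \<in> R"
      "r \<otimes> t [^] d \<oplus> s \<in> I" "r' \<otimes> t [^] d \<oplus> s' \<in> I" unfolding lead_coeffs_def by auto
    have "(r \<oplus> r') \<otimes> t [^] d \<oplus> (s \<oplus> s') = (r \<otimes> t [^] d \<oplus> s) \<oplus> (r' \<otimes> t [^] d \<oplus> s')"
      using * by (simp add: R_sub low_sub l_distr a_ac)
    then have "(r \<oplus> r') \<otimes> t [^] d \<oplus> (s \<oplus> s') \<in> I" using *(5,6) I.a_closed by simp
    then show ?thesis unfolding lead_coeffs_def using low_add[OF *(1,2)] *(3,4) R_closed(3) by blast
  qed
  have m: "r' \<otimes> r \<in> lead_coeffs I d" if r: "r \<in> lead_coeffs I d" and r': "r' \<in> R" for r r'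
  proof -
    from r obtain s where *: "s \<in> low d" "r \<in> R" "r \<otimes> t [^] d \<oplus> s \<in> I" unfolding lead_coeffs_def by auto
    have "(r' \<otimes> r) \<otimes> t [^] d \<oplus> (r' \<otimes> s) = r' \<otimes> (r \<otimes> t [^] d \<oplus> s)"
      using * r' by (simp add: R_sub low_sub r_distr m_assoc)
    then have "(r' \<otimes> r) \<otimes> t [^] d \<oplus> (r' \<otimes> s) \<in> I" using *(3) r' I.I_l_closed R_sub by simp
    then show ?thesis unfolding lead_coeffs_def using low_mult[OF r' *(1)] *(2) r' R_closed(4) by blast
  qed
  have n: "\<ominus> r \<in> lead_coeffs I d" if "r \<in> lead_coeffs I d" for r
  proof -
    have r: "r \<in> carrier T" using that R_sub by (simp add: lead_coeffs_def)
    have "\<ominus> r = (\<ominus> \<one>) \<otimes> r" using r by (simp add: l_minus)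
    then show ?thesis using m[OF that, of "\<ominus> \<one>"] R_closed(2,5) by simp
  qed
  have ng: "inv\<^bsub>add_monoid (T\<lparr>carrier := R\<rparr>)\<^esub> r = \<ominus> r" if "r \<in> R" for r
  proof -
    have "\<ominus>\<^bsub>T\<lparr>carrier := R\<rparr>\<^esub> r = \<ominus> r"
      using that R_sub by (intro R.minus_equality) (auto simp: l_neg)
    then show ?thesis by (simp add: a_inv_def)
  qed
  have sub: "lead_coeffs I d \<subseteq> R" by (auto simp: lead_coeffs_def)
  show ?thesis
  proof (rule idealI)
    show "ring (T\<lparr>carrier := R\<rparr>)" ..
    show "subgroup (lead_coeffs I d) (add_monoid (T\<lparr>carrier := R\<rparr>))"
      using z a n sub ng by (intro subgroup.intro) (auto simp: subset_iff)
    show "x \<otimes>\<^bsub>T\<lparr>carrier := R\<rparr>\<^esub> a \<in> lead_coeffs I d" if "a \<in> lead_coeffs I d" "x \<in> carrier (T\<lparr>carrier := R\<rparr>)" for a x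
      using m that by simp
    show "a \<otimes>\<^bsub>T\<lparr>carrier := R\<rparr>\<^esub> x \<in> lead_coeffs I d" if "a \<in> lead_coeffs I d" "x \<in> carrier (T\<lparr>carrier := R\<rparr>)" for a x
    proof -
      have "a \<otimes>\<^bsub>T\<lparr>carrier := R\<rparr>\<^esub> x = x \<otimes>\<^bsub>T\<lparr>carrier := R\<rparr>\<^esub> a"
        using that sub by (intro R.m_comm) auto
      then show ?thesis using m that by simp
    qed
  qed
qed

lemma lead_coeffs_Suc:
  assumes "ideal I T"
  shows "lead_coeffs I d \<subseteq> lead_coeffs I (Suc d)"
proof
  interpret I: ideal I T by fact
  fix r assume "r \<in> lead_coeffs I d"
  then obtain s where *: "s \<in> low d" "r \<in> R" "r \<otimes> t [^] d \<oplus> s \<in> I" unfolding lead_coeffs_def by auto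
  have "r \<otimes> t [^] Suc d \<oplus> t \<otimes> s = t \<otimes> (r \<otimes> t [^] d \<oplus> s)"
    using * by (simp add: R_sub low_sub r_distr m_ac)
  then have "r \<otimes> t [^] Suc d \<oplus> t \<otimes> s \<in> I" using * I.I_l_closed by auto
  then show "r \<in> lead_coeffs I (Suc d)" unfolding lead_coeffs_def using * low_shift by blast
qed

lemma lead_coeffs_mono: "ideal I T \<Longrightarrow> d \<le> e \<Longrightarrow> lead_coeffs I d \<subseteq> lead_coeffs I e"
  using lift_Suc_mono_le[of "lead_coeffs I"] lead_coeffs_Suc by blast

text \<open>Subtracting from x an element of J with the same top term leaves an element of I that is
  one step lower in the filtration; at the bottom only zero is left.\<close>

lemma subset_if_lead_coeffs_subset:
  assumes I: "ideal I T" and J: "ideal J T" and JI: "J \<subseteq> I"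
    and lead_coeffs: "\<And>d. lead_coeffs I d \<subseteq> lead_coeffs J d"
  shows "x \<in> I \<Longrightarrow> x \<in> low d \<Longrightarrow> x \<in> J"
proof (induction d arbitrary: x)
  case 0
  then show ?case using J additive_subgroup.zero_closed ideal.axioms(1) by fastforce
next
  interpret I: ideal I T by fact
  interpret J: ideal J T by fact
  case (Suc d)
  then obtain r s where *: "x = r \<otimes> t [^] d \<oplus> s" "r \<in> R" "s \<in> low d" by auto
  then have "r \<in> lead_coeffs I d" using Suc.prems unfolding lead_coeffs_def by auto
  then have "r \<in> lead_coeffs J d" using lead_coeffs by auto
  then obtain s' where s': "s' \<in> low d" "r \<otimes> t [^] d \<oplus> s' \<in> J" unfolding lead_coeffs_def by auto
  have d: "x \<oplus> \<ominus> (r \<otimes> t [^] d \<oplus> s') = s \<oplus> \<ominus> s'"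
    using * s' by (simp add: R_sub low_sub minus_add a_ac r_neg1)
       (metis R_sub a_ac(1) a_ac(2) add.inv_closed add.m_closed l_neg l_zero low_sub m_closed nat_pow_closed t_closed)
  have "x \<oplus> \<ominus> (r \<otimes> t [^] d \<oplus> s') \<in> I"
    using Suc.prems s' JI by (meson I.a_closed I.a_inv_closed subsetD)
  then have "s \<oplus> \<ominus> s' \<in> J" using d Suc.IH *(3) s' low_add low_minus by metis
  then have "(s \<oplus> \<ominus> s') \<oplus> (r \<otimes> t [^] d \<oplus> s') \<in> J" using s' J.a_closed by auto
  moreover have "(x \<oplus> \<ominus> (r \<otimes> t [^] d \<oplus> s')) \<oplus> (r \<otimes> t [^] d \<oplus> s') = x"
    using * s' by (simp add: R_sub low_sub a_assoc l_neg)
  ultimately show ?case unfolding d by argo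
qed

text \<open>The leading coefficients of I form an ascending chain of ideals of R, which stops at
  some n. Lifts to I of finitely many generators in each degree up to n generate an ideal with the
  same leading coefficients as I in all degrees, hence equal to I.\<close>

theorem hilbert_step:
  assumes noeth: "noetherian_ring (T\<lparr>carrier := R\<rparr>)"
    and span: "\<And>x. x \<in> carrier T \<Longrightarrow> \<exists>d. x \<in> low d"
  shows "noetherian_ring T"
proof (rule noetherian_ringI)
  fix I assume I: "ideal I T"
  interpret I: ideal I T by fact
  interpret N: noetherian_ring "T\<lparr>carrier := R\<rparr>" by fact
  let ?R = "T\<lparr>carrier := R\<rparr>"
  have "subset.chain {I. ideal I ?R} (range (lead_coeffs I))"
  proof (unfold subset_chain_def, intro conjI ballI)
    show "range (lead_coeffs I) \<subseteq> {I. ideal I ?R}" using lead_coeffs_ideal[OF I] by blast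
    fix x y assume "x \<in> range (lead_coeffs I)" "y \<in> range (lead_coeffs I)"
    then obtain d e where "x = lead_coeffs I d" "y = lead_coeffs I e" by blast
    then show "x \<subseteq> y \<or> y \<subseteq> x" using lead_coeffs_mono[OF I] nat_le_linear[of d e] by metis
  qed
  then have "\<Union>(range (lead_coeffs I)) \<in> range (lead_coeffs I)" using N.ideal_chain_is_trivial by blast
  then obtain n where n: "\<Union>(range (lead_coeffs I)) = lead_coeffs I n" by auto
  have "\<exists>B \<subseteq> R. finite B \<and> lead_coeffs I d = Idl\<^bsub>?R\<^esub> B" for d
    using N.finetely_gen[OF lead_coeffs_ideal[OF I]] by auto
  then obtain B where B: "\<And>d. B d \<subseteq> R" "\<And>d. finite (B d)" "\<And>d. lead_coeffs I d = Idl\<^bsub>?R\<^esub> (B d)" by metis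
  \<comment> \<open>Each chosen generator r in degree d lifts to an element of I with top term r
    t^d.\<close>
  have "\<exists>x. r \<in> B d \<longrightarrow> x \<in> I \<and> (\<exists>s \<in> low d. x = r \<otimes> t [^] d \<oplus> s)" for r d
  proof (cases "r \<in> B d")
    case True
    have "B d \<subseteq> Idl\<^bsub>?R\<^esub> (B d)" using B(1)[of d] by (intro N.genideal_self) simp
    then have "r \<in> lead_coeffs I d" using True B(3) by blast
    then show ?thesis unfolding lead_coeffs_def by auto
  qed simp
  then obtain w where "\<forall>d r. r \<in> B d \<longrightarrow> w d r \<in> I \<and> (\<exists>s \<in> low d. w d r = r \<otimes> t [^] d \<oplus> s)"
    by (atomize_elim, intro choice allI)
  then have w: "\<And>r d. r \<in> B d \<Longrightarrow> w d r \<in> I"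
    "\<And>r d. r \<in> B d \<Longrightarrow> \<exists>s \<in> low d. w d r = r \<otimes> t [^] d \<oplus> s" by simp_all
  define F where "F = (\<Union>d\<le>n. w d ` B d)"
  have F: "finite F" "F \<subseteq> I" using B(2) w(1) by (auto simp: F_def)
  have Fc: "F \<subseteq> carrier T" using F I.a_subset by blast
  have J: "ideal (Idl F) T" by (rule genideal_ideal[OF Fc])
  have JI: "Idl F \<subseteq> I" using genideal_minimal[OF I F(2)] .
  have B': "B d \<subseteq> M \<Longrightarrow> ideal M ?R \<Longrightarrow> lead_coeffs I d \<subseteq> M" for M d
    unfolding B(3) by (rule N.genideal_minimal)
  have le: "lead_coeffs I d \<subseteq> lead_coeffs (Idl F) d" if "d \<le> n" for d
  proof -
    have "B d \<subseteq> lead_coeffs (Idl F) d"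
    proof
      fix r assume r: "r \<in> B d"
      have "w d r \<in> Idl F" using genideal_self[OF Fc] r that by (auto simp: F_def)
      then show "r \<in> lead_coeffs (Idl F) d" using w(2)[OF r] r B(1) unfolding lead_coeffs_def by fastforce
    qed
    then show ?thesis using B' lead_coeffs_ideal[OF J] by blast
  qed
  have "lead_coeffs I d \<subseteq> lead_coeffs (Idl F) d" for d
  proof (cases "d \<le> n")
    case False
    \<comment> \<open>Beyond n the ideals of I have stopped growing, while those of
      \<open>Idl F\<close> keep what they contained at n.\<close>
    have "lead_coeffs I d \<subseteq> lead_coeffs I n" using n by blast
    also have "\<dots> \<subseteq> lead_coeffs (Idl F) n" using le by blast
    also have "\<dots> \<subseteq> lead_coeffs (Idl F) d" using lead_coeffs_mono[OF J] False by simp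
    finally show ?thesis .
  qed (rule le)
  then have lead_coeffs: "x \<in> Idl F" if "x \<in> I" "x \<in> low d" for x d
    using subset_if_lead_coeffs_subset[OF I J JI _ that] by simp
  have "I \<subseteq> Idl F"
  proof
    fix x assume "x \<in> I"
    then show "x \<in> Idl F" using lead_coeffs span[of x] I.Icarr by blast
  qed
  with JI F Fc show "\<exists>A\<subseteq>carrier T. finite A \<and> I = Idl A" by blast
qed

end

section \<open>Algebras and their homomorphisms\<close>

lemma algebra_cring: "algebra k R \<Longrightarrow> cring R"
  by (rule algebra.M_cring)

lemma
  assumes "algebra k R"
  shows algebra_add: "a \<in> carrier R \<Longrightarrow> b \<in> carrier R \<Longrightarrow> a \<oplus>\<^bsub>R\<^esub> b \<in> carrier R"
    and algebra_mult: "a \<in> carrier R \<Longrightarrow> b \<in> carrier R \<Longrightarrow> a \<otimes>\<^bsub>R\<^esub> b \<in> carrier R"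
    and algebra_one: "\<one>\<^bsub>R\<^esub> \<in> carrier R"
    and algebra_zero: "\<zero>\<^bsub>R\<^esub> \<in> carrier R"
    and algebra_smult: "c \<in> carrier k \<Longrightarrow> a \<in> carrier R \<Longrightarrow> c \<odot>\<^bsub>R\<^esub> a \<in> carrier R"
    and algebra_minus: "a \<in> carrier R \<Longrightarrow> \<ominus>\<^bsub>R\<^esub> a \<in> carrier R"
proof -
  interpret algebra k R by fact
  show "a \<in> carrier R \<Longrightarrow> b \<in> carrier R \<Longrightarrow> a \<oplus>\<^bsub>R\<^esub> b \<in> carrier R"
    "a \<in> carrier R \<Longrightarrow> b \<in> carrier R \<Longrightarrow> a \<otimes>\<^bsub>R\<^esub> b \<in> carrier R"
    "\<one>\<^bsub>R\<^esub> \<in> carrier R" "\<zero>\<^bsub>R\<^esub> \<in> carrier R"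
    "c \<in> carrier k \<Longrightarrow> a \<in> carrier R \<Longrightarrow> c \<odot>\<^bsub>R\<^esub> a \<in> carrier R"
    "a \<in> carrier R \<Longrightarrow> \<ominus>\<^bsub>R\<^esub> a \<in> carrier R"
    by simp_all
qed

lemmas algebra_closed = algebra_add algebra_mult algebra_one algebra_zero algebra_smult algebra_minus

lemma alg_homI:
  assumes "\<And>a. a \<in> carrier R \<Longrightarrow> f a \<in> carrier S"
    and "\<And>a b. a \<in> carrier R \<Longrightarrow> b \<in> carrier R \<Longrightarrow> f (a \<oplus>\<^bsub>R\<^esub> b) = f a \<oplus>\<^bsub>S\<^esub> f b"
    and "\<And>a b. a \<in> carrier R \<Longrightarrow> b \<in> carrier R \<Longrightarrow> f (a \<otimes>\<^bsub>R\<^esub> b) = f a \<otimes>\<^bsub>S\<^esub> f b"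
    and "f \<one>\<^bsub>R\<^esub> = \<one>\<^bsub>S\<^esub>"
    and "\<And>c a. c \<in> carrier k \<Longrightarrow> a \<in> carrier R \<Longrightarrow> f (c \<odot>\<^bsub>R\<^esub> a) = c \<odot>\<^bsub>S\<^esub> f a"
    and "f \<in> extensional (carrier R)"
  shows "f \<in> alg_hom k R S"
  using assms unfolding alg_hom_def ring_hom_def by auto

lemma
  assumes "f \<in> alg_hom k R S"
  shows alg_hom_closed: "a \<in> carrier R \<Longrightarrow> f a \<in> carrier S"
    and alg_hom_add: "a \<in> carrier R \<Longrightarrow> b \<in> carrier R \<Longrightarrow> f (a \<oplus>\<^bsub>R\<^esub> b) = f a \<oplus>\<^bsub>S\<^esub> f b"
    and alg_hom_mult: "a \<in> carrier R \<Longrightarrow> b \<in> carrier R \<Longrightarrow> f (a \<otimes>\<^bsub>R\<^esub> b) = f a \<otimes>\<^bsub>S\<^esub> f b"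
    and alg_hom_one: "f \<one>\<^bsub>R\<^esub> = \<one>\<^bsub>S\<^esub>"
    and alg_hom_smult: "c \<in> carrier k \<Longrightarrow> a \<in> carrier R \<Longrightarrow> f (c \<odot>\<^bsub>R\<^esub> a) = c \<odot>\<^bsub>S\<^esub> f a"
    and alg_hom_extensional: "f \<in> extensional (carrier R)"
    and alg_hom_ring_hom: "f \<in> ring_hom R S"
  using assms unfolding alg_hom_def ring_hom_def by auto

lemma alg_hom_zero:
  "f \<in> alg_hom k R S \<Longrightarrow> algebra k R \<Longrightarrow> algebra k S \<Longrightarrow> f \<zero>\<^bsub>R\<^esub> = \<zero>\<^bsub>S\<^esub>"
  by (rule ring_hom_zero[OF alg_hom_ring_hom]) (simp_all add: algebra_cring cring.axioms)

lemma alg_hom_minus: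
  assumes f: "f \<in> alg_hom k R S" and R: "algebra k R" and S: "algebra k S" and a: "a \<in> carrier R"
  shows "f (\<ominus>\<^bsub>R\<^esub> a) = \<ominus>\<^bsub>S\<^esub> f a"
proof -
  interpret ring_hom_ring R S f
    using f R S by (intro ring_hom_ringI2) (auto simp: alg_hom_ring_hom algebra_cring cring.axioms)
  show ?thesis using a by (rule hom_a_inv)
qed

lemma alg_hom_eqI:
  assumes "f \<in> alg_hom k R S" "g \<in> alg_hom k R S" "\<And>a. a \<in> carrier R \<Longrightarrow> f a = g a"
  shows "f = g"
  using assms by (meson alg_hom_extensional extensionalityI)

lemma alg_hom_compose:
  assumes "algebra k R" "f \<in> alg_hom k R S" "g \<in> alg_hom k S T"
  shows "compose (carrier R) g f \<in> alg_hom k R T"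
  using assms alg_hom_closed[OF assms(2)] algebra_closed[OF assms(1)]
  by (intro alg_homI) (auto simp: compose_def alg_hom_closed alg_hom_add alg_hom_mult alg_hom_one
      alg_hom_smult)

lemma alg_hom_id: "algebra k R \<Longrightarrow> (\<lambda>x\<in>carrier R. x) \<in> alg_hom k R R"
  using algebra_closed[of k R] by (intro alg_homI) auto

lemma compose_alg_id: "x \<in> alg_hom k A R \<Longrightarrow> compose (carrier A) (\<lambda>x\<in>carrier R. x) x = x"
  by (rule extensionalityI[of _ "carrier A"])
    (auto simp: compose_def alg_hom_extensional alg_hom_closed)

lemma compose_alg_assoc:
  assumes "x \<in> alg_hom k A R"
  shows "compose (carrier A) h (compose (carrier A) g x) = compose (carrier A) (compose (carrier R) h g) x"
  using alg_hom_closed[OF assms] by (auto simp: compose_def fun_eq_iff)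

section \<open>Finitely generated algebras\<close>

text \<open>Negatives arise from the constant -1. With the constants included, the empty set
  generates the image of k, the base case of the Hilbert basis theorem.\<close>

inductive_set gen :: "'k ring \<Rightarrow> ('k, 'a) module \<Rightarrow> 'a set \<Rightarrow> 'a set"
  for k T F where
    gen_const: "c \<in> carrier k \<Longrightarrow> c \<odot>\<^bsub>T\<^esub> \<one>\<^bsub>T\<^esub> \<in> gen k T F"
  | gen_incl: "a \<in> F \<Longrightarrow> a \<in> gen k T F"
  | gen_add: "a \<in> gen k T F \<Longrightarrow> b \<in> gen k T F \<Longrightarrow> a \<oplus>\<^bsub>T\<^esub> b \<in> gen k T F"
  | gen_mult: "a \<in> gen k T F \<Longrightarrow> b \<in> gen k T F \<Longrightarrow> a \<otimes>\<^bsub>T\<^esub> b \<in> gen k T F"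

lemma gen_closed:
  assumes "algebra k T" "F \<subseteq> carrier T" "x \<in> gen k T F"
  shows "x \<in> carrier T"
  using assms(3) by induction (use assms(2) algebra_closed[OF assms(1)] in auto)

lemma gen_mono:
  assumes "x \<in> gen k T F" "F \<subseteq> gen k T F'"
  shows "x \<in> gen k T F'"
  using assms(1) by induction (use assms(2) in \<open>auto intro: gen.intros\<close>)

lemma gen_image:
  assumes S: "algebra k S" and F: "F \<subseteq> carrier S" and f: "f \<in> alg_hom k S T"
    and "x \<in> gen k S F"
  shows "f x \<in> gen k T (f ` F)"
  using assms(4)
proof induction
  case (gen_const c)
  then show ?case using alg_hom_smult[OF f] alg_hom_one[OF f] algebra_one[OF S]
    by (simp add: gen.gen_const)
next
  case (gen_add a b)
  then show ?case using alg_hom_add[OF f] gen_closed[OF S F] by (simp add: gen.gen_add)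
next
  case (gen_mult a b)
  then show ?case using alg_hom_mult[OF f] gen_closed[OF S F] by (simp add: gen.gen_mult)
qed (auto intro: gen.intros)

lemma gen_subcring:
  assumes T: "algebra k T" and F: "F \<subseteq> carrier T"
  shows "subcring (gen k T F) T"
proof -
  interpret algebra k T by fact
  note c = gen_closed[OF T F]
  have one: "\<one>\<^bsub>T\<^esub> \<in> gen k T F" using gen_const[of "\<one>\<^bsub>k\<^esub>" k T F] by simp
  have neg: "\<ominus>\<^bsub>T\<^esub> h \<in> gen k T F" if h: "h \<in> gen k T F" for h
  proof -
    have "(\<ominus>\<^bsub>k\<^esub> \<one>\<^bsub>k\<^esub>) \<odot>\<^bsub>T\<^esub> \<one>\<^bsub>T\<^esub> \<otimes>\<^bsub>T\<^esub> h = \<ominus>\<^bsub>T\<^esub> h"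
      using c[OF h] by (simp add: smult_assoc2 smult_l_minus l_minus)
    then show ?thesis using gen_mult[OF gen_const[of "\<ominus>\<^bsub>k\<^esub> \<one>\<^bsub>k\<^esub>" k T F] h] by simp
  qed
  show ?thesis using c one neg by (intro subcringI' subringI) (auto intro: gen.intros)
qed

text \<open>The induction adjoins the generators one at a time inside the fixed algebra T, so each
  step is \<open>hilbert_step\<close> and no polynomial ring enters. In the base case the ring is
  the image of the field k, where an ideal with a nonzero element contains 1.\<close>

theorem hilbert_basis:
  assumes k: "field k" and T: "algebra k T" and F: "finite F" "F \<subseteq> carrier T"
  shows "noetherian_ring (T\<lparr>carrier := gen k T F\<rparr>)"
  using F
proof (induction F)
  case empty
  interpret field k by fact
  interpret T: algebra k T by fact
  let ?S = "T\<lparr>carrier := gen k T {}\<rparr>"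
  have el: "\<exists>c \<in> carrier k. x = c \<odot>\<^bsub>T\<^esub> \<one>\<^bsub>T\<^esub>" if "x \<in> gen k T {}" for x
    using that
  proof induction
    case (gen_add a b)
    then obtain c d where "c \<in> carrier k" "d \<in> carrier k"
      "a = c \<odot>\<^bsub>T\<^esub> \<one>\<^bsub>T\<^esub>" "b = d \<odot>\<^bsub>T\<^esub> \<one>\<^bsub>T\<^esub>" by auto
    then show ?case by (intro bexI[of _ "c \<oplus>\<^bsub>k\<^esub> d"]) (simp_all add: T.smult_l_distr)
  next
    case (gen_mult a b)
    then obtain c d where cd: "c \<in> carrier k" "d \<in> carrier k"
      "a = c \<odot>\<^bsub>T\<^esub> \<one>\<^bsub>T\<^esub>" "b = d \<odot>\<^bsub>T\<^esub> \<one>\<^bsub>T\<^esub>" by auto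
    then have "a \<otimes>\<^bsub>T\<^esub> b = (c \<otimes>\<^bsub>k\<^esub> d) \<odot>\<^bsub>T\<^esub> \<one>\<^bsub>T\<^esub>"
      by (simp add: T.smult_assoc2 T.smult_assoc1)
    then show ?case using cd by auto
  qed auto
  have S: "cring ?S"
    using gen_subcring[OF T] T.subcring_iff[of "gen k T {}"] gen_closed[OF T] by blast
  then interpret S: cring ?S .
  show ?case
  proof (rule S.noetherian_ringI)
    fix I assume I: "ideal I ?S"
    interpret I: ideal I ?S by fact
    show "\<exists>A\<subseteq>carrier ?S. finite A \<and> I = Idl\<^bsub>?S\<^esub> A"
    proof (cases "I = {\<zero>\<^bsub>?S\<^esub>}")
      case True
      then show ?thesis using S.genideal_zero by (metis S.zero_closed empty_subsetI finite.emptyI finite_insert insert_subset)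
    next
      case False
      then obtain x where x: "x \<in> I" "x \<noteq> \<zero>\<^bsub>T\<^esub>" using I.zero_closed by auto
      then have xc: "x \<in> gen k T {}" using I.a_subset by auto
      then obtain c where c: "c \<in> carrier k" "x = c \<odot>\<^bsub>T\<^esub> \<one>\<^bsub>T\<^esub>" using el by blast
      have "c \<noteq> \<zero>\<^bsub>k\<^esub>" using x c by auto
      then have u: "inv\<^bsub>k\<^esub> c \<in> carrier k" "inv\<^bsub>k\<^esub> c \<otimes>\<^bsub>k\<^esub> c = \<one>\<^bsub>k\<^esub>"
        using c field_Units by auto
      have "(inv\<^bsub>k\<^esub> c \<odot>\<^bsub>T\<^esub> \<one>\<^bsub>T\<^esub>) \<otimes>\<^bsub>T\<^esub> x = \<one>\<^bsub>T\<^esub>"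
        using u c by (simp add: T.smult_assoc2 T.smult_assoc1[symmetric])
      moreover have "(inv\<^bsub>k\<^esub> c \<odot>\<^bsub>T\<^esub> \<one>\<^bsub>T\<^esub>) \<otimes>\<^bsub>T\<^esub> x \<in> I"
        using I.I_l_closed[OF x(1), of "inv\<^bsub>k\<^esub> c \<odot>\<^bsub>T\<^esub> \<one>\<^bsub>T\<^esub>"] u gen_const[OF u(1), of T] by simp
      ultimately have "I = carrier ?S" using I.one_imp_carrier by simp
      then show ?thesis using S.genideal_one by (metis S.one_closed empty_subsetI finite.emptyI finite_insert insert_subset)
    qed
  qed
next
  case (insert t F)
  interpret T: algebra k T by fact
  let ?S = "T\<lparr>carrier := gen k T (insert t F)\<rparr>" and ?R = "gen k T F"
  have F: "F \<subseteq> carrier T" and tF: "insert t F \<subseteq> carrier T" using insert by auto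
  have S: "cring ?S"
    using gen_subcring[OF T tF] T.subcring_iff gen_closed[OF T tF] by blast
  then interpret S: cring ?S .
  have RS: "?R \<subseteq> carrier ?S"
  proof
    fix x assume "x \<in> ?R"
    moreover have "F \<subseteq> gen k T (insert t F)" by (simp add: gen_incl subset_iff)
    ultimately show "x \<in> carrier ?S" using gen_mono by fastforce
  qed
  have "cring (T\<lparr>carrier := ?R\<rparr>)"
    using gen_subcring[OF T F] T.subcring_iff gen_closed[OF T F] by blast
  then have R: "subcring ?R ?S" using S.subcring_iff[OF RS] by simp
  have t: "t \<in> carrier ?S" using gen_incl[of t "insert t F" k T] by simp
  interpret adjoin_elt ?S ?R t by (intro adjoin_elt.intro adjoin_elt_axioms.intro S R t)
  have low1: "r \<in> ?R \<Longrightarrow> r \<in> low 1" for r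
  proof -
    assume r: "r \<in> ?R"
    then have "r = r \<otimes>\<^bsub>?S\<^esub> t [^]\<^bsub>?S\<^esub> (0::nat) \<oplus>\<^bsub>?S\<^esub> \<zero>\<^bsub>?S\<^esub>" using gen_closed[OF T F r] by simp
    with r low_zero[of 0] show "r \<in> low 1" unfolding One_nat_def low.simps by blast
  qed
  have "\<exists>d. x \<in> low d" if "x \<in> gen k T (insert t F)" for x
    using that
  proof induction
    case (gen_const c)
    show ?case by (rule exI, rule low1, rule gen.gen_const) fact
  next
    case (gen_incl a)
    then consider "a = t" | "a \<in> F" by auto
    then show ?case
    proof cases
      case 1
      have "\<one>\<^bsub>?S\<^esub> \<in> low 1" by (rule low1[OF R_closed(2)])
      then have "t \<otimes>\<^bsub>?S\<^esub> \<one>\<^bsub>?S\<^esub> \<in> low (Suc 1)" by (rule low_shift)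
      moreover have "t \<otimes>\<^bsub>?S\<^esub> \<one>\<^bsub>?S\<^esub> = t" using S.r_one[OF t] .
      ultimately have "a \<in> low (Suc 1)" using 1 by argo
      then show ?thesis by blast
    next
      case 2
      show ?thesis by (rule exI, rule low1, rule gen.gen_incl) fact
    qed
  next
    case (gen_add a b)
    then obtain d e where de: "a \<in> low d" "b \<in> low e" by blast
    have "a \<in> low (d + e)" by (rule low_mono[OF de(1)]) simp
    moreover have "b \<in> low (d + e)" by (rule low_mono[OF de(2)]) simp
    ultimately have "a \<oplus>\<^bsub>?S\<^esub> b \<in> low (d + e)" by (rule low_add)
    then have "a \<oplus>\<^bsub>T\<^esub> b \<in> low (d + e)" by simp
    then show ?case by blast
  next
    case (gen_mult a b)
    then obtain d e where de: "a \<in> low d" "b \<in> low e" by blast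
    have "\<exists>d. a \<otimes>\<^bsub>?S\<^esub> b \<in> low d" by (rule low_prod[OF de(2,1)])
    then show ?case by simp
  qed
  then have "noetherian_ring ?S" using insert by (intro hilbert_step) simp_all
  then show ?case .
qed

definition fg_alg :: "'k ring \<Rightarrow> ('k, 'a) module \<Rightarrow> bool" where
  "fg_alg k T \<longleftrightarrow> (\<exists>F. finite F \<and> F \<subseteq> carrier T \<and> carrier T \<subseteq> gen k T F)"

lemma fg_alg_noetherian:
  assumes "field k" "algebra k T" "fg_alg k T"
  shows "noetherian_ring T"
proof -
  obtain F where F: "finite F" "F \<subseteq> carrier T" "carrier T \<subseteq> gen k T F"
    using assms(3) unfolding fg_alg_def by blast
  then have "gen k T F = carrier T" using gen_closed[OF assms(2) F(2)] by blast
  then show ?thesis using hilbert_basis[OF assms(1,2) F(1,2)] by simp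
qed

lemma fg_alg_image:
  assumes S: "algebra k S" "fg_alg k S" and f: "f \<in> alg_hom k S T" "f ` carrier S = carrier T"
  shows "fg_alg k T"
proof -
  obtain F where F: "finite F" "F \<subseteq> carrier S" "carrier S \<subseteq> gen k S F"
    using assms(2) unfolding fg_alg_def by blast
  have "carrier T \<subseteq> gen k T (f ` F)"
    unfolding f(2)[symmetric] using gen_image[OF S(1) F(2) f(1)] F(3) by blast
  then show ?thesis using F(1,2) f(2) unfolding fg_alg_def
    by (intro exI[of _ "f ` F"]) (auto simp: alg_hom_closed[OF f(1)])
qed

section \<open>Finitely presented algebras\<close>

text \<open>The product in \<open>mpoly_alg\<close> is a \<open>finsum\<close> over these pairs,
  which is a genuine sum only when they are finite in number.\<close>

lemma finite_mset_decomp: "finite {(a, b). a + b = (m :: 'a multiset)}"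
proof (induction m)
  case empty
  have "{(a, b). a + b = ({#} :: 'a multiset)} = {({#}, {#})}" by auto
  then show ?case by simp
next
  case (add x m)
  let ?D = "{(a, b). a + b = m}"
  have "{(a, b). a + b = add_mset x m} \<subseteq>
    (\<lambda>(a, b). (add_mset x a, b)) ` ?D \<union> (\<lambda>(a, b). (a, add_mset x b)) ` ?D"
  proof clarify
    fix a b assume ab: "a + b = add_mset x m" and n: "(a, b) \<notin> (\<lambda>(a, b). (a, add_mset x b)) ` ?D"
    have "x \<in># a + b" using ab by simp
    then consider "x \<in># a" | "x \<in># b" by auto
    then show "(a, b) \<in> (\<lambda>(a, b). (add_mset x a, b)) ` ?D"
    proof cases
      case 1
      then obtain a' where "a = add_mset x a'" by (meson multi_member_split)
      then show ?thesis using ab by (auto intro!: image_eqI[of _ _ "(a', b)"])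
    next
      case 2
      then obtain b' where "b = add_mset x b'" by (meson multi_member_split)
      then show ?thesis using ab n by (auto intro!: image_eqI[of _ _ "(a, b')"])
    qed
  qed
  then show ?case by (rule finite_subset) (simp add: add)
qed

text \<open>
  If there were no ideals, the generated ideal of a presentation would be the intersection of
  the empty family and could not consist of finitely supported functions.
\<close>

lemma finitely_presented_mpoly_ring:
  assumes "field k" and "finitely_presented k A"
  obtains n \<phi> where "ring (mpoly_alg k n)" "\<phi> \<in> alg_hom k (mpoly_alg k n) A"
    "\<phi> ` carrier (mpoly_alg k n) = carrier A"
proof -
  interpret field k by fact
  obtain n \<phi> F where *: "\<phi> \<in> alg_hom k (mpoly_alg k n) A"
    "\<phi> ` carrier (mpoly_alg k n) = carrier A" "F \<subseteq> carrier (mpoly_alg k n)"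
    "a_kernel (mpoly_alg k n) A \<phi> = Idl\<^bsub>mpoly_alg k n\<^esub> F"
    using assms(2) unfolding finitely_presented_def by blast
  have "ring (mpoly_alg k n)"
  proof (rule ccontr)
    assume "\<not> ring (mpoly_alg k n)"
    then have "Idl\<^bsub>mpoly_alg k n\<^esub> F = UNIV" unfolding genideal_def using ideal.axioms(2) by blast
    then have "(\<lambda>m. \<one>\<^bsub>k\<^esub>) \<in> carrier (mpoly_alg k n)"
      using *(4) by (auto simp: a_kernel_def kernel_def)
    then have "finite (UNIV :: nat multiset set)" by (simp add: mpoly_alg_def)
    then have "finite (range (\<lambda>i::nat. {#i#}))" by (rule rev_finite_subset) simp
    moreover have "inj (\<lambda>i::nat. {#i#})" by (rule injI) simp
    ultimately show False using finite_imageD infinite_UNIV_nat by blast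
  qed
  with * show ?thesis using that by blast
qed

text \<open>\<open>ring_P\<close> is an assumption because any finitely presented algebra already
  supplies it, through \<open>finitely_presented_mpoly_ring\<close>. Commutativity and the scalar
  laws remain to be checked.\<close>

locale mpoly_ring = k?: field k for k :: "'k ring" (structure) +
  fixes n :: nat
  assumes ring_P: "ring (mpoly_alg k n)"
begin

abbreviation "P \<equiv> mpoly_alg k n"

sublocale P?: ring P by (rule ring_P)

lemma P_carrier: "p \<in> carrier P \<longleftrightarrow> (\<forall>m. p m \<in> carrier k) \<and> finite {m. p m \<noteq> \<zero>} \<and>
    (\<forall>m. p m \<noteq> \<zero> \<longrightarrow> set_mset m \<subseteq> {..<n})"
  by (simp add: mpoly_alg_def)

lemma P_simps:
  "\<zero>\<^bsub>P\<^esub> = (\<lambda>m. \<zero>)" "\<one>\<^bsub>P\<^esub> = (\<lambda>m. if m = {#} then \<one> else \<zero>)"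
  "p \<oplus>\<^bsub>P\<^esub> q = (\<lambda>m. p m \<oplus> q m)" "c \<odot>\<^bsub>P\<^esub> p = (\<lambda>m. c \<otimes> p m)"
  by (simp_all add: mpoly_alg_def)

lemma P_mult: "(p \<otimes>\<^bsub>P\<^esub> q) m = finsum k (\<lambda>(a, b). p a \<otimes> q b) {(a, b). a + b = m}"
  by (simp add: mpoly_alg_def)

lemma P_coeff: "p \<in> carrier P \<Longrightarrow> p m \<in> carrier k"
  by (simp add: P_carrier)

lemma P_mult_comm:
  assumes p: "p \<in> carrier P" and q: "q \<in> carrier P"
  shows "p \<otimes>\<^bsub>P\<^esub> q = q \<otimes>\<^bsub>P\<^esub> p"
proof
  fix m
  let ?D = "{(a, b). a + b = m} :: (nat multiset \<times> nat multiset) set"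
  have "finsum k (\<lambda>(a, b). p a \<otimes> q b) (prod.swap ` ?D) = (\<Oplus>x \<in> ?D. case prod.swap x of (a, b) \<Rightarrow> p a \<otimes> q b)"
    using p q by (intro k.finsum_reindex) (auto simp: P_coeff)
  also have "\<dots> = finsum k (\<lambda>(a, b). q a \<otimes> p b) ?D"
    using p q by (intro k.finsum_cong') (auto simp: P_coeff k.m_comm)
  also have "prod.swap ` ?D = ?D" by (auto simp: image_iff add.commute)
  finally show "(p \<otimes>\<^bsub>P\<^esub> q) m = (q \<otimes>\<^bsub>P\<^esub> p) m" by (simp add: P_mult)
qed

lemma P_algebra: "algebra k P"
proof (rule algebraI)
  show "cring k" ..
  show "cring P"
    by (intro cring.intro ring_P comm_monoid.intro comm_monoid_axioms.intro P_mult_comm P.monoid_axioms)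
  show smc: "c \<odot>\<^bsub>P\<^esub> p \<in> carrier P" if "c \<in> carrier k" "p \<in> carrier P" for c p
  proof -
    have "finite {m. c \<otimes> p m \<noteq> \<zero>}"
      by (rule finite_subset[of _ "{m. p m \<noteq> \<zero>}"]) (use that in \<open>auto simp: P_carrier\<close>)
    then show ?thesis using that unfolding P_simps P_carrier by (metis k.m_closed k.r_null)
  qed
  show "(c \<oplus> d) \<odot>\<^bsub>P\<^esub> p = c \<odot>\<^bsub>P\<^esub> p \<oplus>\<^bsub>P\<^esub> d \<odot>\<^bsub>P\<^esub> p"
    if "c \<in> carrier k" "d \<in> carrier k" "p \<in> carrier P" for c d p
    using that by (simp add: P_simps P_coeff k.l_distr)
  show "c \<odot>\<^bsub>P\<^esub> (p \<oplus>\<^bsub>P\<^esub> q) = c \<odot>\<^bsub>P\<^esub> p \<oplus>\<^bsub>P\<^esub> c \<odot>\<^bsub>P\<^esub> q"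
    if "c \<in> carrier k" "p \<in> carrier P" "q \<in> carrier P" for c p q
    using that by (simp add: P_simps P_coeff k.r_distr)
  show "(c \<otimes> d) \<odot>\<^bsub>P\<^esub> p = c \<odot>\<^bsub>P\<^esub> (d \<odot>\<^bsub>P\<^esub> p)"
    if "c \<in> carrier k" "d \<in> carrier k" "p \<in> carrier P" for c d p
    using that by (simp add: P_simps P_coeff k.m_assoc)
  show "\<one> \<odot>\<^bsub>P\<^esub> p = p" if "p \<in> carrier P" for p
    using that by (simp add: P_simps P_coeff)
  show "(c \<odot>\<^bsub>P\<^esub> p) \<otimes>\<^bsub>P\<^esub> q = c \<odot>\<^bsub>P\<^esub> (p \<otimes>\<^bsub>P\<^esub> q)"
    if "c \<in> carrier k" "p \<in> carrier P" "q \<in> carrier P" for c p q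
  proof
    fix m
    let ?D = "{(a, b). a + b = m} :: (nat multiset \<times> nat multiset) set"
    have "c \<otimes> (\<Oplus>x \<in> ?D. case x of (a, b) \<Rightarrow> p a \<otimes> q b) = (\<Oplus>x \<in> ?D. c \<otimes> (case x of (a, b) \<Rightarrow> p a \<otimes> q b))"
      using that by (intro k.finsum_rdistr finite_mset_decomp) (auto simp: P_coeff)
    also have "\<dots> = finsum k (\<lambda>(a, b). (c \<otimes> p a) \<otimes> q b) ?D"
      using that by (intro k.finsum_cong') (auto simp: P_coeff k.m_assoc)
    finally show "((c \<odot>\<^bsub>P\<^esub> p) \<otimes>\<^bsub>P\<^esub> q) m = (c \<odot>\<^bsub>P\<^esub> (p \<otimes>\<^bsub>P\<^esub> q)) m"
      unfolding P_mult P_simps by (simp add: P_mult)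
  qed
qed

definition mono :: "nat multiset \<Rightarrow> nat multiset \<Rightarrow> 'k" where
  "mono m m' = (if m' = m then \<one> else \<zero>)"

lemma mono_closed: "set_mset m \<subseteq> {..<n} \<Longrightarrow> mono m \<in> carrier P"
  unfolding P_carrier mono_def by auto

lemma mono_mult: "mono a \<otimes>\<^bsub>P\<^esub> mono b = mono (a + b)"
proof
  fix m
  let ?D = "{(a, b). a + b = m} :: (nat multiset \<times> nat multiset) set"
  have "(mono a \<otimes>\<^bsub>P\<^esub> mono b) m = (\<Oplus>x \<in> ?D. if x = (a, b) then \<one> else \<zero>)"
    unfolding P_mult by (rule k.finsum_cong') (auto simp: mono_def split: if_split_asm)
  also have "\<dots> = mono (a + b) m"
  proof (cases "m = a + b")
    case True
    then show ?thesis
      using k.add.finprod_singleton_swap[of "(a, b)" ?D "\<lambda>_. \<one>"] finite_mset_decomp[of m]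
      by (simp add: mono_def)
  next
    case False
    then have "(\<Oplus>x \<in> ?D. if x = (a, b) then \<one> else \<zero>) = (\<Oplus>x \<in> ?D. \<zero>)"
      by (intro k.finsum_cong') auto
    with False show ?thesis by (simp add: mono_def)
  qed
  finally show "(mono a \<otimes>\<^bsub>P\<^esub> mono b) m = mono (a + b) m" .
qed

lemma mono_gen: "set_mset m \<subseteq> {..<n} \<Longrightarrow> mono m \<in> gen k P ((\<lambda>i. mono {#i#}) ` {..<n})"
proof (induction m)
  case empty
  have "mono {#} = \<one> \<odot>\<^bsub>P\<^esub> \<one>\<^bsub>P\<^esub>" by (auto simp: P_simps mono_def)
  then show ?case using gen_const[of \<one> k P] by simp
next
  case (add x m)
  have "mono (add_mset x m) = mono {#x#} \<otimes>\<^bsub>P\<^esub> mono m" by (simp add: mono_mult)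
  moreover have "mono {#x#} \<in> gen k P ((\<lambda>i. mono {#i#}) ` {..<n})"
    using add.prems by (intro gen_incl) simp
  moreover have "mono m \<in> gen k P ((\<lambda>i. mono {#i#}) ` {..<n})" using add by simp
  ultimately show ?case by (simp add: gen_mult)
qed

lemma P_gen:
  assumes "finite S" "p \<in> carrier P" "{m. p m \<noteq> \<zero>} \<subseteq> S"
  shows "p \<in> gen k P ((\<lambda>i. mono {#i#}) ` {..<n})"
  using assms
proof (induction S arbitrary: p)
  case empty
  then have "p = \<zero> \<odot>\<^bsub>P\<^esub> \<one>\<^bsub>P\<^esub>" by (auto simp: P_simps fun_eq_iff)
  then show ?case using gen_const[of \<zero> k P] by simp
next
  case (insert m S)
  \<comment> \<open>S only contains the support, so the coefficient erased here may already be
    zero.\<close>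
  let ?q = "p(m := \<zero>)"
  have q: "?q \<in> carrier P" "{m. ?q m \<noteq> \<zero>} \<subseteq> S"
    using insert.prems unfolding P_carrier by (auto elim!: rev_finite_subset)
  show ?case
  proof (cases "p m = \<zero>")
    case True
    then have "?q = p" by auto
    with q insert.IH show ?thesis by metis
  next
    case False
    have m: "mono m \<in> carrier P" using insert.prems False by (intro mono_closed) (simp add: P_carrier)
    have "(p m \<odot>\<^bsub>P\<^esub> \<one>\<^bsub>P\<^esub>) \<otimes>\<^bsub>P\<^esub> mono m = p m \<odot>\<^bsub>P\<^esub> mono m"
      using algebra.smult_assoc2[OF P_algebra P_coeff[OF insert.prems(1)] P.one_closed m]
        P.l_one[OF m] by simp
    moreover have "p = p m \<odot>\<^bsub>P\<^esub> mono m \<oplus>\<^bsub>P\<^esub> ?q"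
      using insert.prems by (auto simp: P_simps mono_def fun_eq_iff P_coeff)
    moreover have "mono m \<in> gen k P ((\<lambda>i. mono {#i#}) ` {..<n})"
      using insert.prems False by (intro mono_gen) (simp add: P_carrier)
    ultimately show ?thesis
      using insert.IH[OF q] insert.prems by (metis gen_add gen_const gen_mult P_coeff)
  qed
qed

lemma P_fg: "fg_alg k P"
  unfolding fg_alg_def
  by (intro exI[of _ "(\<lambda>i. mono {#i#}) ` {..<n}"])
    (auto simp: mono_closed intro!: P_gen[of "{m. _ m \<noteq> \<zero>}"] P_carrier[THEN iffD1, THEN conjunct2, THEN conjunct1])

end

lemma finitely_presented_fg:
  assumes "field k" "finitely_presented k A"
  shows "fg_alg k A"
proof -
  obtain n \<phi> where *: "ring (mpoly_alg k n)" "\<phi> \<in> alg_hom k (mpoly_alg k n) A"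
    "\<phi> ` carrier (mpoly_alg k n) = carrier A"
    using finitely_presented_mpoly_ring[OF assms] .
  interpret mpoly_ring k n using assms(1) *(1) by (simp add: mpoly_ring_def mpoly_ring_axioms_def)
  show ?thesis using fg_alg_image[OF P_algebra P_fg *(2,3)] .
qed

text \<open>The kernel of the composite from a polynomial algebra is an ideal of a Noetherian ring,
  hence finitely generated. So all closed subschemes of X that get constructed are finitely
  presented.\<close>

lemma finitely_presented_quotient:
  assumes "field k" "finitely_presented k A" and D: "algebra k D"
    and f: "f \<in> alg_hom k A D" "f ` carrier A = carrier D"
  shows "finitely_presented k D"
proof -
  obtain n \<phi> where *: "ring (mpoly_alg k n)" "\<phi> \<in> alg_hom k (mpoly_alg k n) A"
    "\<phi> ` carrier (mpoly_alg k n) = carrier A"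
    using finitely_presented_mpoly_ring[OF assms(1,2)] .
  interpret mpoly_ring k n using assms(1) *(1) by (simp add: mpoly_ring_def mpoly_ring_axioms_def)
  let ?\<psi> = "compose (carrier P) f \<phi>"
  have \<psi>: "?\<psi> \<in> alg_hom k P D" using alg_hom_compose[OF P_algebra *(2) f(1)] .
  have sur: "?\<psi> ` carrier P = carrier D"
    using f(2) *(3) by (auto simp: compose_def image_image[symmetric] image_restrict_eq)
  interpret D: algebra k D by fact
  interpret ring_hom_ring P D ?\<psi>
    using \<psi> by (intro ring_hom_ringI2) (auto simp: alg_hom_ring_hom ring_P D.ring_axioms)
  obtain F where "F \<subseteq> carrier P" "finite F" "a_kernel P D ?\<psi> = Idl\<^bsub>P\<^esub> F"
    using noetherian_ring.finetely_gen[OF fg_alg_noetherian[OF assms(1) P_algebra P_fg] kernel_is_ideal]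
    by blast
  with \<psi> sur D show ?thesis unfolding finitely_presented_def by blast
qed

text \<open>The algebra laws are identities, apart from the existence of negatives, and all of them
  pass along a surjection that respects the operations. The target S is a bare record; the lemma is
  applied to cosets and to copies along injections.\<close>

lemma algebra_surj_image:
  assumes T: "algebra k T"
    and add: "\<And>a b. a \<in> carrier T \<Longrightarrow> b \<in> carrier T \<Longrightarrow> f (a \<oplus>\<^bsub>T\<^esub> b) = f a \<oplus>\<^bsub>S\<^esub> f b"
    and mult: "\<And>a b. a \<in> carrier T \<Longrightarrow> b \<in> carrier T \<Longrightarrow> f (a \<otimes>\<^bsub>T\<^esub> b) = f a \<otimes>\<^bsub>S\<^esub> f b"
    and one: "f \<one>\<^bsub>T\<^esub> = \<one>\<^bsub>S\<^esub>" and zero: "f \<zero>\<^bsub>T\<^esub> = \<zero>\<^bsub>S\<^esub>"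
    and smult: "\<And>c a. c \<in> carrier k \<Longrightarrow> a \<in> carrier T \<Longrightarrow> f (c \<odot>\<^bsub>T\<^esub> a) = c \<odot>\<^bsub>S\<^esub> f a"
    and sur: "f ` carrier T = carrier S"
  shows "algebra k S"
proof -
  interpret T: algebra k T by fact
  note hom = add[symmetric] mult[symmetric] one[symmetric] zero[symmetric] smult[symmetric]
  have c: "f a \<in> carrier S" if "a \<in> carrier T" for a using sur that by blast
  have el: "\<exists>a \<in> carrier T. x = f a" if "x \<in> carrier S" for x using sur that by blast
  show ?thesis
  proof (rule algebraI)
    show "cring k" by (rule T.R_cring)
    show "cring S"
    proof (rule cringI)
      show "abelian_group S"
      proof (rule abelian_groupI)
        fix x y assume "x \<in> carrier S" "y \<in> carrier S"
        then obtain a b where ab: "a \<in> carrier T" "b \<in> carrier T" "x = f a" "y = f b" using el by metis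
        show "x \<oplus>\<^bsub>S\<^esub> y \<in> carrier S" using ab by (simp add: hom c)
        show "x \<oplus>\<^bsub>S\<^esub> y = y \<oplus>\<^bsub>S\<^esub> x" using ab by (simp add: hom T.a_comm)
        fix z assume "z \<in> carrier S"
        then obtain d where d: "d \<in> carrier T" "z = f d" using el by metis
        show "x \<oplus>\<^bsub>S\<^esub> y \<oplus>\<^bsub>S\<^esub> z = x \<oplus>\<^bsub>S\<^esub> (y \<oplus>\<^bsub>S\<^esub> z)" using ab d by (simp add: hom T.a_assoc)
      next
        fix x assume "x \<in> carrier S"
        then obtain a where ab: "a \<in> carrier T" "x = f a" using el by metis
        show "\<zero>\<^bsub>S\<^esub> \<oplus>\<^bsub>S\<^esub> x = x" using ab by (simp add: hom)
        show "\<exists>y\<in>carrier S. y \<oplus>\<^bsub>S\<^esub> x = \<zero>\<^bsub>S\<^esub>"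
          using ab by (intro bexI[of _ "f (\<ominus>\<^bsub>T\<^esub> a)"]) (simp_all add: hom T.l_neg c)
      qed (simp add: hom c)
      show "comm_monoid S"
      proof (rule comm_monoidI)
        fix x y assume "x \<in> carrier S" "y \<in> carrier S"
        then obtain a b where ab: "a \<in> carrier T" "b \<in> carrier T" "x = f a" "y = f b" using el by metis
        show "x \<otimes>\<^bsub>S\<^esub> y \<in> carrier S" using ab by (simp add: hom c)
        show "x \<otimes>\<^bsub>S\<^esub> y = y \<otimes>\<^bsub>S\<^esub> x" using ab by (simp add: hom T.m_comm)
        fix z assume "z \<in> carrier S"
        then obtain d where d: "d \<in> carrier T" "z = f d" using el by metis
        show "x \<otimes>\<^bsub>S\<^esub> y \<otimes>\<^bsub>S\<^esub> z = x \<otimes>\<^bsub>S\<^esub> (y \<otimes>\<^bsub>S\<^esub> z)" using ab d by (simp add: hom T.m_assoc)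
      next
        fix x assume "x \<in> carrier S"
        then obtain a where ab: "a \<in> carrier T" "x = f a" using el by metis
        show "\<one>\<^bsub>S\<^esub> \<otimes>\<^bsub>S\<^esub> x = x" using ab by (simp add: hom)
      qed (simp add: hom c)
      fix x y z assume "x \<in> carrier S" "y \<in> carrier S" "z \<in> carrier S"
      then obtain a b d where "a \<in> carrier T" "b \<in> carrier T" "x = f a" "y = f b"
        "d \<in> carrier T" "z = f d" using el by metis
      then show "(x \<oplus>\<^bsub>S\<^esub> y) \<otimes>\<^bsub>S\<^esub> z = x \<otimes>\<^bsub>S\<^esub> z \<oplus>\<^bsub>S\<^esub> y \<otimes>\<^bsub>S\<^esub> z"
        by (simp add: hom T.l_distr)
    qed
  next
    fix r s x assume rs: "r \<in> carrier k" "s \<in> carrier k" and "x \<in> carrier S"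
    then obtain a where a: "a \<in> carrier T" "x = f a" using el by metis
    show "r \<odot>\<^bsub>S\<^esub> x \<in> carrier S" using a rs by (simp add: hom c)
    show "(r \<oplus>\<^bsub>k\<^esub> s) \<odot>\<^bsub>S\<^esub> x = r \<odot>\<^bsub>S\<^esub> x \<oplus>\<^bsub>S\<^esub> s \<odot>\<^bsub>S\<^esub> x"
      using a rs by (simp add: hom T.smult_l_distr)
    show "(r \<otimes>\<^bsub>k\<^esub> s) \<odot>\<^bsub>S\<^esub> x = r \<odot>\<^bsub>S\<^esub> (s \<odot>\<^bsub>S\<^esub> x)"
      using a rs by (simp add: hom T.smult_assoc1)
  next
    fix x assume "x \<in> carrier S"
    then obtain a where a: "a \<in> carrier T" "x = f a" using el by metis
    then show "\<one>\<^bsub>k\<^esub> \<odot>\<^bsub>S\<^esub> x = x" by (simp add: hom)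
  next
    fix r x y assume r: "r \<in> carrier k" and "x \<in> carrier S" "y \<in> carrier S"
    then obtain a b where ab: "a \<in> carrier T" "b \<in> carrier T" "x = f a" "y = f b" using el by metis
    show "r \<odot>\<^bsub>S\<^esub> (x \<oplus>\<^bsub>S\<^esub> y) = r \<odot>\<^bsub>S\<^esub> x \<oplus>\<^bsub>S\<^esub> r \<odot>\<^bsub>S\<^esub> y"
      using ab r by (simp add: hom T.smult_r_distr)
    show "r \<odot>\<^bsub>S\<^esub> x \<otimes>\<^bsub>S\<^esub> y = r \<odot>\<^bsub>S\<^esub> (x \<otimes>\<^bsub>S\<^esub> y)"
      using ab r by (simp add: hom T.smult_assoc2)
  qed
qed

section \<open>Quotient algebras\<close>

lemma
  assumes A: "algebra k A" and I: "ideal I A"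
  shows quot_alg_algebra: "algebra k (quot_alg A I)"
    and quot_alg_hom: "(\<lambda>a\<in>carrier A. I +>\<^bsub>A\<^esub> a) \<in> alg_hom k A (quot_alg A I)"
    and quot_alg_surj: "(\<lambda>a\<in>carrier A. I +>\<^bsub>A\<^esub> a) ` carrier A = carrier (quot_alg A I)"
proof -
  interpret A: algebra k A by fact
  interpret I: ideal I A by fact
  let ?Q = "quot_alg A I" and ?f = "\<lambda>a. I +>\<^bsub>A\<^esub> a"
  have add: "?f (a \<oplus>\<^bsub>A\<^esub> b) = ?f a \<oplus>\<^bsub>?Q\<^esub> ?f b" if "a \<in> carrier A" "b \<in> carrier A" for a b
    using I.a_rcos_sum[OF that] by (simp add: quot_alg_def FactRing_def)
  have mult: "?f (a \<otimes>\<^bsub>A\<^esub> b) = ?f a \<otimes>\<^bsub>?Q\<^esub> ?f b" if "a \<in> carrier A" "b \<in> carrier A" for a b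
    using I.rcoset_mult_add[OF that] by (simp add: quot_alg_def FactRing_def)
  have one: "?f \<one>\<^bsub>A\<^esub> = \<one>\<^bsub>?Q\<^esub>" by (simp add: quot_alg_def FactRing_def)
  have zero: "?f \<zero>\<^bsub>A\<^esub> = \<zero>\<^bsub>?Q\<^esub>"
    using I.a_rcos_const[OF I.zero_closed] by (simp add: quot_alg_def FactRing_def)
  have sur: "?f ` carrier A = carrier ?Q"
    by (auto simp: quot_alg_def FactRing_def A_RCOSETS_def')
  have smult: "?f (c \<odot>\<^bsub>A\<^esub> a) = c \<odot>\<^bsub>?Q\<^esub> ?f a" if c: "c \<in> carrier k" and a: "a \<in> carrier A" for c a
  proof -
    \<comment> \<open>Scalar multiplication in \<open>quot_alg\<close> is a union over all
      representatives of a coset; it collapses because each of them yields the same coset.\<close>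
    have eq: "?f (c \<odot>\<^bsub>A\<^esub> b) = ?f (c \<odot>\<^bsub>A\<^esub> a)" if "b \<in> ?f a" for b
    proof -
      from that obtain i where i: "i \<in> I" "b = i \<oplus>\<^bsub>A\<^esub> a" by (auto simp: a_r_coset_def')
      have ic: "i \<in> carrier A" using i(1) by (rule I.a_Hcarr)
      have "c \<odot>\<^bsub>A\<^esub> i = (c \<odot>\<^bsub>A\<^esub> \<one>\<^bsub>A\<^esub>) \<otimes>\<^bsub>A\<^esub> i" using c ic by (simp add: A.smult_assoc2)
      then have "c \<odot>\<^bsub>A\<^esub> i \<in> I" using I.I_l_closed[OF i(1), of "c \<odot>\<^bsub>A\<^esub> \<one>\<^bsub>A\<^esub>"] c by simp
      then have "c \<odot>\<^bsub>A\<^esub> b \<in> ?f (c \<odot>\<^bsub>A\<^esub> a)"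
        using i(2) ic a c by (auto simp: a_r_coset_def' A.smult_r_distr)
      from I.a_repr_independence'[OF this A.smult_closed[OF c a]] show ?thesis by (rule sym)
    qed
    have "a \<in> ?f a" using a by (rule I.a_rcos_self)
    then have "(\<Union>b\<in>?f a. ?f (c \<odot>\<^bsub>A\<^esub> b)) = ?f (c \<odot>\<^bsub>A\<^esub> a)" using eq by blast
    then show ?thesis by (simp add: quot_alg_def)
  qed
  show al: "algebra k ?Q" by (rule algebra_surj_image[OF A add mult one zero smult sur])
  show "restrict ?f (carrier A) \<in> alg_hom k A ?Q"
    using add mult one smult sur algebra_closed[OF A] by (intro alg_homI) auto
  show "restrict ?f (carrier A) ` carrier A = carrier ?Q" using sur by simp
qed

lemma quot_alg_eq_zero_iff:
  assumes "algebra k A" "ideal I A" "a \<in> carrier A"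
  shows "I +>\<^bsub>A\<^esub> a = \<zero>\<^bsub>quot_alg A I\<^esub> \<longleftrightarrow> a \<in> I"
proof -
  interpret A: algebra k A by fact
  interpret I: ideal I A by fact
  have "I +>\<^bsub>A\<^esub> a = I \<longleftrightarrow> a \<in> I"
    using I.a_rcos_self[OF assms(3)] I.a_rcos_const[of a] by (metis (no_types))
  then show ?thesis by (simp add: quot_alg_def FactRing_def)
qed

text \<open>Transport of structure along an injection g. It turns algebras of cosets or of functions
  into test algebras.\<close>

definition image_alg :: "('b \<Rightarrow> 'u) \<Rightarrow> ('k, 'b) module \<Rightarrow> ('k, 'u) module" where
  "image_alg g T = (let v = inv_into (carrier T) g in \<lparr>carrier = g ` carrier T,
     monoid.mult = \<lambda>x y. g (v x \<otimes>\<^bsub>T\<^esub> v y), one = g \<one>\<^bsub>T\<^esub>,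
     ring.zero = g \<zero>\<^bsub>T\<^esub>, ring.add = \<lambda>x y. g (v x \<oplus>\<^bsub>T\<^esub> v y),
     smult = \<lambda>c x. g (c \<odot>\<^bsub>T\<^esub> v x)\<rparr>)"

lemma
  assumes T: "algebra k T" and g: "inj_on g (carrier T)"
  shows image_alg_algebra: "algebra k (image_alg g T)"
    and image_alg_hom: "restrict g (carrier T) \<in> alg_hom k T (image_alg g T)"
    and image_alg_carrier: "carrier (image_alg g T) = g ` carrier T"
    and image_alg_inv: "restrict (inv_into (carrier T) g) (carrier (image_alg g T)) \<in> alg_hom k (image_alg g T) T"
proof -
  note v = inv_into_f_f[OF g]
  let ?S = "image_alg g T"
  have ops: "a \<in> carrier T \<Longrightarrow> b \<in> carrier T \<Longrightarrow> g (a \<oplus>\<^bsub>T\<^esub> b) = g a \<oplus>\<^bsub>?S\<^esub> g b"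
    "a \<in> carrier T \<Longrightarrow> b \<in> carrier T \<Longrightarrow> g (a \<otimes>\<^bsub>T\<^esub> b) = g a \<otimes>\<^bsub>?S\<^esub> g b"
    "g \<one>\<^bsub>T\<^esub> = \<one>\<^bsub>?S\<^esub>" "g \<zero>\<^bsub>T\<^esub> = \<zero>\<^bsub>?S\<^esub>"
    "a \<in> carrier T \<Longrightarrow> g (c \<odot>\<^bsub>T\<^esub> a) = c \<odot>\<^bsub>?S\<^esub> g a" for a b c
    by (simp_all add: image_alg_def Let_def v)
  show car: "carrier ?S = g ` carrier T" by (simp add: image_alg_def Let_def)
  show al: "algebra k ?S" by (rule algebra_surj_image[OF T ops]) (use car in auto)
  show "restrict g (carrier T) \<in> alg_hom k T ?S"
    using ops car algebra_closed[OF T] by (intro alg_homI) auto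
  show "restrict (inv_into (carrier T) g) (carrier ?S) \<in> alg_hom k ?S T"
    using algebra_closed[OF T] algebra_closed[OF al]
    by (intro alg_homI) (auto simp: car v ops[symmetric] image_iff)
qed

text \<open>The quotient A/I is described by its projection and kernel instead of by cosets, so that
  any isomorphic copy qualifies, in particular one that is a test algebra.\<close>

definition is_quot :: "'k ring \<Rightarrow> ('k, 'a) module \<Rightarrow> 'a set \<Rightarrow> ('k, 'b) module \<Rightarrow> ('a \<Rightarrow> 'b) \<Rightarrow> bool" where
  "is_quot k A I C \<pi> \<longleftrightarrow> algebra k C \<and> \<pi> \<in> alg_hom k A C \<and> \<pi> ` carrier A = carrier C \<and>
     (\<forall>a\<in>carrier A. \<pi> a = \<zero>\<^bsub>C\<^esub> \<longleftrightarrow> a \<in> I)"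

text \<open>Choosing one representative in each coset embeds the quotient into the type of
  A.\<close>

lemma is_quot_exists:
  fixes A :: "('k, 'a) module"
  assumes A: "algebra k A" and I: "ideal I A"
  obtains C :: "('k, 'a) module" and \<pi> where "is_quot k A I C \<pi>"
proof -
  interpret I: ideal I A by fact
  let ?Q = "quot_alg A I" and ?g = "\<lambda>Z. Eps (\<lambda>a. a \<in> Z)"
  note Q = quot_alg_algebra[OF A I]
  have s: "?g (I +>\<^bsub>A\<^esub> a) \<in> I +>\<^bsub>A\<^esub> a" if "a \<in> carrier A" for a
    using I.a_rcos_self[OF that] by (rule someI)
  have inj: "inj_on ?g (carrier ?Q)"
  proof (rule inj_onI)
    fix Z Y assume Z: "Z \<in> carrier ?Q" and Y: "Y \<in> carrier ?Q" and eq: "?g Z = ?g Y"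
    have *: "Z = I +>\<^bsub>A\<^esub> ?g Z" if Z: "Z \<in> carrier ?Q" for Z
    proof -
      obtain a where a: "a \<in> carrier A" "Z = I +>\<^bsub>A\<^esub> a"
        using Z unfolding quot_alg_surj[OF A I, symmetric] by auto
      show ?thesis using I.a_repr_independence'[OF s[OF a(1)] a(1)] unfolding a(2) .
    qed
    show "Z = Y" using *[OF Z] *[OF Y] eq by metis
  qed
  let ?\<pi> = "compose (carrier A) (restrict ?g (carrier ?Q)) (\<lambda>a\<in>carrier A. I +>\<^bsub>A\<^esub> a)"
  have zero: "?g \<zero>\<^bsub>?Q\<^esub> = \<zero>\<^bsub>image_alg ?g ?Q\<^esub>" by (simp add: image_alg_def Let_def)
  have cl: "I +>\<^bsub>A\<^esub> a \<in> carrier ?Q" if "a \<in> carrier A" for a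
    using alg_hom_closed[OF quot_alg_hom[OF A I] that] that by simp
  have "?\<pi> a = \<zero>\<^bsub>image_alg ?g ?Q\<^esub> \<longleftrightarrow> a \<in> I" if "a \<in> carrier A" for a
    using that cl[OF that] inj_on_eq_iff[OF inj cl[OF that] algebra_zero[OF Q]]
      quot_alg_eq_zero_iff[OF A I that] unfolding zero[symmetric] by (simp add: compose_def)
  moreover have "?\<pi> ` carrier A = carrier (image_alg ?g ?Q)"
  proof -
    have "?\<pi> ` carrier A = ?g ` ((\<lambda>a\<in>carrier A. I +>\<^bsub>A\<^esub> a) ` carrier A)"
      using cl by (auto simp: compose_def image_iff)
    then show ?thesis using quot_alg_surj[OF A I] image_alg_carrier[OF Q inj] by simp
  qed
  ultimately have "is_quot k A I (image_alg ?g ?Q) ?\<pi>"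
    unfolding is_quot_def
    using image_alg_algebra[OF Q inj] alg_hom_compose[OF A quot_alg_hom[OF A I] image_alg_hom[OF Q inj]] by blast
  then show ?thesis using that by blast
qed

lemma is_quot_factor:
  assumes q: "is_quot k A I C \<pi>" and A: "algebra k A" and I: "ideal I A" and R: "algebra k R"
    and x: "x \<in> alg_hom k A R" "\<And>a. a \<in> I \<Longrightarrow> x a = \<zero>\<^bsub>R\<^esub>"
  obtains h where "h \<in> alg_hom k C R" "compose (carrier A) h \<pi> = x"
proof -
  interpret A: algebra k A by fact
  interpret R: algebra k R by fact
  have C: "algebra k C" and \<pi>: "\<pi> \<in> alg_hom k A C" and sur: "\<pi> ` carrier A = carrier C"
    and ker: "\<And>a. a \<in> carrier A \<Longrightarrow> \<pi> a = \<zero>\<^bsub>C\<^esub> \<longleftrightarrow> a \<in> I" using q by (auto simp: is_quot_def)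
  interpret C: algebra k C by fact
  define h where "h = (\<lambda>y\<in>carrier C. x (inv_into (carrier A) \<pi> y))"
  have eq: "x a = x b" if "a \<in> carrier A" "b \<in> carrier A" "\<pi> a = \<pi> b" for a b
  proof -
    have "\<pi> (a \<oplus>\<^bsub>A\<^esub> (\<ominus>\<^bsub>A\<^esub> b)) = \<zero>\<^bsub>C\<^esub>"
      using that \<pi> by (simp add: alg_hom_add[OF \<pi>] alg_hom_minus[OF \<pi> A C] alg_hom_closed[OF \<pi>] C.r_neg)
    then have "x (a \<oplus>\<^bsub>A\<^esub> (\<ominus>\<^bsub>A\<^esub> b)) = \<zero>\<^bsub>R\<^esub>" using x(2) ker that by simp
    then have "x a \<oplus>\<^bsub>R\<^esub> (\<ominus>\<^bsub>R\<^esub> x b) = \<zero>\<^bsub>R\<^esub>"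
      using that by (simp add: alg_hom_add[OF x(1)] alg_hom_minus[OF x(1) A R])
    then have "\<ominus>\<^bsub>R\<^esub> (\<ominus>\<^bsub>R\<^esub> x b) = x a"
      using that alg_hom_closed[OF x(1)] by (intro R.minus_equality) auto
    then show ?thesis using that alg_hom_closed[OF x(1)] by simp
  qed
  have h: "h (\<pi> a) = x a" if a: "a \<in> carrier A" for a
  proof -
    have "\<pi> a \<in> carrier C" "\<pi> a \<in> \<pi> ` carrier A" using a sur by auto
    then show ?thesis unfolding h_def
      using eq[of "inv_into (carrier A) \<pi> (\<pi> a)" a] a by (simp add: inv_into_into f_inv_into_f)
  qed
  have "h \<in> alg_hom k C R"
  proof (rule alg_homI)
    fix u v assume "u \<in> carrier C" "v \<in> carrier C"
    then obtain a b where ab: "a \<in> carrier A" "b \<in> carrier A" "u = \<pi> a" "v = \<pi> b" using sur by blast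
    show "h u \<in> carrier R" using ab by (simp add: h alg_hom_closed[OF x(1)])
    show "h (u \<oplus>\<^bsub>C\<^esub> v) = h u \<oplus>\<^bsub>R\<^esub> h v"
      using ab by (simp add: h alg_hom_add[OF \<pi>, symmetric] alg_hom_add[OF x(1)])
    show "h (u \<otimes>\<^bsub>C\<^esub> v) = h u \<otimes>\<^bsub>R\<^esub> h v"
      using ab by (simp add: h alg_hom_mult[OF \<pi>, symmetric] alg_hom_mult[OF x(1)])
    fix c assume "c \<in> carrier k"
    then show "h (c \<odot>\<^bsub>C\<^esub> u) = c \<odot>\<^bsub>R\<^esub> h u"
      using ab by (simp add: h alg_hom_smult[OF \<pi>, symmetric] alg_hom_smult[OF x(1)])
  next
    show "h \<one>\<^bsub>C\<^esub> = \<one>\<^bsub>R\<^esub>" using h[of "\<one>\<^bsub>A\<^esub>"] by (simp add: alg_hom_one[OF \<pi>] alg_hom_one[OF x(1)])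
  qed (simp_all add: h_def)
  moreover have "compose (carrier A) h \<pi> = x"
    using h alg_hom_extensional[OF x(1)] by (intro extensionalityI[of _ "carrier A"]) (auto simp: compose_def)
  ultimately show ?thesis using that by blast
qed

section \<open>Bases of algebras\<close>

text \<open>Here \<open>cd e c\<close> is the coordinate of c at the basis vector e. It is total in
  e and zero outside E, which lets coordinates be compared without side conditions on e.\<close>

definition alg_basis :: "'k ring \<Rightarrow> ('k, 'c) module \<Rightarrow> 'c set \<Rightarrow> ('c \<Rightarrow> 'c \<Rightarrow> 'k) \<Rightarrow> bool" where
  "alg_basis k C E cd \<longleftrightarrow> E \<subseteq> carrier C \<and>
     (\<forall>c\<in>carrier C. (\<forall>e. cd e c \<in> carrier k) \<and> finite {e. cd e c \<noteq> \<zero>\<^bsub>k\<^esub>} \<and>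
        {e. cd e c \<noteq> \<zero>\<^bsub>k\<^esub>} \<subseteq> E \<and>
        c = (\<Oplus>\<^bsub>C\<^esub>e\<in>{e. cd e c \<noteq> \<zero>\<^bsub>k\<^esub>}. cd e c \<odot>\<^bsub>C\<^esub> e)) \<and>
     (\<forall>c\<in>carrier C. \<forall>d\<in>carrier C. \<forall>e. cd e (c \<oplus>\<^bsub>C\<^esub> d) = cd e c \<oplus>\<^bsub>k\<^esub> cd e d) \<and>
     (\<forall>a\<in>carrier k. \<forall>c\<in>carrier C. \<forall>e. cd e (a \<odot>\<^bsub>C\<^esub> c) = a \<otimes>\<^bsub>k\<^esub> cd e c) \<and>
     (\<forall>e\<in>E. \<forall>e'. cd e' e = (if e' = e then \<one>\<^bsub>k\<^esub> else \<zero>\<^bsub>k\<^esub>))"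

locale field_alg = k?: field k + C?: algebra k C
  for k :: "'k ring" (structure) and C :: "('k, 'c) module" (structure)
begin

definition coeffs :: "'c set \<Rightarrow> ('c \<Rightarrow> 'k) set" where
  "coeffs Z = {a. (\<forall>e. a e \<in> carrier k) \<and> finite {e. a e \<noteq> \<zero>\<^bsub>k\<^esub>} \<and> {e. a e \<noteq> \<zero>\<^bsub>k\<^esub>} \<subseteq> Z}"

definition lin :: "('c \<Rightarrow> 'k) \<Rightarrow> 'c" where
  "lin a = (\<Oplus>\<^bsub>C\<^esub>e\<in>{e. a e \<noteq> \<zero>\<^bsub>k\<^esub>}. a e \<odot>\<^bsub>C\<^esub> e)"

lemma lin_superset:
  assumes a: "a \<in> coeffs Z" and Z: "Z \<subseteq> carrier C" and F: "finite F" "{e. a e \<noteq> \<zero>\<^bsub>k\<^esub>} \<subseteq> F" "F \<subseteq> carrier C"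
  shows "lin a = (\<Oplus>\<^bsub>C\<^esub>e\<in>F. a e \<odot>\<^bsub>C\<^esub> e)"
  unfolding lin_def
  using assms by (intro C.M.add.finprod_mono_neutral_cong_left) (auto simp: coeffs_def subset_iff)

lemma lin_closed: "a \<in> coeffs Z \<Longrightarrow> Z \<subseteq> carrier C \<Longrightarrow> lin a \<in> carrier C"
  unfolding lin_def by (rule C.M.finsum_closed) (auto simp: coeffs_def)

lemma coeffs_add:
  assumes "a \<in> coeffs Z" "b \<in> coeffs Z"
  shows "(\<lambda>e. a e \<oplus>\<^bsub>k\<^esub> b e) \<in> coeffs Z"
proof -
  have "{e. a e \<oplus>\<^bsub>k\<^esub> b e \<noteq> \<zero>\<^bsub>k\<^esub>} \<subseteq> {e. a e \<noteq> \<zero>\<^bsub>k\<^esub>} \<union> {e. b e \<noteq> \<zero>\<^bsub>k\<^esub>}" by auto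
  then show ?thesis using assms unfolding coeffs_def
    by (auto intro: finite_subset)
qed

lemma coeffs_smult:
  assumes "c \<in> carrier k" "a \<in> coeffs Z"
  shows "(\<lambda>e. c \<otimes>\<^bsub>k\<^esub> a e) \<in> coeffs Z"
proof -
  have "{e. c \<otimes>\<^bsub>k\<^esub> a e \<noteq> \<zero>\<^bsub>k\<^esub>} \<subseteq> {e. a e \<noteq> \<zero>\<^bsub>k\<^esub>}" using assms by auto
  then show ?thesis using assms unfolding coeffs_def by (auto intro: finite_subset)
qed

lemma lin_add:
  assumes a: "a \<in> coeffs Z" and b: "b \<in> coeffs Z" and Z: "Z \<subseteq> carrier C"
  shows "lin (\<lambda>e. a e \<oplus>\<^bsub>k\<^esub> b e) = lin a \<oplus>\<^bsub>C\<^esub> lin b"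
proof -
  let ?F = "{e. a e \<noteq> \<zero>\<^bsub>k\<^esub>} \<union> {e. b e \<noteq> \<zero>\<^bsub>k\<^esub>}"
  have F: "finite ?F" "?F \<subseteq> carrier C" "{e. a e \<oplus>\<^bsub>k\<^esub> b e \<noteq> \<zero>\<^bsub>k\<^esub>} \<subseteq> ?F"
    using a b Z by (auto simp: coeffs_def)
  have ab: "\<And>e. a e \<in> carrier k" "\<And>e. b e \<in> carrier k" using a b by (auto simp: coeffs_def)
  have "lin (\<lambda>e. a e \<oplus>\<^bsub>k\<^esub> b e) = (\<Oplus>\<^bsub>C\<^esub>e\<in>?F. a e \<odot>\<^bsub>C\<^esub> e \<oplus>\<^bsub>C\<^esub> b e \<odot>\<^bsub>C\<^esub> e)"
    unfolding lin_superset[OF coeffs_add[OF a b] Z F(1,3,2)]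
    using F(2) ab by (intro C.M.finsum_cong') (auto simp: C.smult_l_distr subset_iff)
  also have "\<dots> = (\<Oplus>\<^bsub>C\<^esub>e\<in>?F. a e \<odot>\<^bsub>C\<^esub> e) \<oplus>\<^bsub>C\<^esub> (\<Oplus>\<^bsub>C\<^esub>e\<in>?F. b e \<odot>\<^bsub>C\<^esub> e)"
    using F(2) ab by (intro C.M.finsum_addf) (auto simp: subset_iff)
  also have "\<dots> = lin a \<oplus>\<^bsub>C\<^esub> lin b"
    using lin_superset[OF a Z F(1) _ F(2)] lin_superset[OF b Z F(1) _ F(2)] by auto
  finally show ?thesis .
qed

lemma lin_smult:
  assumes c: "c \<in> carrier k" and a: "a \<in> coeffs Z" and Z: "Z \<subseteq> carrier C"
  shows "lin (\<lambda>e. c \<otimes>\<^bsub>k\<^esub> a e) = c \<odot>\<^bsub>C\<^esub> lin a"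
proof -
  let ?F = "{e. a e \<noteq> \<zero>\<^bsub>k\<^esub>}"
  have F: "finite ?F" "?F \<subseteq> carrier C" "{e. c \<otimes>\<^bsub>k\<^esub> a e \<noteq> \<zero>\<^bsub>k\<^esub>} \<subseteq> ?F"
    using a c Z by (auto simp: coeffs_def)
  have ac: "\<And>e. a e \<in> carrier k" using a by (auto simp: coeffs_def)
  have "lin (\<lambda>e. c \<otimes>\<^bsub>k\<^esub> a e) = (\<Oplus>\<^bsub>C\<^esub>e\<in>?F. c \<odot>\<^bsub>C\<^esub> (a e \<odot>\<^bsub>C\<^esub> e))"
    unfolding lin_superset[OF coeffs_smult[OF c a] Z F(1,3,2)]
    using F(2) ac c by (intro C.M.finsum_cong') (auto simp: C.smult_assoc1 subset_iff)
  also have "\<dots> = c \<odot>\<^bsub>C\<^esub> (\<Oplus>\<^bsub>C\<^esub>e\<in>?F. a e \<odot>\<^bsub>C\<^esub> e)"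
    using F ac c by (intro C.finsum_smult_ldistr[symmetric]) (auto simp: subset_iff)
  finally show ?thesis by (simp add: lin_def)
qed

lemma coeffs_single: "e \<in> Z \<Longrightarrow> (\<lambda>e'. if e' = e then \<one>\<^bsub>k\<^esub> else \<zero>\<^bsub>k\<^esub>) \<in> coeffs Z"
  by (auto simp: coeffs_def)

lemma lin_single:
  assumes "e \<in> carrier C"
  shows "lin (\<lambda>e'. if e' = e then \<one>\<^bsub>k\<^esub> else \<zero>\<^bsub>k\<^esub>) = e"
proof -
  have "lin (\<lambda>e'. if e' = e then \<one>\<^bsub>k\<^esub> else \<zero>\<^bsub>k\<^esub>) = (\<Oplus>\<^bsub>C\<^esub>e'\<in>{e}. (if e' = e then \<one>\<^bsub>k\<^esub> else \<zero>\<^bsub>k\<^esub>) \<odot>\<^bsub>C\<^esub> e')"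
    using assms by (intro lin_superset[OF coeffs_single[of e "{e}"]]) auto
  also have "\<dots> = e" using assms by simp
  finally show ?thesis .
qed

lemma lin_span:
  assumes Z: "Z \<subseteq> carrier C" and Y: "\<And>e. e \<in> Y \<Longrightarrow> e \<in> lin ` coeffs Z"
    and a: "a \<in> coeffs Y"
  shows "lin a \<in> lin ` coeffs Z"
proof -
  have sum: "(\<Oplus>\<^bsub>C\<^esub>e\<in>F. a e \<odot>\<^bsub>C\<^esub> e) \<in> lin ` coeffs Z" if "finite F" "F \<subseteq> Y" for F
    using that
  proof (induction F)
    case empty
    have "(\<lambda>e. \<zero>\<^bsub>k\<^esub>) \<in> coeffs Z" "lin (\<lambda>e. \<zero>\<^bsub>k\<^esub>) = \<zero>\<^bsub>C\<^esub>" by (auto simp: coeffs_def lin_def)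
    then show ?case by force
  next
    case (insert e F)
    then have "(\<Oplus>\<^bsub>C\<^esub>e\<in>F. a e \<odot>\<^bsub>C\<^esub> e) \<in> lin ` coeffs Z" "e \<in> lin ` coeffs Z" using Y by simp_all
    then obtain b b' where b: "b \<in> coeffs Z" "(\<Oplus>\<^bsub>C\<^esub>e\<in>F. a e \<odot>\<^bsub>C\<^esub> e) = lin b"
      "b' \<in> coeffs Z" "e = lin b'" by blast
    have ae: "a e \<in> carrier k" for e using a by (auto simp: coeffs_def)
    have Yc: "Y \<subseteq> carrier C" using Y lin_closed Z by blast
    have "(\<Oplus>\<^bsub>C\<^esub>e\<in>insert e F. a e \<odot>\<^bsub>C\<^esub> e) = a e \<odot>\<^bsub>C\<^esub> e \<oplus>\<^bsub>C\<^esub> (\<Oplus>\<^bsub>C\<^esub>e\<in>F. a e \<odot>\<^bsub>C\<^esub> e)"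
      using insert.hyps insert.prems Yc ae by (intro C.M.finsum_insert) (auto simp: subset_iff)
    also have "\<dots> = lin (\<lambda>x. (a e \<otimes>\<^bsub>k\<^esub> b' x) \<oplus>\<^bsub>k\<^esub> b x)"
      using b ae Z by (simp add: lin_add[OF coeffs_smult[OF ae b(3)] b(1) Z] lin_smult[OF ae b(3) Z])
    finally show ?case using coeffs_add[OF coeffs_smult[OF ae b(3)] b(1)] by blast
  qed
  have "(\<Oplus>\<^bsub>C\<^esub>e\<in>{e. a e \<noteq> \<zero>\<^bsub>k\<^esub>}. a e \<odot>\<^bsub>C\<^esub> e) \<in> lin ` coeffs Z"
    by (rule sum) (use a in \<open>auto simp: coeffs_def\<close>)
  then show ?thesis by (simp add: lin_def[of a])
qed

text \<open>Well-order the underlying type and keep those elements of C that are not combinations of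
  smaller ones. They span by well-founded induction. In a nontrivial relation, dividing by the
  coefficient of the largest element would express that element by smaller ones.\<close>

theorem alg_basis_exists: "\<exists>E cd. alg_basis k C E cd"
proof -
  obtain r :: "('c \<times> 'c) set" where r: "well_order_on UNIV r" using well_order_on by blast
  then have wf: "wf (r - Id)" and lin: "linear_order_on UNIV r" by (auto simp: well_order_on_def)
  define below where "below c = {c' \<in> carrier C. (c', c) \<in> r - Id}" for c
  define E where "E = {c \<in> carrier C. c \<notin> lin ` coeffs (below c)}"
  have E: "E \<subseteq> carrier C" and bc: "below c \<subseteq> carrier C" for c by (auto simp: E_def below_def)
  have span: "c \<in> carrier C \<Longrightarrow> c \<in> lin ` coeffs E" for c
  proof (induction c rule: wf_induct_rule[OF wf])
    case (1 c)
    show ?case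
    proof (cases "c \<in> E")
      case True
      show ?thesis using coeffs_single[OF True] lin_single[OF 1(2)] by (metis image_eqI)
    next
      case False
      then obtain a where a: "a \<in> coeffs (below c)" "c = lin a" using 1(2) by (auto simp: E_def)
      show ?thesis unfolding a(2) by (rule lin_span[OF E _ a(1)]) (use 1(1) in \<open>auto simp: below_def\<close>)
    qed
  qed
  have indep: "a = (\<lambda>e. \<zero>\<^bsub>k\<^esub>)" if a: "a \<in> coeffs E" and z: "lin a = \<zero>\<^bsub>C\<^esub>" for a
  proof (rule ccontr)
    assume "a \<noteq> (\<lambda>e. \<zero>\<^bsub>k\<^esub>)"
    let ?S = "{e. a e \<noteq> \<zero>\<^bsub>k\<^esub>}"
    have S: "finite ?S" "?S \<noteq> {}" "?S \<subseteq> E" using a \<open>a \<noteq> _\<close> by (auto simp: coeffs_def)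
    have ac: "a e \<in> carrier k" for e using a by (auto simp: coeffs_def)
    \<comment> \<open>The support is finite, so the converse order is well founded on it and yields
      its largest element m.\<close>
    have "wf ((r - Id)\<inverse> \<inter> ?S \<times> ?S)"
    proof (rule finite_acyclic_wf)
      show "finite ((r - Id)\<inverse> \<inter> ?S \<times> ?S)" using S(1) by blast
      have "acyclic ((r - Id)\<inverse>)" using wf_acyclic[OF wf] by (simp only: acyclic_converse)
      then show "acyclic ((r - Id)\<inverse> \<inter> ?S \<times> ?S)" by (rule acyclic_subset) blast
    qed
    then obtain m where m: "m \<in> ?S" "\<And>y. (y, m) \<in> (r - Id)\<inverse> \<inter> ?S \<times> ?S \<Longrightarrow> y \<notin> ?S"
      using S(2) by (metis wfE_min ex_in_conv)
    have lt: "e \<in> below m" if "e \<in> ?S" "e \<noteq> m" for e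
    proof -
      have "(e, m) \<in> r \<or> (m, e) \<in> r"
        using lin that(2) by (simp add: linear_order_on_def total_on_def)
      moreover have "(m, e) \<notin> r" using m(2)[of e] m(1) that by blast
      ultimately show ?thesis using that S(3) E by (auto simp: below_def)
    qed
    have am: "a m \<noteq> \<zero>\<^bsub>k\<^esub>" using m by simp
    let ?u = "inv\<^bsub>k\<^esub> (a m)" and ?a = "a(m := \<zero>\<^bsub>k\<^esub>)"
    have u: "?u \<in> carrier k" "?u \<otimes>\<^bsub>k\<^esub> a m = \<one>\<^bsub>k\<^esub>" using ac[of m] am k.field_Units by auto
    have mc: "m \<in> carrier C" using m S(3) E by blast
    have a': "?a \<in> coeffs (below m)"
      using a lt unfolding coeffs_def by (auto elim!: rev_finite_subset)
    have "lin a = (\<Oplus>\<^bsub>C\<^esub>e\<in>insert m (?S - {m}). a e \<odot>\<^bsub>C\<^esub> e)"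
      unfolding lin_def using m(1) by (simp add: insert_absorb)
    also have "\<dots> = a m \<odot>\<^bsub>C\<^esub> m \<oplus>\<^bsub>C\<^esub> (\<Oplus>\<^bsub>C\<^esub>e\<in>?S - {m}. a e \<odot>\<^bsub>C\<^esub> e)"
      using S E ac mc by (intro C.M.finsum_insert) auto
    also have "(\<Oplus>\<^bsub>C\<^esub>e\<in>?S - {m}. a e \<odot>\<^bsub>C\<^esub> e) = (\<Oplus>\<^bsub>C\<^esub>e\<in>?S - {m}. ?a e \<odot>\<^bsub>C\<^esub> e)"
      using S E ac by (intro C.M.finsum_cong') auto
    also have "\<dots> = lin ?a"
      using S E by (intro lin_superset[OF a' bc, symmetric]) auto
    finally have eq: "a m \<odot>\<^bsub>C\<^esub> m \<oplus>\<^bsub>C\<^esub> lin ?a = \<zero>\<^bsub>C\<^esub>" using z by simp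
    have lc: "lin ?a \<in> carrier C" by (rule lin_closed[OF a' bc])
    have "a m \<odot>\<^bsub>C\<^esub> m = \<ominus>\<^bsub>C\<^esub> lin ?a"
      using eq lc ac[of m] mc by (intro C.M.minus_equality[symmetric]) auto
    then have "?u \<odot>\<^bsub>C\<^esub> (a m \<odot>\<^bsub>C\<^esub> m) = \<ominus>\<^bsub>C\<^esub> (?u \<odot>\<^bsub>C\<^esub> lin ?a)"
      using u lc by (simp add: C.smult_r_minus)
    also have "\<dots> = (\<ominus>\<^bsub>k\<^esub> ?u) \<odot>\<^bsub>C\<^esub> lin ?a" using u lc by (simp add: C.smult_l_minus)
    also have "\<dots> = lin (\<lambda>e. (\<ominus>\<^bsub>k\<^esub> ?u) \<otimes>\<^bsub>k\<^esub> ?a e)" using u by (intro lin_smult[OF _ a' bc, symmetric]) simp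
    also have "?u \<odot>\<^bsub>C\<^esub> (a m \<odot>\<^bsub>C\<^esub> m) = m"
      using u ac[of m] mc by (simp add: C.smult_assoc1[symmetric])
    finally have "m \<in> lin ` coeffs (below m)"
      using coeffs_smult[OF _ a', of "\<ominus>\<^bsub>k\<^esub> ?u"] u by blast
    then show False using m S(3) by (auto simp: E_def)
  qed
  define co where "co c = (SOME a. a \<in> coeffs E \<and> lin a = c)" for c
  have co: "co c \<in> coeffs E" "lin (co c) = c" if "c \<in> carrier C" for c
  proof -
    have "\<exists>a. a \<in> coeffs E \<and> lin a = c" using span[OF that] by blast
    from someI_ex[OF this] show "co c \<in> coeffs E" "lin (co c) = c" by (simp_all add: co_def)
  qed
  have uniq: "a = co c" if a: "a \<in> coeffs E" "lin a = c" for a c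
  proof -
    have cc: "c \<in> carrier C" using lin_closed[OF a(1) E] a(2) by simp
    let ?m = "\<lambda>e. (\<ominus>\<^bsub>k\<^esub> \<one>\<^bsub>k\<^esub>) \<otimes>\<^bsub>k\<^esub> co c e"
    have m: "?m \<in> coeffs E" by (rule coeffs_smult[OF _ co(1)[OF cc]]) simp
    have "lin (\<lambda>e. a e \<oplus>\<^bsub>k\<^esub> ?m e) = lin a \<oplus>\<^bsub>C\<^esub> (\<ominus>\<^bsub>k\<^esub> \<one>\<^bsub>k\<^esub>) \<odot>\<^bsub>C\<^esub> lin (co c)"
      using lin_add[OF a(1) m E] lin_smult[OF _ co(1)[OF cc] E, of "\<ominus>\<^bsub>k\<^esub> \<one>\<^bsub>k\<^esub>"] by simp
    also have "\<dots> = \<zero>\<^bsub>C\<^esub>" using cc a(2) co(2)[OF cc] by (simp add: C.smult_l_minus C.M.r_neg)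
    finally have "(\<lambda>e. a e \<oplus>\<^bsub>k\<^esub> ?m e) = (\<lambda>e. \<zero>\<^bsub>k\<^esub>)" using indep coeffs_add[OF a(1) m] by blast
    then have "a e \<oplus>\<^bsub>k\<^esub> \<ominus>\<^bsub>k\<^esub> co c e = \<zero>\<^bsub>k\<^esub>" for e
      using co(1)[OF cc] by (auto simp: fun_eq_iff coeffs_def k.l_minus)
    then have "a e = co c e" for e
      using a(1) co(1)[OF cc] k.minus_equality[of "a e" "\<ominus>\<^bsub>k\<^esub> co c e"] by (auto simp: coeffs_def)
    then show ?thesis by blast
  qed
  have add: "co (c \<oplus>\<^bsub>C\<^esub> d) = (\<lambda>e. co c e \<oplus>\<^bsub>k\<^esub> co d e)" if "c \<in> carrier C" "d \<in> carrier C" for c d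
    by (rule uniq[symmetric]) (use that co in \<open>simp_all add: coeffs_add lin_add[OF _ _ E]\<close>)
  have smult: "co (a \<odot>\<^bsub>C\<^esub> c) = (\<lambda>e. a \<otimes>\<^bsub>k\<^esub> co c e)" if "a \<in> carrier k" "c \<in> carrier C" for a c
    by (rule uniq[symmetric]) (use that co in \<open>simp_all add: coeffs_smult lin_smult[OF _ _ E]\<close>)
  have single: "co e = (\<lambda>e'. if e' = e then \<one>\<^bsub>k\<^esub> else \<zero>\<^bsub>k\<^esub>)" if "e \<in> E" for e
    by (rule uniq[symmetric]) (use that E in \<open>auto simp: coeffs_single lin_single\<close>)
  have "alg_basis k C E (\<lambda>e c. co c e)"
    unfolding alg_basis_def
  proof (intro conjI ballI allI)
    fix c assume c: "c \<in> carrier C"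
    show "co c e \<in> carrier k" "finite {e. co c e \<noteq> \<zero>\<^bsub>k\<^esub>}" "{e. co c e \<noteq> \<zero>\<^bsub>k\<^esub>} \<subseteq> E" for e
      using co(1)[OF c] by (simp_all add: coeffs_def)
    show "c = (\<Oplus>\<^bsub>C\<^esub>e\<in>{e. co c e \<noteq> \<zero>\<^bsub>k\<^esub>}. co c e \<odot>\<^bsub>C\<^esub> e)" using co(2)[OF c] by (simp add: lin_def)
  qed (use E add smult single in simp_all)
  then show ?thesis by blast
qed

end

section \<open>Tensor products\<close>

locale tensor = k?: field k + R: algebra k R + C: algebra k C
  for k :: "'k ring" (structure) and R :: "('k, 'r) module" and C :: "('k, 'c) module" +
  fixes E :: "'c set" and cd :: "'c \<Rightarrow> 'c \<Rightarrow> 'k"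
  assumes basis: "alg_basis k C E cd"
begin

lemma E_sub: "e \<in> E \<Longrightarrow> e \<in> carrier C"
  and cd_closed: "c \<in> carrier C \<Longrightarrow> cd e c \<in> carrier k"
  and cd_finite: "c \<in> carrier C \<Longrightarrow> finite {e. cd e c \<noteq> \<zero>}"
  and cd_supp: "c \<in> carrier C \<Longrightarrow> {e. cd e c \<noteq> \<zero>} \<subseteq> E"
  and cd_sum: "c \<in> carrier C \<Longrightarrow> (\<Oplus>\<^bsub>C\<^esub>e\<in>{e. cd e c \<noteq> \<zero>}. cd e c \<odot>\<^bsub>C\<^esub> e) = c"
  and cd_add: "c \<in> carrier C \<Longrightarrow> d \<in> carrier C \<Longrightarrow> cd e (c \<oplus>\<^bsub>C\<^esub> d) = cd e c \<oplus> cd e d"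
  and cd_smult: "a \<in> carrier k \<Longrightarrow> c \<in> carrier C \<Longrightarrow> cd e (a \<odot>\<^bsub>C\<^esub> c) = a \<otimes> cd e c"
  and cd_single: "e \<in> E \<Longrightarrow> cd e' e = (if e' = e then \<one> else \<zero>)"
  using basis unfolding alg_basis_def by (blast, blast, blast, blast, metis, blast, blast, blast)

text \<open>The tensor product of R and C realised as the free R-module on the basis E of C: an
  element is the family of its coordinates in R.\<close>

definition fin_supp :: "('c \<Rightarrow> 'r) set" where
  "fin_supp = {t. (\<forall>e. t e \<in> carrier R) \<and> finite {e. t e \<noteq> \<zero>\<^bsub>R\<^esub>} \<and> {e. t e \<noteq> \<zero>\<^bsub>R\<^esub>} \<subseteq> E}"

text \<open>Only the additive structure of this record is meaningful.\<close>

definition fin_supp_add :: "('c \<Rightarrow> 'r) ring" where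
  "fin_supp_add = \<lparr>carrier = fin_supp, monoid.mult = (\<lambda>_ _ _. \<zero>\<^bsub>R\<^esub>), one = (\<lambda>_. \<zero>\<^bsub>R\<^esub>),
     ring.zero = (\<lambda>_. \<zero>\<^bsub>R\<^esub>), ring.add = (\<lambda>s t e. s e \<oplus>\<^bsub>R\<^esub> t e)\<rparr>"

lemma fin_supp_add_simps: "carrier fin_supp_add = fin_supp" "\<zero>\<^bsub>fin_supp_add\<^esub> = (\<lambda>_. \<zero>\<^bsub>R\<^esub>)" "s \<oplus>\<^bsub>fin_supp_add\<^esub> t = (\<lambda>e. s e \<oplus>\<^bsub>R\<^esub> t e)"
  by (simp_all add: fin_supp_add_def)

lemma fin_supp_coeff: "t \<in> fin_supp \<Longrightarrow> t e \<in> carrier R"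
  by (simp add: fin_supp_def)

lemma fin_supp_map:
  assumes t: "t \<in> fin_supp" and h: "\<And>r. r \<in> carrier R \<Longrightarrow> h r \<in> carrier R" "h \<zero>\<^bsub>R\<^esub> = \<zero>\<^bsub>R\<^esub>"
  shows "(\<lambda>e. h (t e)) \<in> fin_supp"
proof -
  have "{e. h (t e) \<noteq> \<zero>\<^bsub>R\<^esub>} \<subseteq> {e. t e \<noteq> \<zero>\<^bsub>R\<^esub>}" using h(2) by auto
  then show ?thesis using t h(1) unfolding fin_supp_def by (auto intro: finite_subset)
qed

lemma fin_supp_zero: "(\<lambda>_. \<zero>\<^bsub>R\<^esub>) \<in> fin_supp"
  by (simp add: fin_supp_def)

lemma fin_supp_add:
  assumes "s \<in> fin_supp" "t \<in> fin_supp"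
  shows "(\<lambda>e. s e \<oplus>\<^bsub>R\<^esub> t e) \<in> fin_supp"
proof -
  have "{e. s e \<oplus>\<^bsub>R\<^esub> t e \<noteq> \<zero>\<^bsub>R\<^esub>} \<subseteq> {e. s e \<noteq> \<zero>\<^bsub>R\<^esub>} \<union> {e. t e \<noteq> \<zero>\<^bsub>R\<^esub>}" by auto
  then show ?thesis using assms unfolding fin_supp_def by (auto intro: finite_subset)
qed

lemma fin_supp_add_group: "abelian_group fin_supp_add"
proof (rule abelian_groupI)
  fix s assume s: "s \<in> carrier fin_supp_add"
  show "\<exists>t\<in>carrier fin_supp_add. t \<oplus>\<^bsub>fin_supp_add\<^esub> s = \<zero>\<^bsub>fin_supp_add\<^esub>"
    using s by (intro bexI[of _ "\<lambda>e. \<ominus>\<^bsub>R\<^esub> s e"]) (simp_all add: fin_supp_add_simps fin_supp_map fin_supp_coeff R.l_neg)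
qed (simp_all add: fin_supp_add_simps fin_supp_add fin_supp_zero fin_supp_coeff R.M.a_ac)

text \<open>The tensor r \<otimes> c, obtained by expanding c in the basis.\<close>

definition pure :: "'r \<Rightarrow> 'c \<Rightarrow> 'c \<Rightarrow> 'r" where
  "pure r c = (\<lambda>e. cd e c \<odot>\<^bsub>R\<^esub> r)"

lemma pure_supp: "r \<in> carrier R \<Longrightarrow> c \<in> carrier C \<Longrightarrow> {e. pure r c e \<noteq> \<zero>\<^bsub>R\<^esub>} \<subseteq> {e. cd e c \<noteq> \<zero>}"
  by (auto simp: pure_def)

lemma pure_closed: "r \<in> carrier R \<Longrightarrow> c \<in> carrier C \<Longrightarrow> pure r c \<in> fin_supp"
  unfolding fin_supp_def using pure_supp[of r c] cd_supp[of c] finite_subset[OF pure_supp cd_finite]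
  by (auto simp: pure_def cd_closed)

section \<open>Balanced biadditive maps and their extension to tensors\<close>

definition biadd :: "('m, 'x) ring_scheme \<Rightarrow> ('r \<Rightarrow> 'c \<Rightarrow> 'm) \<Rightarrow> bool" where
  "biadd M U \<longleftrightarrow>
     (\<forall>r\<in>carrier R. \<forall>c\<in>carrier C. U r c \<in> carrier M) \<and>
     (\<forall>r\<in>carrier R. \<forall>r'\<in>carrier R. \<forall>c\<in>carrier C. U (r \<oplus>\<^bsub>R\<^esub> r') c = U r c \<oplus>\<^bsub>M\<^esub> U r' c) \<and>
     (\<forall>r\<in>carrier R. \<forall>c\<in>carrier C. \<forall>c'\<in>carrier C. U r (c \<oplus>\<^bsub>C\<^esub> c') = U r c \<oplus>\<^bsub>M\<^esub> U r c') \<and>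
     (\<forall>a\<in>carrier k. \<forall>r\<in>carrier R. \<forall>c\<in>carrier C. U (a \<odot>\<^bsub>R\<^esub> r) c = U r (a \<odot>\<^bsub>C\<^esub> c))"

lemma biaddI:
  assumes "\<And>r c. r \<in> carrier R \<Longrightarrow> c \<in> carrier C \<Longrightarrow> U r c \<in> carrier M"
    and "\<And>r r' c. r \<in> carrier R \<Longrightarrow> r' \<in> carrier R \<Longrightarrow> c \<in> carrier C \<Longrightarrow> U (r \<oplus>\<^bsub>R\<^esub> r') c = U r c \<oplus>\<^bsub>M\<^esub> U r' c"
    and "\<And>r c c'. r \<in> carrier R \<Longrightarrow> c \<in> carrier C \<Longrightarrow> c' \<in> carrier C \<Longrightarrow> U r (c \<oplus>\<^bsub>C\<^esub> c') = U r c \<oplus>\<^bsub>M\<^esub> U r c'"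
    and "\<And>a r c. a \<in> carrier k \<Longrightarrow> r \<in> carrier R \<Longrightarrow> c \<in> carrier C \<Longrightarrow> U (a \<odot>\<^bsub>R\<^esub> r) c = U r (a \<odot>\<^bsub>C\<^esub> c)"
  shows "biadd M U"
  using assms unfolding biadd_def by simp

text \<open>The additive map r \<otimes> c \<mapsto> U r c, evaluated on coordinates. The target is
  a mere abelian group, without scalars; k-bilinearity is replaced by the balance condition in
  \<open>biadd\<close>.\<close>

definition bilinear_ext :: "('m, 'x) ring_scheme \<Rightarrow> ('r \<Rightarrow> 'c \<Rightarrow> 'm) \<Rightarrow> ('c \<Rightarrow> 'r) \<Rightarrow> 'm" where
  "bilinear_ext M U t = finsum M (\<lambda>e. U (t e) e) {e. t e \<noteq> \<zero>\<^bsub>R\<^esub>}"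

context
  fixes M :: "('m, 'x) ring_scheme" and U :: "'r \<Rightarrow> 'c \<Rightarrow> 'm"
  assumes M: "abelian_group M" and U: "biadd M U"
begin

interpretation M: abelian_group M by (rule M)

lemma U_closed: "r \<in> carrier R \<Longrightarrow> c \<in> carrier C \<Longrightarrow> U r c \<in> carrier M"
  and U_add_l: "r \<in> carrier R \<Longrightarrow> r' \<in> carrier R \<Longrightarrow> c \<in> carrier C \<Longrightarrow> U (r \<oplus>\<^bsub>R\<^esub> r') c = U r c \<oplus>\<^bsub>M\<^esub> U r' c"
  and U_add_r: "r \<in> carrier R \<Longrightarrow> c \<in> carrier C \<Longrightarrow> c' \<in> carrier C \<Longrightarrow> U r (c \<oplus>\<^bsub>C\<^esub> c') = U r c \<oplus>\<^bsub>M\<^esub> U r c'"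
  and U_balanced: "a \<in> carrier k \<Longrightarrow> r \<in> carrier R \<Longrightarrow> c \<in> carrier C \<Longrightarrow> U (a \<odot>\<^bsub>R\<^esub> r) c = U r (a \<odot>\<^bsub>C\<^esub> c)"
  using U unfolding biadd_def by blast+

lemma U_zero_l: "c \<in> carrier C \<Longrightarrow> U \<zero>\<^bsub>R\<^esub> c = \<zero>\<^bsub>M\<^esub>"
  using U_add_l[of "\<zero>\<^bsub>R\<^esub>" "\<zero>\<^bsub>R\<^esub>" c] U_closed[of "\<zero>\<^bsub>R\<^esub>" c] M.add.r_cancel_one' by fastforce

lemma U_zero_r: "r \<in> carrier R \<Longrightarrow> U r \<zero>\<^bsub>C\<^esub> = \<zero>\<^bsub>M\<^esub>"
  using U_add_r[of r "\<zero>\<^bsub>C\<^esub>" "\<zero>\<^bsub>C\<^esub>"] U_closed[of r "\<zero>\<^bsub>C\<^esub>"] M.add.r_cancel_one' by fastforce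

lemma bilinear_ext_superset:
  assumes t: "t \<in> fin_supp" and F: "finite F" "{e. t e \<noteq> \<zero>\<^bsub>R\<^esub>} \<subseteq> F" "F \<subseteq> E"
  shows "bilinear_ext M U t = finsum M (\<lambda>e. U (t e) e) F"
  unfolding bilinear_ext_def
proof (rule M.add.finprod_mono_neutral_cong_left)
  show "U (t e) e = \<zero>\<^bsub>M\<^esub>" if "e \<in> F - {e. t e \<noteq> \<zero>\<^bsub>R\<^esub>}" for e
    using that F E_sub U_zero_l by auto
  show "(\<lambda>e. U (t e) e) \<in> F \<rightarrow> carrier M"
    using F E_sub fin_supp_coeff[OF t] U_closed by blast
qed (use F in simp_all)

lemma bilinear_ext_closed: "t \<in> fin_supp \<Longrightarrow> bilinear_ext M U t \<in> carrier M"
  unfolding bilinear_ext_def by (rule M.finsum_closed) (auto simp: fin_supp_def intro!: U_closed E_sub)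

lemma bilinear_ext_add:
  assumes s: "s \<in> fin_supp" and t: "t \<in> fin_supp"
  shows "bilinear_ext M U (\<lambda>e. s e \<oplus>\<^bsub>R\<^esub> t e) = bilinear_ext M U s \<oplus>\<^bsub>M\<^esub> bilinear_ext M U t"
proof -
  let ?F = "{e. s e \<noteq> \<zero>\<^bsub>R\<^esub>} \<union> {e. t e \<noteq> \<zero>\<^bsub>R\<^esub>}"
  have F: "finite ?F" "?F \<subseteq> E" "{e. s e \<oplus>\<^bsub>R\<^esub> t e \<noteq> \<zero>\<^bsub>R\<^esub>} \<subseteq> ?F"
    using s t by (auto simp: fin_supp_def)
  have c: "e \<in> ?F \<Longrightarrow> e \<in> carrier C" for e using F(2) E_sub by blast
  have "bilinear_ext M U (\<lambda>e. s e \<oplus>\<^bsub>R\<^esub> t e) = (\<Oplus>\<^bsub>M\<^esub>e\<in>?F. U (s e) e \<oplus>\<^bsub>M\<^esub> U (t e) e)"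
    unfolding bilinear_ext_superset[OF fin_supp_add[OF s t] F(1,3,2)]
    by (rule M.finsum_cong') (use c s t in \<open>auto simp: fin_supp_coeff U_add_l U_closed\<close>)
  also have "\<dots> = (\<Oplus>\<^bsub>M\<^esub>e\<in>?F. U (s e) e) \<oplus>\<^bsub>M\<^esub> (\<Oplus>\<^bsub>M\<^esub>e\<in>?F. U (t e) e)"
    by (rule M.finsum_addf) (use c s t in \<open>auto simp: fin_supp_coeff U_closed\<close>)
  also have "\<dots> = bilinear_ext M U s \<oplus>\<^bsub>M\<^esub> bilinear_ext M U t"
    using bilinear_ext_superset[OF s F(1) _ F(2)] bilinear_ext_superset[OF t F(1) _ F(2)] by simp
  finally show ?thesis .
qed

text \<open>The coordinates of c move from the R side to the C side by balance, and additivity in c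
  then reassembles c. The value on a pure tensor is thereby independent of the basis.\<close>

lemma bilinear_ext_pure:
  assumes r: "r \<in> carrier R" and c: "c \<in> carrier C"
  shows "bilinear_ext M U (pure r c) = U r c"
proof -
  let ?F = "{e. cd e c \<noteq> \<zero>}"
  have e: "e \<in> ?F \<Longrightarrow> e \<in> carrier C" for e using cd_supp[OF c] E_sub by blast
  have "bilinear_ext M U (pure r c) = (\<Oplus>\<^bsub>M\<^esub>e\<in>?F. U (pure r c e) e)"
    by (rule bilinear_ext_superset[OF pure_closed[OF r c] cd_finite[OF c] pure_supp[OF r c] cd_supp[OF c]])
  also have "\<dots> = (\<Oplus>\<^bsub>M\<^esub>e\<in>?F. U r (cd e c \<odot>\<^bsub>C\<^esub> e))"
    by (rule M.finsum_cong') (use e r c in \<open>auto simp: pure_def U_balanced U_closed cd_closed\<close>)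
  also have "\<dots> = U r (\<Oplus>\<^bsub>C\<^esub>e\<in>?F. cd e c \<odot>\<^bsub>C\<^esub> e)"
  proof -
    have "finite ?F \<Longrightarrow> F \<subseteq> ?F \<Longrightarrow> finite F \<Longrightarrow>
      (\<Oplus>\<^bsub>M\<^esub>e\<in>F. U r (cd e c \<odot>\<^bsub>C\<^esub> e)) = U r (\<Oplus>\<^bsub>C\<^esub>e\<in>F. cd e c \<odot>\<^bsub>C\<^esub> e)" for F
    proof (induction F rule: infinite_finite_induct)
      case (insert x F)
      have i: "x \<in> carrier C" "F \<subseteq> carrier C" using insert.prems e by auto
      have "(\<Oplus>\<^bsub>M\<^esub>e\<in>insert x F. U r (cd e c \<odot>\<^bsub>C\<^esub> e)) =
          U r (cd x c \<odot>\<^bsub>C\<^esub> x) \<oplus>\<^bsub>M\<^esub> (\<Oplus>\<^bsub>M\<^esub>e\<in>F. U r (cd e c \<odot>\<^bsub>C\<^esub> e))"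
        using insert.hyps i r c by (intro M.finsum_insert) (auto simp: U_closed cd_closed subset_iff)
      also have "\<dots> = U r (cd x c \<odot>\<^bsub>C\<^esub> x \<oplus>\<^bsub>C\<^esub> (\<Oplus>\<^bsub>C\<^esub>e\<in>F. cd e c \<odot>\<^bsub>C\<^esub> e))"
      proof -
        have "(\<Oplus>\<^bsub>C\<^esub>e\<in>F. cd e c \<odot>\<^bsub>C\<^esub> e) \<in> carrier C"
          using i c by (intro C.M.finsum_closed) (auto simp: cd_closed subset_iff)
        then show ?thesis using insert i r c by (simp add: U_add_r cd_closed)
      qed
      also have "cd x c \<odot>\<^bsub>C\<^esub> x \<oplus>\<^bsub>C\<^esub> (\<Oplus>\<^bsub>C\<^esub>e\<in>F. cd e c \<odot>\<^bsub>C\<^esub> e) = (\<Oplus>\<^bsub>C\<^esub>e\<in>insert x F. cd e c \<odot>\<^bsub>C\<^esub> e)"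
        using insert.hyps i c by (intro C.M.finsum_insert[symmetric]) (auto simp: cd_closed subset_iff)
      finally show ?case .
    qed (use r in \<open>simp_all add: U_zero_r\<close>)
    then show ?thesis using cd_finite[OF c] by blast
  qed
  also have "\<dots> = U r c" by (simp add: cd_sum[OF c])
  finally show ?thesis .
qed

end

lemma pure_add_l: "r \<in> carrier R \<Longrightarrow> r' \<in> carrier R \<Longrightarrow> c \<in> carrier C \<Longrightarrow>
    pure (r \<oplus>\<^bsub>R\<^esub> r') c = (\<lambda>e. pure r c e \<oplus>\<^bsub>R\<^esub> pure r' c e)"
  by (simp add: pure_def R.smult_r_distr cd_closed)

lemma pure_add_r: "r \<in> carrier R \<Longrightarrow> c \<in> carrier C \<Longrightarrow> c' \<in> carrier C \<Longrightarrow>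
    pure r (c \<oplus>\<^bsub>C\<^esub> c') = (\<lambda>e. pure r c e \<oplus>\<^bsub>R\<^esub> pure r c' e)"
  by (simp add: pure_def cd_add R.smult_l_distr cd_closed)

lemma pure_balanced: "a \<in> carrier k \<Longrightarrow> r \<in> carrier R \<Longrightarrow> c \<in> carrier C \<Longrightarrow>
    pure (a \<odot>\<^bsub>R\<^esub> r) c = pure r (a \<odot>\<^bsub>C\<^esub> c)"
  by (simp add: pure_def cd_smult R.smult_assoc1[symmetric] cd_closed k.m_comm)

lemma pure_smult: "a \<in> carrier k \<Longrightarrow> r \<in> carrier R \<Longrightarrow> c \<in> carrier C \<Longrightarrow>
    pure (a \<odot>\<^bsub>R\<^esub> r) c = (\<lambda>e. a \<odot>\<^bsub>R\<^esub> pure r c e)"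
  by (simp add: pure_def R.smult_assoc1[symmetric] cd_closed k.m_comm)

text \<open>Additively, tensors are generated by pure ones: coordinates are split off one at a time,
  and zero is itself pure. The ring laws and the universal property are thus reduced to pure
  tensors.\<close>

lemma fin_supp_induct [consumes 1, case_names pure add]:
  assumes t: "t \<in> fin_supp" and pure: "\<And>r c. r \<in> carrier R \<Longrightarrow> c \<in> carrier C \<Longrightarrow> P (pure r c)"
    and add: "\<And>s t. s \<in> fin_supp \<Longrightarrow> t \<in> fin_supp \<Longrightarrow> P s \<Longrightarrow> P t \<Longrightarrow> P (\<lambda>e. s e \<oplus>\<^bsub>R\<^esub> t e)"
  shows "P t"
proof -
  have "P t" if "finite S" "t \<in> fin_supp" "{e. t e \<noteq> \<zero>\<^bsub>R\<^esub>} \<subseteq> S" for S t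
    using that
  proof (induction S arbitrary: t)
    case empty
    then have "t = pure \<zero>\<^bsub>R\<^esub> \<zero>\<^bsub>C\<^esub>" by (auto simp: pure_def fun_eq_iff cd_closed)
    then show ?case using pure by simp
  next
    case (insert m S)
    let ?q = "t(m := \<zero>\<^bsub>R\<^esub>)"
    have q: "?q \<in> fin_supp" "{e. ?q e \<noteq> \<zero>\<^bsub>R\<^esub>} \<subseteq> S"
      using insert.prems unfolding fin_supp_def by (auto elim!: rev_finite_subset)
    show ?case
    proof (cases "t m = \<zero>\<^bsub>R\<^esub>")
      case True
      then have "?q = t" by auto
      with q insert.IH show ?thesis by metis
    next
      case False
      then have m: "m \<in> E" "t m \<in> carrier R" using insert.prems by (auto simp: fin_supp_def)
      have "t = (\<lambda>e. pure (t m) m e \<oplus>\<^bsub>R\<^esub> ?q e)"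
        using m insert.prems by (auto simp: pure_def cd_single fun_eq_iff fin_supp_coeff)
      moreover have "P (\<lambda>e. pure (t m) m e \<oplus>\<^bsub>R\<^esub> ?q e)"
        using m E_sub by (intro add pure_closed pure q insert.IH) auto
      ultimately show ?thesis by simp
    qed
  qed
  then show ?thesis using t by (auto simp: fin_supp_def)
qed

section \<open>Multiplication of tensors\<close>

abbreviation mult_pure :: "'r \<Rightarrow> 'c \<Rightarrow> 'r \<Rightarrow> 'c \<Rightarrow> 'c \<Rightarrow> 'r" where
  "mult_pure r c \<equiv> \<lambda>r' c'. pure (r \<otimes>\<^bsub>R\<^esub> r') (c \<otimes>\<^bsub>C\<^esub> c')"

lemma biadd_mult_pure:
  assumes "r \<in> carrier R" "c \<in> carrier C"
  shows "biadd fin_supp_add (mult_pure r c)"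
proof (rule biaddI)
  fix a r' c' assume *: "a \<in> carrier k" "r' \<in> carrier R" "c' \<in> carrier C"
  have "r \<otimes>\<^bsub>R\<^esub> (a \<odot>\<^bsub>R\<^esub> r') = a \<odot>\<^bsub>R\<^esub> (r \<otimes>\<^bsub>R\<^esub> r')"
    using assms * by (metis R.m_comm R.smult_assoc2 R.smult_closed)
  moreover have "c \<otimes>\<^bsub>C\<^esub> (a \<odot>\<^bsub>C\<^esub> c') = a \<odot>\<^bsub>C\<^esub> (c \<otimes>\<^bsub>C\<^esub> c')"
    using assms * by (metis C.m_comm C.smult_assoc2 C.smult_closed)
  ultimately show "mult_pure r c (a \<odot>\<^bsub>R\<^esub> r') c' = mult_pure r c r' (a \<odot>\<^bsub>C\<^esub> c')"
    using assms * by (simp add: pure_balanced)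
qed (use assms in \<open>simp_all add: fin_supp_add_simps pure_closed pure_add_l pure_add_r R.r_distr C.r_distr\<close>)

text \<open>The product of r \<otimes> c with t. Extending bilinearly in t makes it additive in t by
  construction; that it is also balanced biadditive in (r, c), which the second extension
  \<open>tmult\<close> relies on, follows by induction on t.\<close>

definition mult_pure_left :: "('c \<Rightarrow> 'r) \<Rightarrow> 'r \<Rightarrow> 'c \<Rightarrow> 'c \<Rightarrow> 'r" where
  "mult_pure_left t r c = bilinear_ext fin_supp_add (mult_pure r c) t"

lemma mult_pure_left_closed: "t \<in> fin_supp \<Longrightarrow> r \<in> carrier R \<Longrightarrow> c \<in> carrier C \<Longrightarrow> mult_pure_left t r c \<in> fin_supp"
  using bilinear_ext_closed[OF fin_supp_add_group biadd_mult_pure] by (simp add: mult_pure_left_def fin_supp_add_simps)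

lemma mult_pure_left_add: "s \<in> fin_supp \<Longrightarrow> t \<in> fin_supp \<Longrightarrow> r \<in> carrier R \<Longrightarrow> c \<in> carrier C \<Longrightarrow>
    mult_pure_left (\<lambda>e. s e \<oplus>\<^bsub>R\<^esub> t e) r c = (\<lambda>e. mult_pure_left s r c e \<oplus>\<^bsub>R\<^esub> mult_pure_left t r c e)"
  using bilinear_ext_add[OF fin_supp_add_group biadd_mult_pure] by (simp add: mult_pure_left_def fin_supp_add_simps)

lemma mult_pure_left_pure: "r' \<in> carrier R \<Longrightarrow> c' \<in> carrier C \<Longrightarrow> r \<in> carrier R \<Longrightarrow> c \<in> carrier C \<Longrightarrow>
    mult_pure_left (pure r' c') r c = pure (r \<otimes>\<^bsub>R\<^esub> r') (c \<otimes>\<^bsub>C\<^esub> c')"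
  using bilinear_ext_pure[OF fin_supp_add_group biadd_mult_pure] by (simp add: mult_pure_left_def)

lemma biadd_mul1:
  assumes t: "t \<in> fin_supp"
  shows "biadd fin_supp_add (mult_pure_left t)"
proof (rule biaddI)
  show "mult_pure_left t r c \<in> carrier fin_supp_add" if "r \<in> carrier R" "c \<in> carrier C" for r c
    using mult_pure_left_closed[OF t that] by (simp add: fin_supp_add_simps)
  show "mult_pure_left t (r \<oplus>\<^bsub>R\<^esub> r') c = mult_pure_left t r c \<oplus>\<^bsub>fin_supp_add\<^esub> mult_pure_left t r' c"
    if "r \<in> carrier R" "r' \<in> carrier R" "c \<in> carrier C" for r r' c
    using t
  proof (induction rule: fin_supp_induct)
    case (pure r1 c1)
    then show ?case using that by (simp add: mult_pure_left_pure fin_supp_add_simps R.l_distr pure_add_l)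
  next
    case (add s t)
    then show ?case using that by (simp add: mult_pure_left_add fin_supp_add_simps mult_pure_left_closed fin_supp_coeff R.M.a_ac)
  qed
  show "mult_pure_left t r (c \<oplus>\<^bsub>C\<^esub> c') = mult_pure_left t r c \<oplus>\<^bsub>fin_supp_add\<^esub> mult_pure_left t r c'"
    if "r \<in> carrier R" "c \<in> carrier C" "c' \<in> carrier C" for r c c'
    using t
  proof (induction rule: fin_supp_induct)
    case (pure r1 c1)
    then show ?case using that by (simp add: mult_pure_left_pure fin_supp_add_simps C.l_distr pure_add_r)
  next
    case (add s t)
    then show ?case using that by (simp add: mult_pure_left_add fin_supp_add_simps mult_pure_left_closed fin_supp_coeff R.M.a_ac)
  qed
  show "mult_pure_left t (a \<odot>\<^bsub>R\<^esub> r) c = mult_pure_left t r (a \<odot>\<^bsub>C\<^esub> c)"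
    if "a \<in> carrier k" "r \<in> carrier R" "c \<in> carrier C" for a r c
    using t
  proof (induction rule: fin_supp_induct)
    case (pure r1 c1)
    then show ?case using that by (simp add: mult_pure_left_pure R.smult_assoc2 C.smult_assoc2 pure_balanced)
  next
    case (add s t)
    then show ?case using that by (simp add: mult_pure_left_add)
  qed
qed

definition tmult :: "('c \<Rightarrow> 'r) \<Rightarrow> ('c \<Rightarrow> 'r) \<Rightarrow> 'c \<Rightarrow> 'r" where
  "tmult s t = bilinear_ext fin_supp_add (mult_pure_left t) s"

lemma tmult_closed: "s \<in> fin_supp \<Longrightarrow> t \<in> fin_supp \<Longrightarrow> tmult s t \<in> fin_supp"
  using bilinear_ext_closed[OF fin_supp_add_group biadd_mul1] by (simp add: tmult_def fin_supp_add_simps)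

lemma tmult_add_l: "s \<in> fin_supp \<Longrightarrow> s' \<in> fin_supp \<Longrightarrow> t \<in> fin_supp \<Longrightarrow>
    tmult (\<lambda>e. s e \<oplus>\<^bsub>R\<^esub> s' e) t = (\<lambda>e. tmult s t e \<oplus>\<^bsub>R\<^esub> tmult s' t e)"
  using bilinear_ext_add[OF fin_supp_add_group biadd_mul1] by (simp add: tmult_def fin_supp_add_simps)

lemma tmult_pure_l: "r \<in> carrier R \<Longrightarrow> c \<in> carrier C \<Longrightarrow> t \<in> fin_supp \<Longrightarrow> tmult (pure r c) t = mult_pure_left t r c"
  using bilinear_ext_pure[OF fin_supp_add_group biadd_mul1] by (simp add: tmult_def)

lemma tmult_pure: "r \<in> carrier R \<Longrightarrow> c \<in> carrier C \<Longrightarrow> r' \<in> carrier R \<Longrightarrow> c' \<in> carrier C \<Longrightarrow>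
    tmult (pure r c) (pure r' c') = pure (r \<otimes>\<^bsub>R\<^esub> r') (c \<otimes>\<^bsub>C\<^esub> c')"
  by (simp add: tmult_pure_l pure_closed mult_pure_left_pure)

lemma tmult_add_r:
  assumes "s \<in> fin_supp" "t \<in> fin_supp" "t' \<in> fin_supp"
  shows "tmult s (\<lambda>e. t e \<oplus>\<^bsub>R\<^esub> t' e) = (\<lambda>e. tmult s t e \<oplus>\<^bsub>R\<^esub> tmult s t' e)"
  using assms(1)
proof (induction rule: fin_supp_induct)
  case (pure r c)
  then show ?case using assms by (simp add: tmult_pure_l fin_supp_add mult_pure_left_add)
next
  case (add s s')
  then show ?case using assms by (simp add: tmult_add_l fin_supp_add tmult_closed fin_supp_coeff R.M.a_ac)
qed

lemma tmult_comm:
  assumes "s \<in> fin_supp" "t \<in> fin_supp"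
  shows "tmult s t = tmult t s"
  using assms(1)
proof (induction rule: fin_supp_induct)
  case (pure r c)
  show ?case using assms(2)
  proof (induction rule: fin_supp_induct)
    case (pure r' c')
    then show ?case using \<open>r \<in> carrier R\<close> \<open>c \<in> carrier C\<close> by (simp add: tmult_pure R.m_comm C.m_comm)
  next
    case (add t t')
    then show ?case using \<open>r \<in> carrier R\<close> \<open>c \<in> carrier C\<close> by (simp add: tmult_add_l tmult_add_r pure_closed)
  qed
next
  case (add s s')
  then show ?case using assms(2) by (simp add: tmult_add_l tmult_add_r)
qed

lemma tmult_assoc:
  assumes s: "s \<in> fin_supp" and t: "t \<in> fin_supp" and u: "u \<in> fin_supp"
  shows "tmult (tmult s t) u = tmult s (tmult t u)"
  using s
proof (induction rule: fin_supp_induct)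
  case (pure r c)
  note rc = this
  show ?case using t
  proof (induction rule: fin_supp_induct)
    case (pure r' c')
    note rc' = this
    show ?case using u
    proof (induction rule: fin_supp_induct)
      case (pure r'' c'')
      then show ?case using rc rc' by (simp add: tmult_pure R.m_assoc C.m_assoc)
    next
      case (add v w)
      then show ?case using rc rc' by (simp add: tmult_add_r tmult_closed pure_closed)
    qed
  next
    case (add v w)
    then show ?case using rc u by (simp add: tmult_add_r tmult_add_l tmult_closed pure_closed)
  qed
next
  case (add v w)
  then show ?case using t u by (simp add: tmult_add_l tmult_closed)
qed

definition tensor_alg :: "('k, 'c \<Rightarrow> 'r) module" where
  "tensor_alg = \<lparr>carrier = fin_supp, monoid.mult = tmult, one = pure \<one>\<^bsub>R\<^esub> \<one>\<^bsub>C\<^esub>,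
     ring.zero = (\<lambda>_. \<zero>\<^bsub>R\<^esub>), ring.add = (\<lambda>s t e. s e \<oplus>\<^bsub>R\<^esub> t e), smult = (\<lambda>a t e. a \<odot>\<^bsub>R\<^esub> t e)\<rparr>"

lemma tensor_alg_simps: "carrier tensor_alg = fin_supp" "s \<otimes>\<^bsub>tensor_alg\<^esub> t = tmult s t" "\<one>\<^bsub>tensor_alg\<^esub> = pure \<one>\<^bsub>R\<^esub> \<one>\<^bsub>C\<^esub>"
  "\<zero>\<^bsub>tensor_alg\<^esub> = (\<lambda>_. \<zero>\<^bsub>R\<^esub>)" "s \<oplus>\<^bsub>tensor_alg\<^esub> t = (\<lambda>e. s e \<oplus>\<^bsub>R\<^esub> t e)" "a \<odot>\<^bsub>tensor_alg\<^esub> t = (\<lambda>e. a \<odot>\<^bsub>R\<^esub> t e)"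
  by (simp_all add: tensor_alg_def)

lemma fin_supp_smult: "a \<in> carrier k \<Longrightarrow> t \<in> fin_supp \<Longrightarrow> (\<lambda>e. a \<odot>\<^bsub>R\<^esub> t e) \<in> fin_supp"
  by (rule fin_supp_map) simp_all

lemma tensor_alg_algebra: "algebra k tensor_alg"
proof (rule algebraI)
  show "cring k" ..
  show "cring tensor_alg"
  proof (rule cringI)
    show "abelian_group tensor_alg"
    proof (rule abelian_groupI)
      fix s assume s: "s \<in> carrier tensor_alg"
      show "\<exists>t\<in>carrier tensor_alg. t \<oplus>\<^bsub>tensor_alg\<^esub> s = \<zero>\<^bsub>tensor_alg\<^esub>"
        using s by (intro bexI[of _ "\<lambda>e. \<ominus>\<^bsub>R\<^esub> s e"]) (simp_all add: tensor_alg_simps fin_supp_map fin_supp_coeff R.l_neg)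
    qed (simp_all add: tensor_alg_simps fin_supp_add fin_supp_zero fin_supp_coeff R.M.a_ac)
    show "comm_monoid tensor_alg"
    proof (rule comm_monoidI)
      fix s assume "s \<in> carrier tensor_alg"
      then have "s \<in> fin_supp" by (simp add: tensor_alg_simps)
      then show "\<one>\<^bsub>tensor_alg\<^esub> \<otimes>\<^bsub>tensor_alg\<^esub> s = s" unfolding tensor_alg_simps
        by (induction rule: fin_supp_induct) (simp_all add: tmult_pure tmult_add_r pure_closed)
    next
      fix s t assume "s \<in> carrier tensor_alg" "t \<in> carrier tensor_alg"
      then show "s \<otimes>\<^bsub>tensor_alg\<^esub> t = t \<otimes>\<^bsub>tensor_alg\<^esub> s" unfolding tensor_alg_simps by (rule tmult_comm)
    qed (simp_all add: tensor_alg_simps tmult_closed pure_closed tmult_assoc)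
  qed (simp add: tensor_alg_simps tmult_add_l)
  fix a s t assume a: "a \<in> carrier k" and s: "s \<in> carrier tensor_alg" and t: "t \<in> carrier tensor_alg"
  have s': "s \<in> fin_supp" and t': "t \<in> fin_supp" using s t by (simp_all add: tensor_alg_simps)
  show "(a \<odot>\<^bsub>tensor_alg\<^esub> s) \<otimes>\<^bsub>tensor_alg\<^esub> t = a \<odot>\<^bsub>tensor_alg\<^esub> (s \<otimes>\<^bsub>tensor_alg\<^esub> t)"
    unfolding tensor_alg_simps using s'
  proof (induction rule: fin_supp_induct)
    case (pure r c)
    note rc = this
    show ?case using t'
    proof (induction rule: fin_supp_induct)
      case (pure r' c')
      then show ?case using rc a by (simp add: pure_smult[symmetric] tmult_pure R.smult_assoc2)
    next
      case (add v w)
      then show ?case using rc a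
        by (simp add: tmult_add_r pure_closed fin_supp_smult tmult_closed R.smult_r_distr fin_supp_coeff)
    qed
  next
    case (add v w)
    then show ?case using t' a
      by (simp add: R.smult_r_distr fin_supp_coeff tmult_add_l fin_supp_smult tmult_closed)
  qed
qed (simp_all add: tensor_alg_simps fin_supp_smult fin_supp_coeff R.smult_l_distr R.smult_r_distr R.smult_assoc1)

definition inl :: "'r \<Rightarrow> 'c \<Rightarrow> 'r" where
  "inl = (\<lambda>r\<in>carrier R. pure r \<one>\<^bsub>C\<^esub>)"

definition inr :: "'c \<Rightarrow> 'c \<Rightarrow> 'r" where
  "inr = (\<lambda>c\<in>carrier C. pure \<one>\<^bsub>R\<^esub> c)"

lemma inl_hom: "inl \<in> alg_hom k R tensor_alg"
  by (rule alg_homI) (simp_all add: inl_def tensor_alg_simps pure_closed pure_add_l tmult_pure pure_smult)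

lemma inr_hom: "inr \<in> alg_hom k C tensor_alg"
  by (rule alg_homI)
    (simp_all add: inr_def tensor_alg_simps pure_closed pure_add_r tmult_pure pure_smult pure_balanced[symmetric])

lemma inl_inr: "r \<in> carrier R \<Longrightarrow> c \<in> carrier C \<Longrightarrow> inl r \<otimes>\<^bsub>tensor_alg\<^esub> inr c = pure r c"
  by (simp add: inl_def inr_def tensor_alg_simps tmult_pure)

text \<open>The map r \<otimes> c \<mapsto> f r * g c is balanced biadditive, so it extends;
  multiplicativity is checked on pure tensors and uses that S is commutative.\<close>

lemma tensor_universal:
  assumes S: "algebra k S" and f: "f \<in> alg_hom k R S" and g: "g \<in> alg_hom k C S"
  obtains h where "h \<in> alg_hom k tensor_alg S" "compose (carrier R) h inl = f" "compose (carrier C) h inr = g"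
proof -
  interpret S: algebra k S by fact
  have Sg: "abelian_group S" ..
  let ?U = "\<lambda>r c. f r \<otimes>\<^bsub>S\<^esub> g c"
  note cl = alg_hom_closed[OF f] alg_hom_closed[OF g]
  have U: "biadd S ?U"
  proof (rule biaddI)
    fix a r c assume *: "a \<in> carrier k" "r \<in> carrier R" "c \<in> carrier C"
    have "f r \<otimes>\<^bsub>S\<^esub> (a \<odot>\<^bsub>S\<^esub> g c) = (a \<odot>\<^bsub>S\<^esub> g c) \<otimes>\<^bsub>S\<^esub> f r"
      using * by (intro S.m_comm) (simp_all add: cl)
    also have "\<dots> = a \<odot>\<^bsub>S\<^esub> (g c \<otimes>\<^bsub>S\<^esub> f r)" using * by (intro S.smult_assoc2) (simp_all add: cl)
    also have "g c \<otimes>\<^bsub>S\<^esub> f r = f r \<otimes>\<^bsub>S\<^esub> g c" using * by (intro S.m_comm) (simp_all add: cl)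
    finally show "f (a \<odot>\<^bsub>R\<^esub> r) \<otimes>\<^bsub>S\<^esub> g c = f r \<otimes>\<^bsub>S\<^esub> g (a \<odot>\<^bsub>C\<^esub> c)"
      using * by (simp add: alg_hom_smult[OF f] alg_hom_smult[OF g] cl S.smult_assoc2)
  qed (simp_all add: cl alg_hom_add[OF f] alg_hom_add[OF g] S.l_distr S.r_distr)
  define h where "h = (\<lambda>t\<in>fin_supp. bilinear_ext S ?U t)"
  have hadd: "h (\<lambda>e. s e \<oplus>\<^bsub>R\<^esub> t e) = h s \<oplus>\<^bsub>S\<^esub> h t" if "s \<in> fin_supp" "t \<in> fin_supp" for s t
    using that by (simp add: h_def fin_supp_add bilinear_ext_add[OF Sg U])
  have hpure: "h (pure r c) = f r \<otimes>\<^bsub>S\<^esub> g c" if "r \<in> carrier R" "c \<in> carrier C" for r c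
    using that by (simp add: h_def pure_closed bilinear_ext_pure[OF Sg U])
  have hcl: "h t \<in> carrier S" if "t \<in> fin_supp" for t
    using that by (simp add: h_def bilinear_ext_closed[OF Sg U])
  have "h \<in> alg_hom k tensor_alg S"
  proof (rule alg_homI)
    fix s t assume "s \<in> carrier tensor_alg" "t \<in> carrier tensor_alg"
    then have st: "s \<in> fin_supp" "t \<in> fin_supp" by (simp_all add: tensor_alg_simps)
    show "h (s \<otimes>\<^bsub>tensor_alg\<^esub> t) = h s \<otimes>\<^bsub>S\<^esub> h t" unfolding tensor_alg_simps using st(1)
    proof (induction rule: fin_supp_induct)
      case (pure r c)
      note rc = this
      show ?case using st(2)
      proof (induction rule: fin_supp_induct)
        case (pure r' c')
        then show ?case using rc
          by (simp add: tmult_pure hpure alg_hom_mult[OF f] alg_hom_mult[OF g] cl S.m_ac)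
      next
        case (add v w)
        then show ?case using rc by (simp add: tmult_add_r pure_closed hadd tmult_closed hcl S.r_distr)
      qed
    next
      case (add v w)
      then show ?case using st(2) by (simp add: tmult_add_l hadd tmult_closed hcl S.l_distr)
    qed
  next
    fix a s assume a: "a \<in> carrier k" and "s \<in> carrier tensor_alg"
    then have s: "s \<in> fin_supp" by (simp add: tensor_alg_simps)
    then show "h (a \<odot>\<^bsub>tensor_alg\<^esub> s) = a \<odot>\<^bsub>S\<^esub> h s" unfolding tensor_alg_simps
    proof (induction rule: fin_supp_induct)
      case (pure r c)
      then show ?case using a
        by (simp add: pure_smult[symmetric] hpure alg_hom_smult[OF f] cl S.smult_assoc2)
    next
      case (add v w)
      then show ?case using a by (simp add: R.smult_r_distr fin_supp_coeff hadd fin_supp_smult hcl S.smult_r_distr)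
    qed
  qed (simp_all add: tensor_alg_simps hcl hadd hpure alg_hom_one[OF f] alg_hom_one[OF g], simp add: h_def)
  moreover have "compose (carrier R) h inl = f"
    using alg_hom_extensional[OF f]
    by (intro extensionalityI[of _ "carrier R"]) (auto simp: compose_def inl_def hpure alg_hom_one[OF g] cl)
  moreover have "compose (carrier C) h inr = g"
    using alg_hom_extensional[OF g]
    by (intro extensionalityI[of _ "carrier C"]) (auto simp: compose_def inr_def hpure alg_hom_one[OF f] cl)
  ultimately show ?thesis using that by blast
qed

end

text \<open>
  The tensor product of the test algebras \<open>R\<close> and \<open>C\<close>, as a test algebra \<open>T\<close>, with
  the coordinates \<open>cf t e \<in> R\<close> of \<open>t \<in> T\<close> in the basis of \<open>C\<close> whose coordinate
  functions are \<open>cd\<close>.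
\<close>

definition is_tensor :: "'k ring \<Rightarrow> ('k, 'u) module \<Rightarrow> ('k, 'u) module \<Rightarrow> ('u \<Rightarrow> 'u \<Rightarrow> 'k) \<Rightarrow>
    ('k, 'u) module \<Rightarrow> ('u \<Rightarrow> 'u) \<Rightarrow> ('u \<Rightarrow> 'u) \<Rightarrow> ('u \<Rightarrow> 'u \<Rightarrow> 'u) \<Rightarrow> bool" where
  "is_tensor k R C cd T i j cf \<longleftrightarrow> algebra k T \<and> i \<in> alg_hom k R T \<and> j \<in> alg_hom k C T \<and>
     (\<forall>P. (\<forall>r\<in>carrier R. \<forall>c\<in>carrier C. P (i r \<otimes>\<^bsub>T\<^esub> j c)) \<longrightarrow>
          (\<forall>s\<in>carrier T. \<forall>t\<in>carrier T. P s \<longrightarrow> P t \<longrightarrow> P (s \<oplus>\<^bsub>T\<^esub> t)) \<longrightarrow> (\<forall>t\<in>carrier T. P t)) \<and>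
     (\<forall>(S :: ('k, 'u) module) f g. algebra k S \<longrightarrow> f \<in> alg_hom k R S \<longrightarrow> g \<in> alg_hom k C S \<longrightarrow>
        (\<exists>h\<in>alg_hom k T S. compose (carrier R) h i = f \<and> compose (carrier C) h j = g)) \<and>
     (\<forall>t\<in>carrier T. \<forall>e. cf t e \<in> carrier R) \<and>
     (\<forall>s\<in>carrier T. \<forall>t\<in>carrier T. \<forall>e. cf (s \<oplus>\<^bsub>T\<^esub> t) e = cf s e \<oplus>\<^bsub>R\<^esub> cf t e) \<and>
     (\<forall>t\<in>carrier T. (\<forall>e. cf t e = \<zero>\<^bsub>R\<^esub>) \<longrightarrow> t = \<zero>\<^bsub>T\<^esub>) \<and>
     (\<forall>r\<in>carrier R. \<forall>c\<in>carrier C. \<forall>e. cf (i r \<otimes>\<^bsub>T\<^esub> j c) e = cd e c \<odot>\<^bsub>R\<^esub> r)"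

section \<open>Encoding finitely supported functions in an infinite type\<close>

lemma infinite_pairing:
  assumes "infinite (UNIV :: 'u set)"
  obtains p :: "'u \<times> 'u \<Rightarrow> 'u" where "inj p"
proof -
  have "|UNIV \<times> UNIV :: ('u \<times> 'u) set| =o |UNIV :: 'u set|"
    using card_of_Times_same_infinite[OF assms] .
  then obtain p :: "'u \<times> 'u \<Rightarrow> 'u" where "bij_betw p (UNIV \<times> UNIV) UNIV"
    using card_of_ordIso by blast
  then show ?thesis using that by (auto simp: bij_betw_def)
qed

lemma infinite_list_encoding:
  assumes u: "infinite (UNIV :: 'u set)"
  obtains q :: "'u list \<Rightarrow> 'u" where "inj q"
proof -
  obtain p :: "'u \<times> 'u \<Rightarrow> 'u" where p: "inj p" using infinite_pairing[OF u] .
  obtain nu :: "nat \<Rightarrow> 'u" where nu: "inj nu" using infinite_countable_subset[OF u] by blast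
  \<comment> \<open>Folding pairs from \<open>undefined\<close> is shown injective only among lists
    of equal length, so the final code also records the length through \<open>nu\<close>.\<close>
  define enc where "enc xs = foldr (\<lambda>x y. p (x, y)) xs undefined" for xs
  have enc: "length xs = length ys \<Longrightarrow> enc xs = enc ys \<Longrightarrow> xs = ys" for xs ys
    by (induction xs ys rule: list_induct2) (simp_all add: enc_def inj_eq[OF p])
  have "inj (\<lambda>xs. p (nu (length xs), enc xs))"
    by (rule injI) (simp add: inj_eq[OF p] inj_eq[OF nu] enc)
  then show ?thesis using that by blast
qed

text \<open>A function with finite support is determined by its graph over the support, that is, by
  a finite list of pairs. This brings the elements of \<open>tensor_alg\<close> back into the type
  \<open>'u\<close>.\<close>

lemma finite_support_encoding:
  assumes u: "infinite (UNIV :: 'u set)"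
  obtains g :: "('u \<Rightarrow> 'u) \<Rightarrow> 'u" where "inj_on g {t. finite {e. t e \<noteq> z}}"
proof -
  obtain p :: "'u \<times> 'u \<Rightarrow> 'u" where p: "inj p" using infinite_pairing[OF u] .
  obtain q :: "'u list \<Rightarrow> 'u" where q: "inj q" using infinite_list_encoding[OF u] .
  define l where "l t = (SOME xs. set xs = {e. t e \<noteq> z})" for t :: "'u \<Rightarrow> 'u"
  have l: "set (l t) = {e. t e \<noteq> z}" if "finite {e. t e \<noteq> z}" for t
    unfolding l_def by (rule someI_ex) (rule finite_list[OF that])
  define g where "g t = q (map (\<lambda>e. p (e, t e)) (l t))" for t
  have "inj_on g {t. finite {e. t e \<noteq> z}}"
  proof (rule inj_onI)
    fix s t :: "'u \<Rightarrow> 'u"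
    assume "s \<in> {t. finite {e. t e \<noteq> z}}" "t \<in> {t. finite {e. t e \<noteq> z}}" and eq: "g s = g t"
    then have f: "finite {e. s e \<noteq> z}" "finite {e. t e \<noteq> z}" by simp_all
    have "map (\<lambda>e. p (e, s e)) (l s) = map (\<lambda>e. p (e, t e)) (l t)"
      using eq unfolding g_def by (rule injD[OF q])
    then have "(\<lambda>e. p (e, s e)) ` set (l s) = (\<lambda>e. p (e, t e)) ` set (l t)"
      by (metis list.set_map)
    then have "p ` (\<lambda>e. (e, s e)) ` {e. s e \<noteq> z} = p ` (\<lambda>e. (e, t e)) ` {e. t e \<noteq> z}"
      unfolding l[OF f(1)] l[OF f(2)] image_image .
    then have im: "(\<lambda>e. (e, s e)) ` {e. s e \<noteq> z} = (\<lambda>e. (e, t e)) ` {e. t e \<noteq> z}"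
      unfolding inj_image_eq_iff[OF p] .
    show "s = t"
    proof
      fix e
      have s: "(e, y) \<in> (\<lambda>e. (e, s e)) ` {e. s e \<noteq> z} \<longleftrightarrow> y = s e \<and> y \<noteq> z" for y by blast
      have t: "(e, y) \<in> (\<lambda>e. (e, t e)) ` {e. t e \<noteq> z} \<longleftrightarrow> y = t e \<and> y \<noteq> z" for y by blast
      have "y = s e \<and> y \<noteq> z \<longleftrightarrow> y = t e \<and> y \<noteq> z" for y using s[of y] t[of y] unfolding im by blast
      then show "s e = t e" by metis
    qed
  qed
  then show ?thesis using that by blast
qed

theorem tensor_exists:
  fixes R C :: "('k, 'u) module"
  assumes u: "infinite (UNIV :: 'u set)" and k: "field k" and R: "algebra k R" and C: "algebra k C"
    and basis: "alg_basis k C E cd"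
  obtains T i j cf where "is_tensor k R C cd T i j cf"
proof -
  interpret tensor k R C E cd
    using k R C basis by (simp add: tensor_def tensor_axioms_def)
  obtain g :: "('u \<Rightarrow> 'u) \<Rightarrow> 'u" where "inj_on g {t. finite {e. t e \<noteq> \<zero>\<^bsub>R\<^esub>}}"
    using finite_support_encoding[OF u] .
  then have g: "inj_on g (carrier tensor_alg)" by (rule inj_on_subset) (auto simp: tensor_alg_simps fin_supp_def)
  define T where "T = image_alg g tensor_alg"
  define G where "G = restrict g (carrier tensor_alg)"
  \<comment> \<open>Decoding returns the coordinate family, so V also serves as the coordinate
    function \<open>cf\<close> of \<open>is_tensor\<close>.\<close>
  define V where "V = restrict (inv_into (carrier tensor_alg) g) (carrier T)"
  have T: "algebra k T" and gh: "G \<in> alg_hom k tensor_alg T" and vh: "V \<in> alg_hom k T tensor_alg"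
    unfolding T_def G_def V_def
    by (rule image_alg_algebra[OF tensor_alg_algebra g] image_alg_hom[OF tensor_alg_algebra g] image_alg_inv[OF tensor_alg_algebra g])+
  have Tc: "carrier T = g ` carrier tensor_alg" unfolding T_def by (rule image_alg_carrier[OF tensor_alg_algebra g])
  have vg: "V (G t) = t" if "t \<in> fin_supp" for t
    using that by (simp add: V_def G_def Tc inv_into_f_f[OF g] tensor_alg_simps(1)[symmetric])
  have el: "\<exists>t \<in> fin_supp. s = G t" if "s \<in> carrier T" for s
    using that by (auto simp: Tc tensor_alg_simps(1) G_def)
  have Gcl: "G t \<in> carrier T" if "t \<in> fin_supp" for t
    using that alg_hom_closed[OF gh] by (simp add: tensor_alg_simps(1))
  have Gadd: "G (\<lambda>e. v e \<oplus>\<^bsub>R\<^esub> w e) = G v \<oplus>\<^bsub>T\<^esub> G w" if "v \<in> fin_supp" "w \<in> fin_supp" for v w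
    using alg_hom_add[OF gh, of v w] that by (simp add: tensor_alg_simps)
  define i where "i = compose (carrier R) G inl"
  define j where "j = compose (carrier C) G inr"
  have i: "i \<in> alg_hom k R T" and j: "j \<in> alg_hom k C T" unfolding i_def j_def
    by (rule alg_hom_compose[OF R inl_hom gh], rule alg_hom_compose[OF C inr_hom gh])
  have ij: "i r \<otimes>\<^bsub>T\<^esub> j c = G (pure r c)" if "r \<in> carrier R" "c \<in> carrier C" for r c
    using that alg_hom_mult[OF gh, of "inl r" "inr c"] alg_hom_closed[OF inl_hom] alg_hom_closed[OF inr_hom]
    by (simp add: i_def j_def compose_eq inl_inr)
  have "is_tensor k R C cd T i j V"
    unfolding is_tensor_def
  proof (intro conjI allI ballI impI)
    fix P t
    assume P: "\<forall>r\<in>carrier R. \<forall>c\<in>carrier C. P (i r \<otimes>\<^bsub>T\<^esub> j c)"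
      and Padd: "\<forall>s\<in>carrier T. \<forall>t\<in>carrier T. P s \<longrightarrow> P t \<longrightarrow> P (s \<oplus>\<^bsub>T\<^esub> t)"
      and "t \<in> carrier T"
    then obtain t' where t': "t' \<in> fin_supp" "t = G t'" using el by blast
    show "P t" unfolding t'(2) using t'(1)
    proof (induction rule: fin_supp_induct)
      case (pure r c)
      have "P (i r \<otimes>\<^bsub>T\<^esub> j c)" using P pure by blast
      then show ?case using ij[OF pure] by simp
    next
      case (add v w)
      have "P (G v \<oplus>\<^bsub>T\<^esub> G w)" using Padd add Gcl by blast
      then show ?case using Gadd[OF add(1,2)] by simp
    qed
  next
    fix S :: "('k, 'u) module" and a b
    assume S: "algebra k S" and a: "a \<in> alg_hom k R S" and b: "b \<in> alg_hom k C S"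
    obtain h where h: "h \<in> alg_hom k tensor_alg S" "compose (carrier R) h inl = a" "compose (carrier C) h inr = b"
      using tensor_universal[OF S a b] .
    have hg: "compose (carrier T) h V (G t) = h t" if "t \<in> fin_supp" for t
      using vg[OF that] Gcl[OF that] by (simp add: compose_eq)
    have "compose (carrier R) (compose (carrier T) h V) i = a"
      unfolding h(2)[symmetric] using alg_hom_closed[OF inl_hom]
      by (intro extensionalityI[of _ "carrier R"]) (simp_all add: compose_eq i_def hg tensor_alg_simps(1))
    moreover have "compose (carrier C) (compose (carrier T) h V) j = b"
      unfolding h(3)[symmetric] using alg_hom_closed[OF inr_hom]
      by (intro extensionalityI[of _ "carrier C"]) (simp_all add: compose_eq j_def hg tensor_alg_simps(1))
    ultimately show "\<exists>h\<in>alg_hom k T S. compose (carrier R) h i = a \<and> compose (carrier C) h j = b"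
      using alg_hom_compose[OF T vh h(1)] by blast
  next
    fix t e assume t: "t \<in> carrier T"
    show "V t e \<in> carrier R" using alg_hom_closed[OF vh t] by (simp add: tensor_alg_simps(1) fin_supp_coeff)
  next
    fix s t e assume s: "s \<in> carrier T" and t: "t \<in> carrier T"
    show "V (s \<oplus>\<^bsub>T\<^esub> t) e = V s e \<oplus>\<^bsub>R\<^esub> V t e"
      unfolding alg_hom_add[OF vh s t] by (simp only: tensor_alg_simps)
  next
    fix t assume t: "t \<in> carrier T" and z: "\<forall>e. V t e = \<zero>\<^bsub>R\<^esub>"
    obtain t' where t': "t' \<in> fin_supp" "t = G t'" using el[OF t] by blast
    have "t' = \<zero>\<^bsub>tensor_alg\<^esub>" using z vg[OF t'(1)] t'(2) by (simp add: tensor_alg_simps fun_eq_iff)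
    then show "t = \<zero>\<^bsub>T\<^esub>" using alg_hom_zero[OF gh tensor_alg_algebra T] t'(2) by simp
  next
    fix r c e assume rc: "r \<in> carrier R" "c \<in> carrier C"
    show "V (i r \<otimes>\<^bsub>T\<^esub> j c) e = cd e c \<odot>\<^bsub>R\<^esub> r"
      unfolding ij[OF rc] using vg[OF pure_closed[OF rc]] by (simp add: pure_def)
  qed (use T i j in simp_all)
  then show ?thesis using that by blast
qed

lemma
  assumes "is_tensor k R C cd T i j cf"
  shows is_tensor_algebra: "algebra k T"
    and is_tensor_inl: "i \<in> alg_hom k R T"
    and is_tensor_inr: "j \<in> alg_hom k C T"
    and is_tensor_induct: "\<lbrakk>t \<in> carrier T; \<And>r c. r \<in> carrier R \<Longrightarrow> c \<in> carrier C \<Longrightarrow> P (i r \<otimes>\<^bsub>T\<^esub> j c);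
      \<And>s t. s \<in> carrier T \<Longrightarrow> t \<in> carrier T \<Longrightarrow> P s \<Longrightarrow> P t \<Longrightarrow> P (s \<oplus>\<^bsub>T\<^esub> t)\<rbrakk> \<Longrightarrow> P t"
    and is_tensor_cf_closed: "t \<in> carrier T \<Longrightarrow> cf t e \<in> carrier R"
    and is_tensor_cf_add: "s \<in> carrier T \<Longrightarrow> t \<in> carrier T \<Longrightarrow> cf (s \<oplus>\<^bsub>T\<^esub> t) e = cf s e \<oplus>\<^bsub>R\<^esub> cf t e"
    and is_tensor_cf_zero: "t \<in> carrier T \<Longrightarrow> (\<And>e. cf t e = \<zero>\<^bsub>R\<^esub>) \<Longrightarrow> t = \<zero>\<^bsub>T\<^esub>"
    and is_tensor_cf_pure: "r \<in> carrier R \<Longrightarrow> c \<in> carrier C \<Longrightarrow> cf (i r \<otimes>\<^bsub>T\<^esub> j c) e = cd e c \<odot>\<^bsub>R\<^esub> r"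
proof -
  note * = assms[unfolded is_tensor_def]
  note 1 = *[THEN conjunct1] and 2 = *[THEN conjunct2]
  note 3 = 2[THEN conjunct1] and 4 = 2[THEN conjunct2, THEN conjunct1]
  note 5 = 2[THEN conjunct2, THEN conjunct2, THEN conjunct1]
  note 6 = 2[THEN conjunct2, THEN conjunct2, THEN conjunct2, THEN conjunct2]
  note 7 = 6[THEN conjunct1] and 8 = 6[THEN conjunct2, THEN conjunct1]
  note 9 = 6[THEN conjunct2, THEN conjunct2, THEN conjunct1]
  note 10 = 6[THEN conjunct2, THEN conjunct2, THEN conjunct2]
  show "algebra k T" by (rule 1)
  show "i \<in> alg_hom k R T" by (rule 3)
  show "j \<in> alg_hom k C T" by (rule 4)
  show "\<lbrakk>t \<in> carrier T; \<And>r c. r \<in> carrier R \<Longrightarrow> c \<in> carrier C \<Longrightarrow> P (i r \<otimes>\<^bsub>T\<^esub> j c);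
      \<And>s t. s \<in> carrier T \<Longrightarrow> t \<in> carrier T \<Longrightarrow> P s \<Longrightarrow> P t \<Longrightarrow> P (s \<oplus>\<^bsub>T\<^esub> t)\<rbrakk> \<Longrightarrow> P t"
    by (rule 5[THEN spec, of P, THEN mp, THEN mp, THEN bspec]) blast+
  show "t \<in> carrier T \<Longrightarrow> cf t e \<in> carrier R" using 7 by simp
  show "s \<in> carrier T \<Longrightarrow> t \<in> carrier T \<Longrightarrow> cf (s \<oplus>\<^bsub>T\<^esub> t) e = cf s e \<oplus>\<^bsub>R\<^esub> cf t e" using 8 by simp
  show "t \<in> carrier T \<Longrightarrow> (\<And>e. cf t e = \<zero>\<^bsub>R\<^esub>) \<Longrightarrow> t = \<zero>\<^bsub>T\<^esub>" using 9 by simp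
  show "r \<in> carrier R \<Longrightarrow> c \<in> carrier C \<Longrightarrow> cf (i r \<otimes>\<^bsub>T\<^esub> j c) e = cd e c \<odot>\<^bsub>R\<^esub> r" using 10 by simp
qed

lemma is_tensor_factor:
  fixes R S :: "('k, 'u) module"
  assumes "is_tensor k R C cd T i j cf" "algebra k S" "f \<in> alg_hom k R S" "g \<in> alg_hom k C S"
  obtains h where "h \<in> alg_hom k T S" "compose (carrier R) h i = f" "compose (carrier C) h j = g"
  using assms(1)[unfolded is_tensor_def, THEN conjunct2, THEN conjunct2, THEN conjunct2, THEN conjunct2,
      THEN conjunct1, THEN spec, THEN spec, THEN spec, THEN mp, THEN mp, THEN mp, OF assms(2-4)] that
  by (elim bexE conjE)

lemma is_tensor_cf_of_zero:
  assumes t: "is_tensor k R C cd T i j cf" and R: "algebra k R"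
  shows "cf \<zero>\<^bsub>T\<^esub> e = \<zero>\<^bsub>R\<^esub>"
proof -
  interpret R: algebra k R by fact
  interpret T: algebra k T by (rule is_tensor_algebra[OF t])
  have "cf \<zero>\<^bsub>T\<^esub> e \<oplus>\<^bsub>R\<^esub> cf \<zero>\<^bsub>T\<^esub> e = cf \<zero>\<^bsub>T\<^esub> e"
    using is_tensor_cf_add[OF t, of "\<zero>\<^bsub>T\<^esub>" "\<zero>\<^bsub>T\<^esub>" e] by simp
  then show ?thesis using is_tensor_cf_closed[OF t, of "\<zero>\<^bsub>T\<^esub>" e] R.M.add.r_cancel_one' by simp
qed

text \<open>Base change along x acts coordinatewise, since both tensor products use the same basis
  of C; on pure tensors this is the k-linearity of x. It turns vanishing of a specialised tensor
  into vanishing of x on elements of A.\<close>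

lemma is_tensor_cf_natural:
  assumes tA: "is_tensor k A C cd T i j cf" and tR: "is_tensor k R C cd T' i' j' cf'"
    and A: "algebra k A" and R: "algebra k R" and x: "x \<in> alg_hom k A R" and h: "h \<in> alg_hom k T T'"
    and hi: "compose (carrier A) h i = compose (carrier A) i' x" and hj: "compose (carrier C) h j = j'"
    and t: "t \<in> carrier T" and cd: "\<And>c. c \<in> carrier C \<Longrightarrow> cd e c \<in> carrier k"
  shows "cf' (h t) e = x (cf t e)"
proof (rule is_tensor_induct[OF tA t])
  note i = is_tensor_inl[OF tA] and j = is_tensor_inr[OF tA]
  fix r c assume r: "r \<in> carrier A" and c: "c \<in> carrier C"
  have "h (i r) = i' (x r)" "h (j c) = j' c"
    using fun_cong[OF hi, of r] fun_cong[OF hj, of c] r c by (simp_all add: compose_eq)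
  then have "h (i r \<otimes>\<^bsub>T\<^esub> j c) = i' (x r) \<otimes>\<^bsub>T'\<^esub> j' c"
    using alg_hom_mult[OF h alg_hom_closed[OF i r] alg_hom_closed[OF j c]] by simp
  then show "cf' (h (i r \<otimes>\<^bsub>T\<^esub> j c)) e = x (cf (i r \<otimes>\<^bsub>T\<^esub> j c) e)"
    by (simp add: is_tensor_cf_pure[OF tA r c] is_tensor_cf_pure[OF tR alg_hom_closed[OF x r] c]
        alg_hom_smult[OF x cd[OF c] r])
next
  fix s t assume st: "s \<in> carrier T" "t \<in> carrier T" "cf' (h s) e = x (cf s e)" "cf' (h t) e = x (cf t e)"
  then show "cf' (h (s \<oplus>\<^bsub>T\<^esub> t)) e = x (cf (s \<oplus>\<^bsub>T\<^esub> t) e)"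
    by (simp add: alg_hom_add[OF h] is_tensor_cf_add[OF tA] is_tensor_cf_add[OF tR]
        alg_hom_closed[OF h] is_tensor_cf_closed[OF tA] alg_hom_add[OF x])
qed

text \<open>Since 1 is the sum of its components and is nonzero, some coordinate is nonzero, hence
  invertible in the field k. This coordinate takes the place of faithful flatness in what
  follows.\<close>

lemma alg_basis_one:
  assumes k: "field k" and C: "algebra k C" and b: "alg_basis k C E cd" and ne: "\<one>\<^bsub>C\<^esub> \<noteq> \<zero>\<^bsub>C\<^esub>"
  obtains e where "cd e \<one>\<^bsub>C\<^esub> \<in> Units k"
proof -
  interpret k: field k by fact
  interpret C: algebra k C by fact
  have cl: "cd e \<one>\<^bsub>C\<^esub> \<in> carrier k" for e using b C.one_closed unfolding alg_basis_def by blast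
  have s: "\<one>\<^bsub>C\<^esub> = (\<Oplus>\<^bsub>C\<^esub>e\<in>{e. cd e \<one>\<^bsub>C\<^esub> \<noteq> \<zero>\<^bsub>k\<^esub>}. cd e \<one>\<^bsub>C\<^esub> \<odot>\<^bsub>C\<^esub> e)"
    using b C.one_closed unfolding alg_basis_def by blast
  have "{e. cd e \<one>\<^bsub>C\<^esub> \<noteq> \<zero>\<^bsub>k\<^esub>} \<noteq> {}"
  proof
    assume "{e. cd e \<one>\<^bsub>C\<^esub> \<noteq> \<zero>\<^bsub>k\<^esub>} = {}"
    then show False using s ne by (simp only: C.M.finsum_empty)
  qed
  then show ?thesis using that cl k.field_Units by blast
qed

text \<open>The coordinate of r \<otimes> 1 at e is a unit multiple of r, so r can be recovered from
  it. Through this, equations between points descend from R \<otimes> C to R.\<close>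

lemma is_tensor_inl_inj:
  assumes t: "is_tensor k R C cd T i j cf" and k: "field k" and R: "algebra k R" and C: "algebra k C"
    and b: "alg_basis k C E cd" and ne: "\<one>\<^bsub>C\<^esub> \<noteq> \<zero>\<^bsub>C\<^esub>"
  shows "inj_on i (carrier R)"
proof (rule inj_onI)
  interpret k: field k by fact
  interpret R: algebra k R by fact
  interpret C: algebra k C by fact
  obtain e where e: "cd e \<one>\<^bsub>C\<^esub> \<in> Units k" using alg_basis_one[OF k C b ne] .
  fix r s assume rs: "r \<in> carrier R" "s \<in> carrier R" and eq: "i r = i s"
  have eq': "cd e \<one>\<^bsub>C\<^esub> \<odot>\<^bsub>R\<^esub> r = cd e \<one>\<^bsub>C\<^esub> \<odot>\<^bsub>R\<^esub> s"
    using is_tensor_cf_pure[OF t rs(1) C.one_closed, of e] is_tensor_cf_pure[OF t rs(2) C.one_closed, of e] eq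
    by simp
  have "inv\<^bsub>k\<^esub> cd e \<one>\<^bsub>C\<^esub> \<odot>\<^bsub>R\<^esub> (cd e \<one>\<^bsub>C\<^esub> \<odot>\<^bsub>R\<^esub> u) = u" if "u \<in> carrier R" for u
    using e that k.Units_closed by (simp add: R.smult_assoc1[symmetric])
  then show "r = s" using eq' rs by metis
qed

text \<open>Faithfully flat descent along \<open>k \<rightarrow> B\<close>.\<close>

lemma is_tensor_descent:
  assumes t: "is_tensor k B B cd T i j cf" and k: "field k" and B: "algebra k B"
    and bs: "alg_basis k B E cd" and ne: "\<one>\<^bsub>B\<^esub> \<noteq> \<zero>\<^bsub>B\<^esub>"
    and b: "b \<in> carrier B" and eq: "i b = j b"
  shows "\<exists>c\<in>carrier k. b = c \<odot>\<^bsub>B\<^esub> \<one>\<^bsub>B\<^esub>"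
proof -
  interpret k: field k by fact
  interpret B: algebra k B by fact
  interpret T: algebra k T by (rule is_tensor_algebra[OF t])
  note i = is_tensor_inl[OF t] and j = is_tensor_inr[OF t]
  obtain e where e: "cd e \<one>\<^bsub>B\<^esub> \<in> Units k" using alg_basis_one[OF k B bs ne] .
  have cb: "cd e b \<in> carrier k" using bs b unfolding alg_basis_def by blast
  \<comment> \<open>Comparing b \<otimes> 1 with 1 \<otimes> b in the coordinate e equates a unit
    multiple of b with a scalar multiple of 1.\<close>
  have "i b \<otimes>\<^bsub>T\<^esub> j \<one>\<^bsub>B\<^esub> = i \<one>\<^bsub>B\<^esub> \<otimes>\<^bsub>T\<^esub> j b"
    using b eq alg_hom_closed[OF j b] by (simp add: alg_hom_one[OF i] alg_hom_one[OF j])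
  then have eq': "cd e \<one>\<^bsub>B\<^esub> \<odot>\<^bsub>B\<^esub> b = cd e b \<odot>\<^bsub>B\<^esub> \<one>\<^bsub>B\<^esub>"
    using is_tensor_cf_pure[OF t b B.one_closed, of e] is_tensor_cf_pure[OF t B.one_closed b, of e] by simp
  have "b = inv\<^bsub>k\<^esub> cd e \<one>\<^bsub>B\<^esub> \<odot>\<^bsub>B\<^esub> (cd e \<one>\<^bsub>B\<^esub> \<odot>\<^bsub>B\<^esub> b)"
    using e b k.Units_closed by (simp add: B.smult_assoc1[symmetric])
  also have "\<dots> = (inv\<^bsub>k\<^esub> cd e \<one>\<^bsub>B\<^esub> \<otimes>\<^bsub>k\<^esub> cd e b) \<odot>\<^bsub>B\<^esub> \<one>\<^bsub>B\<^esub>"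
    unfolding eq' using e cb by (simp add: B.smult_assoc1)
  finally show ?thesis using e cb by blast
qed

lemma is_tensor_fg:
  assumes t: "is_tensor k R C cd T i j cf" and R: "algebra k R" "fg_alg k R" and C: "algebra k C" "fg_alg k C"
  shows "fg_alg k T"
proof -
  obtain F where F: "finite F" "F \<subseteq> carrier R" "carrier R \<subseteq> gen k R F"
    using R(2) unfolding fg_alg_def by blast
  obtain F' where F': "finite F'" "F' \<subseteq> carrier C" "carrier C \<subseteq> gen k C F'"
    using C(2) unfolding fg_alg_def by blast
  note i = is_tensor_inl[OF t] and j = is_tensor_inr[OF t]
  let ?F = "i ` F \<union> j ` F'"
  have gi: "i r \<in> gen k T ?F" if "r \<in> carrier R" for r
    using gen_mono[OF gen_image[OF R(1) F(2) i], of r ?F] F(3) that by (simp add: gen_incl subset_iff)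
  have gj: "j c \<in> gen k T ?F" if "c \<in> carrier C" for c
    using gen_mono[OF gen_image[OF C(1) F'(2) j], of c ?F] F'(3) that by (simp add: gen_incl subset_iff)
  have "t' \<in> gen k T ?F" if "t' \<in> carrier T" for t'
    by (rule is_tensor_induct[OF t that]) (simp_all add: gen_mult gen_add gi gj)
  moreover have "?F \<subseteq> carrier T"
    using alg_hom_closed[OF i] alg_hom_closed[OF j] F(2) F'(2) by blast
  ultimately show ?thesis unfolding fg_alg_def using F(1) F'(1)
    by (intro exI[of _ ?F] conjI subsetI) auto
qed

section \<open>Surjective endomorphisms of Noetherian rings\<close>

text \<open>The kernels of the powers of f ascend, so those of f^n and f^(n+1) agree for some n.
  Writing a = f^n b by surjectivity, f a = 0 puts b into the kernel of f^(n+1), hence into that of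
  f^n, and so a = 0.\<close>

lemma noetherian_surj_endo_inj:
  assumes N: "noetherian_ring T" and f: "f \<in> ring_hom T T" and sur: "f ` carrier T = carrier T"
    and a: "a \<in> carrier T" "f a = \<zero>\<^bsub>T\<^esub>"
  shows "a = \<zero>\<^bsub>T\<^esub>"
proof -
  interpret noetherian_ring T by fact
  interpret f: ring_hom_ring T T f using f by (intro ring_hom_ringI2 ring_axioms)
  let ?K = "\<lambda>n. {a \<in> carrier T. (f ^^ n) a = \<zero>\<^bsub>T\<^esub>}"
  have cl: "(f ^^ n) a \<in> carrier T" if "a \<in> carrier T" for n a
    using that by (induction n) simp_all
  have hom: "f ^^ n \<in> ring_hom T T" for n
  proof (induction n)
    case 0
    show ?case by (simp add: ring_hom_def)
  next
    case (Suc n)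
    then show ?case unfolding funpow.simps
      by (intro ring_hom_trans[of "f ^^ n" T T f T] f)
  qed
  have K: "ideal (?K n) T" for n
  proof -
    interpret g: ring_hom_ring T T "f ^^ n" using hom by (intro ring_hom_ringI2 ring_axioms)
    show ?thesis using g.kernel_is_ideal unfolding a_kernel_def' .
  qed
  have Suc: "?K n \<subseteq> ?K (Suc n)" for n by auto
  have mono: "m \<le> n \<Longrightarrow> ?K m \<subseteq> ?K n" for m n using lift_Suc_mono_le[of ?K, OF Suc] by blast
  have "subset.chain {I. ideal I T} (range ?K)"
  proof (unfold subset_chain_def, intro conjI ballI)
    show "range ?K \<subseteq> {I. ideal I T}" using K by blast
    fix x y assume "x \<in> range ?K" "y \<in> range ?K"
    then obtain m n where "x = ?K m" "y = ?K n" by blast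
    then show "x \<subseteq> y \<or> y \<subseteq> x" using mono[of m n] mono[of n m] nat_le_linear[of m n] by metis
  qed
  then have "\<Union>(range ?K) \<in> range ?K" using ideal_chain_is_trivial by blast
  then obtain n where n: "\<Union>(range ?K) = ?K n" by blast
  have "\<exists>b\<in>carrier T. (f ^^ m) b = a" for m
  proof (induction m)
    case (Suc m)
    then obtain b where b: "b \<in> carrier T" "(f ^^ m) b = a" by blast
    then have "b \<in> f ` carrier T" using sur by simp
    then obtain c where c: "c \<in> carrier T" "b = f c" by blast
    show ?case using b c by (intro bexI[of _ c]) (simp_all add: funpow_swap1)
  qed (use a in simp)
  then obtain b where b: "b \<in> carrier T" "(f ^^ n) b = a" by blast
  then have "b \<in> ?K (Suc n)" using a by simp
  then have "b \<in> ?K n" using n by blast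
  then show ?thesis using b by simp
qed

section \<open>Conjugation in affine group schemes\<close>

locale affine_gs =
  fixes k :: "'u ring" and A :: "'u alg" and Xf :: "'u grp_functor"
  assumes universe: "infinite (UNIV :: 'u set)" and field_k: "field k"
    and group_scheme: "affine_group_scheme k A Xf" and fp_A: "finitely_presented k A"
begin

abbreviation pull :: "'u pt \<Rightarrow> 'u pt \<Rightarrow> 'u pt" where
  "pull f x \<equiv> compose (carrier A) f x"

abbreviation cp :: "'u set \<Rightarrow> 'u alg \<Rightarrow> 'u pt set" where
  "cp I R \<equiv> closed_points k A I R"

abbreviation cj :: "'u alg \<Rightarrow> 'u pt \<Rightarrow> 'u pt \<Rightarrow> 'u pt" where
  "cj R x h \<equiv> x \<otimes>\<^bsub>Xf R\<^esub> h \<otimes>\<^bsub>Xf R\<^esub> inv\<^bsub>Xf R\<^esub> x"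

lemma alg_A: "algebra k A"
  using group_scheme by (simp add: affine_group_scheme_def)

lemma pt_group: "algebra k R \<Longrightarrow> group (Xf R)"
  using group_scheme by (simp add: affine_group_scheme_def)

lemma pt_carrier: "algebra k R \<Longrightarrow> carrier (Xf R) = alg_hom k A R"
  using group_scheme by (simp add: affine_group_scheme_def)

lemma pull_hom: "algebra k R \<Longrightarrow> algebra k S \<Longrightarrow> f \<in> alg_hom k R S \<Longrightarrow> pull f \<in> hom (Xf R) (Xf S)"
  using group_scheme by (simp add: affine_group_scheme_def)

lemma
  assumes R: "algebra k R"
  shows pt_mult: "x \<in> alg_hom k A R \<Longrightarrow> y \<in> alg_hom k A R \<Longrightarrow> x \<otimes>\<^bsub>Xf R\<^esub> y \<in> alg_hom k A R"
    and pt_inv: "x \<in> alg_hom k A R \<Longrightarrow> inv\<^bsub>Xf R\<^esub> x \<in> alg_hom k A R"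
    and pt_one: "\<one>\<^bsub>Xf R\<^esub> \<in> alg_hom k A R"
    and pt_assoc: "x \<in> alg_hom k A R \<Longrightarrow> y \<in> alg_hom k A R \<Longrightarrow> z \<in> alg_hom k A R \<Longrightarrow>
      x \<otimes>\<^bsub>Xf R\<^esub> y \<otimes>\<^bsub>Xf R\<^esub> z = x \<otimes>\<^bsub>Xf R\<^esub> (y \<otimes>\<^bsub>Xf R\<^esub> z)"
    and pt_inv_inv: "x \<in> alg_hom k A R \<Longrightarrow> inv\<^bsub>Xf R\<^esub> (inv\<^bsub>Xf R\<^esub> x) = x"
    and pt_inv_mult: "x \<in> alg_hom k A R \<Longrightarrow> y \<in> alg_hom k A R \<Longrightarrow>
      inv\<^bsub>Xf R\<^esub> (x \<otimes>\<^bsub>Xf R\<^esub> y) = inv\<^bsub>Xf R\<^esub> y \<otimes>\<^bsub>Xf R\<^esub> inv\<^bsub>Xf R\<^esub> x"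
    and pt_cancel: "x \<in> alg_hom k A R \<Longrightarrow> y \<in> alg_hom k A R \<Longrightarrow> x \<otimes>\<^bsub>Xf R\<^esub> (inv\<^bsub>Xf R\<^esub> x \<otimes>\<^bsub>Xf R\<^esub> y) = y"
      "x \<in> alg_hom k A R \<Longrightarrow> y \<in> alg_hom k A R \<Longrightarrow> inv\<^bsub>Xf R\<^esub> x \<otimes>\<^bsub>Xf R\<^esub> (x \<otimes>\<^bsub>Xf R\<^esub> y) = y"
      "x \<in> alg_hom k A R \<Longrightarrow> x \<otimes>\<^bsub>Xf R\<^esub> inv\<^bsub>Xf R\<^esub> x = \<one>\<^bsub>Xf R\<^esub>"
      "x \<in> alg_hom k A R \<Longrightarrow> inv\<^bsub>Xf R\<^esub> x \<otimes>\<^bsub>Xf R\<^esub> x = \<one>\<^bsub>Xf R\<^esub>"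
      "x \<in> alg_hom k A R \<Longrightarrow> x \<otimes>\<^bsub>Xf R\<^esub> \<one>\<^bsub>Xf R\<^esub> = x"
      "x \<in> alg_hom k A R \<Longrightarrow> \<one>\<^bsub>Xf R\<^esub> \<otimes>\<^bsub>Xf R\<^esub> x = x"
      "inv\<^bsub>Xf R\<^esub> \<one>\<^bsub>Xf R\<^esub> = \<one>\<^bsub>Xf R\<^esub>"
proof -
  interpret group "Xf R" by (rule pt_group[OF R])
  note c = pt_carrier[OF R]
  show "x \<in> alg_hom k A R \<Longrightarrow> y \<in> alg_hom k A R \<Longrightarrow> x \<otimes>\<^bsub>Xf R\<^esub> y \<in> alg_hom k A R"
    "x \<in> alg_hom k A R \<Longrightarrow> inv\<^bsub>Xf R\<^esub> x \<in> alg_hom k A R"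
    "\<one>\<^bsub>Xf R\<^esub> \<in> alg_hom k A R"
    "x \<in> alg_hom k A R \<Longrightarrow> y \<in> alg_hom k A R \<Longrightarrow> z \<in> alg_hom k A R \<Longrightarrow>
      x \<otimes>\<^bsub>Xf R\<^esub> y \<otimes>\<^bsub>Xf R\<^esub> z = x \<otimes>\<^bsub>Xf R\<^esub> (y \<otimes>\<^bsub>Xf R\<^esub> z)"
    "x \<in> alg_hom k A R \<Longrightarrow> inv\<^bsub>Xf R\<^esub> (inv\<^bsub>Xf R\<^esub> x) = x"
    "x \<in> alg_hom k A R \<Longrightarrow> y \<in> alg_hom k A R \<Longrightarrow>
      inv\<^bsub>Xf R\<^esub> (x \<otimes>\<^bsub>Xf R\<^esub> y) = inv\<^bsub>Xf R\<^esub> y \<otimes>\<^bsub>Xf R\<^esub> inv\<^bsub>Xf R\<^esub> x"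
    "x \<in> alg_hom k A R \<Longrightarrow> x \<otimes>\<^bsub>Xf R\<^esub> inv\<^bsub>Xf R\<^esub> x = \<one>\<^bsub>Xf R\<^esub>"
    "x \<in> alg_hom k A R \<Longrightarrow> inv\<^bsub>Xf R\<^esub> x \<otimes>\<^bsub>Xf R\<^esub> x = \<one>\<^bsub>Xf R\<^esub>"
    "x \<in> alg_hom k A R \<Longrightarrow> x \<otimes>\<^bsub>Xf R\<^esub> \<one>\<^bsub>Xf R\<^esub> = x"
    "x \<in> alg_hom k A R \<Longrightarrow> \<one>\<^bsub>Xf R\<^esub> \<otimes>\<^bsub>Xf R\<^esub> x = x"
    "inv\<^bsub>Xf R\<^esub> \<one>\<^bsub>Xf R\<^esub> = \<one>\<^bsub>Xf R\<^esub>"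
    using m_assoc inv_mult_group unfolding c[symmetric] by simp_all
  show "x \<in> alg_hom k A R \<Longrightarrow> y \<in> alg_hom k A R \<Longrightarrow> x \<otimes>\<^bsub>Xf R\<^esub> (inv\<^bsub>Xf R\<^esub> x \<otimes>\<^bsub>Xf R\<^esub> y) = y"
    "x \<in> alg_hom k A R \<Longrightarrow> y \<in> alg_hom k A R \<Longrightarrow> inv\<^bsub>Xf R\<^esub> x \<otimes>\<^bsub>Xf R\<^esub> (x \<otimes>\<^bsub>Xf R\<^esub> y) = y"
    unfolding c[symmetric] by (simp_all add: m_assoc[symmetric])
qed

text \<open>As rewrite rules these bring words in points to a right-nested reduced form, which
  settles the conjugation identities below.\<close>

lemmas pt_simps = pt_mult pt_inv pt_one pt_assoc pt_inv_inv pt_inv_mult pt_cancel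

lemma
  assumes R: "algebra k R" and S: "algebra k S" and f: "f \<in> alg_hom k R S"
  shows pull_closed: "x \<in> alg_hom k A R \<Longrightarrow> pull f x \<in> alg_hom k A S"
    and pull_mult: "x \<in> alg_hom k A R \<Longrightarrow> y \<in> alg_hom k A R \<Longrightarrow>
      pull f (x \<otimes>\<^bsub>Xf R\<^esub> y) = pull f x \<otimes>\<^bsub>Xf S\<^esub> pull f y"
    and pull_inv: "x \<in> alg_hom k A R \<Longrightarrow> pull f (inv\<^bsub>Xf R\<^esub> x) = inv\<^bsub>Xf S\<^esub> pull f x"
    and pull_cp: "x \<in> cp I R \<Longrightarrow> I \<subseteq> carrier A \<Longrightarrow> pull f x \<in> cp I S"
proof -
  interpret group_hom "Xf R" "Xf S" "pull f"
    using pull_hom[OF R S f] pt_group R S by (simp add: group_hom_def group_hom_axioms_def)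
  note c = pt_carrier[OF R, symmetric]
  show "x \<in> alg_hom k A R \<Longrightarrow> pull f x \<in> alg_hom k A S" by (rule alg_hom_compose[OF alg_A _ f])
  show "x \<in> alg_hom k A R \<Longrightarrow> y \<in> alg_hom k A R \<Longrightarrow>
      pull f (x \<otimes>\<^bsub>Xf R\<^esub> y) = pull f x \<otimes>\<^bsub>Xf S\<^esub> pull f y"
    "x \<in> alg_hom k A R \<Longrightarrow> pull f (inv\<^bsub>Xf R\<^esub> x) = inv\<^bsub>Xf S\<^esub> pull f x"
    unfolding c by simp_all
  show "x \<in> cp I R \<Longrightarrow> I \<subseteq> carrier A \<Longrightarrow> pull f x \<in> cp I S"
    unfolding closed_points_def using alg_hom_compose[OF alg_A _ f] alg_hom_zero[OF f R S]
    by (auto simp: compose_eq subset_iff)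
qed

lemma cj_closed: "algebra k R \<Longrightarrow> x \<in> alg_hom k A R \<Longrightarrow> h \<in> alg_hom k A R \<Longrightarrow> cj R x h \<in> alg_hom k A R"
  by (simp add: pt_simps)

lemma cj_mult: "algebra k R \<Longrightarrow> x \<in> alg_hom k A R \<Longrightarrow> y \<in> alg_hom k A R \<Longrightarrow> h \<in> alg_hom k A R \<Longrightarrow>
    cj R (x \<otimes>\<^bsub>Xf R\<^esub> y) h = cj R x (cj R y h)"
  by (simp add: pt_simps)

lemma cj_one: "algebra k R \<Longrightarrow> h \<in> alg_hom k A R \<Longrightarrow> cj R \<one>\<^bsub>Xf R\<^esub> h = h"
  by (simp add: pt_simps)

lemma cj_cj_inv: "algebra k R \<Longrightarrow> x \<in> alg_hom k A R \<Longrightarrow> h \<in> alg_hom k A R \<Longrightarrow> cj R x (cj R (inv\<^bsub>Xf R\<^esub> x) h) = h"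
  by (simp add: pt_simps)

lemma cj_inv_cj: "algebra k R \<Longrightarrow> x \<in> alg_hom k A R \<Longrightarrow> h \<in> alg_hom k A R \<Longrightarrow> cj R (inv\<^bsub>Xf R\<^esub> x) (cj R x h) = h"
  by (simp add: pt_simps)

lemma pull_cj:
  assumes "algebra k R" "algebra k S" "f \<in> alg_hom k R S" "x \<in> alg_hom k A R" "h \<in> alg_hom k A R"
  shows "pull f (cj R x h) = cj S (pull f x) (pull f h)"
  using assms by (simp add: pull_mult pull_inv pt_simps(1-3))

lemma pull_pull: "x \<in> alg_hom k A R \<Longrightarrow> pull g (pull f x) = pull (compose (carrier R) g f) x"
  by (rule compose_alg_assoc)

lemma cp_sub: "x \<in> cp I R \<Longrightarrow> x \<in> alg_hom k A R"
  by (simp add: closed_points_def)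

text \<open>The inclusion x H x\<inverse> \<subseteq> H' after every base change. This one-sided
  relation composes, defines the normalizer, and cuts out a closed subscheme.\<close>

definition sends :: "'u alg \<Rightarrow> 'u pt \<Rightarrow> 'u set \<Rightarrow> 'u set \<Rightarrow> bool" where
  "sends R x H H' \<longleftrightarrow> (\<forall>S f. algebra k S \<longrightarrow> f \<in> alg_hom k R S \<longrightarrow>
     (\<forall>h\<in>cp H S. cj S (pull f x) h \<in> cp H' S))"

lemma sendsI:
  assumes "\<And>S f h. algebra k S \<Longrightarrow> f \<in> alg_hom k R S \<Longrightarrow> h \<in> cp H S \<Longrightarrow> cj S (pull f x) h \<in> cp H' S"
  shows "sends R x H H'"
  using assms unfolding sends_def by blast

lemma sendsD: "sends R x H H' \<Longrightarrow> algebra k S \<Longrightarrow> f \<in> alg_hom k R S \<Longrightarrow> h \<in> cp H S \<Longrightarrow>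
    cj S (pull f x) h \<in> cp H' S"
  unfolding sends_def by blast

lemma sends_cp:
  assumes "sends R x H H'" "algebra k R" "x \<in> alg_hom k A R" "h \<in> cp H R"
  shows "cj R x h \<in> cp H' R"
  using sendsD[OF assms(1,2) alg_hom_id[OF assms(2)] assms(4)] by (simp add: compose_alg_id[OF assms(3)])

lemma sends_pull:
  assumes "sends R x H H'" "algebra k R" "algebra k S" "f \<in> alg_hom k R S" "x \<in> alg_hom k A R"
  shows "sends S (pull f x) H H'"
proof (rule sendsI)
  fix T g h assume T: "algebra k T" and g: "g \<in> alg_hom k S T" and h: "h \<in> cp H T"
  show "cj T (pull g (pull f x)) h \<in> cp H' T"
    unfolding pull_pull[OF assms(5)]
    by (rule sendsD[OF assms(1) T alg_hom_compose[OF assms(2,4) g] h])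
qed

lemma sends_mult:
  assumes x: "sends R x H' H''" "x \<in> alg_hom k A R" and y: "sends R y H H'" "y \<in> alg_hom k A R"
    and R: "algebra k R"
  shows "sends R (x \<otimes>\<^bsub>Xf R\<^esub> y) H H''"
proof (rule sendsI)
  fix S f h assume S: "algebra k S" and f: "f \<in> alg_hom k R S" and h: "h \<in> cp H S"
  have "cj S (pull f x) (cj S (pull f y) h) \<in> cp H'' S"
    by (rule sendsD[OF x(1) S f sendsD[OF y(1) S f h]])
  then show "cj S (pull f (x \<otimes>\<^bsub>Xf R\<^esub> y)) h \<in> cp H'' S"
    using pull_mult[OF R S f x(2) y(2)]
      cj_mult[OF S pull_closed[OF R S f x(2)] pull_closed[OF R S f y(2)] cp_sub[OF h]] by simp
qed

lemma pull_one:
  assumes R: "algebra k R" and S: "algebra k S" and f: "f \<in> alg_hom k R S"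
  shows "pull f \<one>\<^bsub>Xf R\<^esub> = \<one>\<^bsub>Xf S\<^esub>"
  using pull_mult[OF R S f pt_one[OF R] pt_inv[OF R pt_one[OF R]]] pull_inv[OF R S f pt_one[OF R]]
    pt_cancel(3)[OF S pull_closed[OF R S f pt_one[OF R]]] pt_cancel(3)[OF R pt_one[OF R]] by simp

lemma sends_one:
  assumes R: "algebra k R"
  shows "sends R \<one>\<^bsub>Xf R\<^esub> H H"
proof (rule sendsI)
  fix S f h assume S: "algebra k S" and f: "f \<in> alg_hom k R S" and h: "h \<in> cp H S"
  show "cj S (pull f \<one>\<^bsub>Xf R\<^esub>) h \<in> cp H S"
    unfolding pull_one[OF R S f] cj_one[OF S cp_sub[OF h]] by (rule h)
qed

lemma conjugates_iff:
  assumes R: "algebra k R" and x: "x \<in> alg_hom k A R"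
  shows "conjugates k A Xf R x H H' \<longleftrightarrow> sends R x H H' \<and> sends R (inv\<^bsub>Xf R\<^esub> x) H' H"
proof -
  have "cj S (pull f x) ` cp H S = cp H' S \<longleftrightarrow>
      (\<forall>h\<in>cp H S. cj S (pull f x) h \<in> cp H' S) \<and> (\<forall>h\<in>cp H' S. cj S (pull f (inv\<^bsub>Xf R\<^esub> x)) h \<in> cp H S)"
    (is "?L \<longleftrightarrow> ?M") if S: "algebra k S" and f: "f \<in> alg_hom k R S" for S f
  proof -
    note px = pull_closed[OF R S f x]
    have pi: "pull f (inv\<^bsub>Xf R\<^esub> x) = inv\<^bsub>Xf S\<^esub> pull f x" by (rule pull_inv[OF R S f x])
    show ?thesis unfolding pi
    proof (intro iffI conjI ballI)
      fix h assume L: "cj S (pull f x) ` cp H S = cp H' S"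
      { assume "h \<in> cp H S" then show "cj S (pull f x) h \<in> cp H' S" using L by blast }
      assume "h \<in> cp H' S"
      then obtain g where g: "g \<in> cp H S" "h = cj S (pull f x) g" using L by blast
      show "cj S (inv\<^bsub>Xf S\<^esub> pull f x) h \<in> cp H S"
        unfolding g(2) cj_inv_cj[OF S px cp_sub[OF g(1)]] by (rule g(1))
    next
      assume M: "(\<forall>h\<in>cp H S. cj S (pull f x) h \<in> cp H' S) \<and> (\<forall>h\<in>cp H' S. cj S (inv\<^bsub>Xf S\<^esub> pull f x) h \<in> cp H S)"
      show "cj S (pull f x) ` cp H S = cp H' S"
      proof
        show "cj S (pull f x) ` cp H S \<subseteq> cp H' S" using M by blast
        show "cp H' S \<subseteq> cj S (pull f x) ` cp H S"
        proof
          fix h assume h: "h \<in> cp H' S"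
          show "h \<in> cj S (pull f x) ` cp H S"
            by (rule image_eqI, rule cj_cj_inv[OF S px cp_sub[OF h], symmetric])
              (rule M[THEN conjunct2, THEN bspec, OF h])
        qed
      qed
    qed
  qed
  then show ?thesis unfolding conjugates_def sends_def Let_def by meson
qed

lemma normalizer_points_eq:
  assumes R: "algebra k R"
  shows "normalizer_points k A Xf G R = {x \<in> alg_hom k A R. sends R x G G}"
  unfolding normalizer_points_def sends_def pt_carrier[OF R] by blast

lemma transporter_eq:
  assumes R: "algebra k R"
  shows "transporter k A Xf H G R = {x \<in> alg_hom k A R. sends R x H G \<and> sends R (inv\<^bsub>Xf R\<^esub> x) G H}"
  unfolding transporter_def pt_carrier[OF R] using conjugates_iff[OF R] by blast

section \<open>Universal points of closed subschemes and closed conditions\<close>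

lemma quot_point:
  assumes q: "is_quot k A H C \<pi>" and H: "H \<subseteq> carrier A" and S: "algebra k S" and y: "y \<in> alg_hom k C S"
  shows "compose (carrier A) y \<pi> \<in> cp H S"
proof -
  have C: "algebra k C" and \<pi>: "\<pi> \<in> alg_hom k A C" and ker: "\<And>a. a \<in> carrier A \<Longrightarrow> \<pi> a = \<zero>\<^bsub>C\<^esub> \<longleftrightarrow> a \<in> H"
    using q by (auto simp: is_quot_def)
  have "compose (carrier A) y \<pi> a = \<zero>\<^bsub>S\<^esub>" if "a \<in> H" for a
    using that H ker[of a] alg_hom_zero[OF y C S] by (auto simp: compose_eq subset_iff)
  then show ?thesis using alg_hom_compose[OF alg_A \<pi> y] by (simp add: closed_points_def)
qed

lemma cp_factor:
  assumes q: "is_quot k A H C \<pi>" and H: "ideal H A" and S: "algebra k S" and x: "x \<in> cp H S"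
  obtains y where "y \<in> alg_hom k C S" "compose (carrier A) y \<pi> = x"
  using is_quot_factor[OF q alg_A H S, of x] x unfolding closed_points_def by blast

lemma cp_genideal:
  assumes R: "algebra k R" and x: "x \<in> alg_hom k A R" and Z: "Z \<subseteq> carrier A"
  shows "x \<in> cp (Idl\<^bsub>A\<^esub> Z) R \<longleftrightarrow> (\<forall>a\<in>Z. x a = \<zero>\<^bsub>R\<^esub>)"
proof -
  interpret A: algebra k A by (rule alg_A)
  interpret R: algebra k R by fact
  interpret x: ring_hom_ring A R x
    using x by (intro ring_hom_ringI2 A.ring_axioms R.ring_axioms alg_hom_ring_hom)
  have "ideal {a \<in> carrier A. x a = \<zero>\<^bsub>R\<^esub>} A" using x.kernel_is_ideal unfolding a_kernel_def' .
  then have "(\<forall>a\<in>Z. x a = \<zero>\<^bsub>R\<^esub>) \<Longrightarrow> Idl\<^bsub>A\<^esub> Z \<subseteq> {a \<in> carrier A. x a = \<zero>\<^bsub>R\<^esub>}"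
    using Z by (intro A.genideal_minimal) auto
  moreover have "Z \<subseteq> Idl\<^bsub>A\<^esub> Z" using Z by (rule A.genideal_self)
  ultimately show ?thesis using x unfolding closed_points_def by blast
qed

text \<open>The basis of C is fixed before R, so that the coordinates over different bases R can be
  compared by \<open>is_tensor_cf_natural\<close>.\<close>

lemma tensor_obtain:
  fixes C :: "'u alg"
  assumes C: "algebra k C"
  obtains E cd where "alg_basis k C E cd" "\<And>e c. c \<in> carrier C \<Longrightarrow> cd e c \<in> carrier k"
    "\<And>R. algebra k R \<Longrightarrow> \<exists>T i j cf. is_tensor k R C cd T i j cf"
proof -
  interpret field_alg k C using C field_k by (simp add: field_alg_def)
  obtain E cd where b: "alg_basis k C E cd" using alg_basis_exists by blast
  moreover have "c \<in> carrier C \<Longrightarrow> cd e c \<in> carrier k" for e c using b unfolding alg_basis_def by blast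
  moreover have "\<exists>T i j cf. is_tensor k R C cd T i j cf" if R: "algebra k R" for R
    using tensor_exists[OF universe field_k R C b] by metis
  ultimately show ?thesis using that by blast
qed

text \<open>
  The condition on \<open>x\<close> that \<open>\<mu>(x, h) \<in> I\<close> for all \<open>h \<in> H\<close> is tested on the universal
  point \<open>h\<close>, over \<open>A \<otimes> A/H\<close>.  As \<open>A/H\<close> is free over \<open>k\<close>, it is the vanishing
  of the coordinates in \<open>A\<close> of certain elements of \<open>A \<otimes> A/H\<close>.
\<close>

theorem closed_locus:
  assumes H: "ideal H A" and I: "I \<subseteq> carrier A"
    and cl: "\<And>S x h. algebra k S \<Longrightarrow> x \<in> alg_hom k A S \<Longrightarrow> h \<in> alg_hom k A S \<Longrightarrow> \<mu> S x h \<in> alg_hom k A S"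
    and nat: "\<And>S S' f x h. algebra k S \<Longrightarrow> algebra k S' \<Longrightarrow> f \<in> alg_hom k S S' \<Longrightarrow>
      x \<in> alg_hom k A S \<Longrightarrow> h \<in> alg_hom k A S \<Longrightarrow> pull f (\<mu> S x h) = \<mu> S' (pull f x) (pull f h)"
  shows "\<exists>J. ideal J A \<and> (\<forall>R x. algebra k R \<longrightarrow> x \<in> alg_hom k A R \<longrightarrow>
    x \<in> cp J R \<longleftrightarrow> (\<forall>S f. algebra k S \<longrightarrow> f \<in> alg_hom k R S \<longrightarrow> (\<forall>h\<in>cp H S. \<mu> S (pull f x) h \<in> cp I S)))"
proof -
  interpret A: algebra k A by (rule alg_A)
  have Hc: "H \<subseteq> carrier A" using H by (simp add: additive_subgroup.a_subset ideal.axioms(1))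
  obtain C :: "'u alg" and \<pi> where q: "is_quot k A H C \<pi>" using is_quot_exists[OF alg_A H] .
  then have C: "algebra k C" and \<pi>: "\<pi> \<in> alg_hom k A C" by (simp_all add: is_quot_def)
  obtain E cd where b: "alg_basis k C E cd" and cd: "\<And>e c. c \<in> carrier C \<Longrightarrow> cd e c \<in> carrier k"
    and te: "\<And>R. algebra k R \<Longrightarrow> \<exists>T i j cf. is_tensor k R C cd T i j cf" using tensor_obtain[OF C] by metis
  obtain T i j cf where t: "is_tensor k A C cd T i j cf" using te[OF alg_A] by blast
  note T = is_tensor_algebra[OF t] and i = is_tensor_inl[OF t] and j = is_tensor_inr[OF t]
  \<comment> \<open>The value of \<mu> at the universal pair: as a point of X over T,
    \<open>i\<close> is the pullback of the identity of A, and
    \<open>compose (carrier A) j \<pi>\<close> is the universal point of H.\<close>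
  define m where "m = \<mu> T i (compose (carrier A) j \<pi>)"
  have j\<pi>: "compose (carrier A) j \<pi> \<in> alg_hom k A T" by (rule alg_hom_compose[OF alg_A \<pi> j])
  have m: "m \<in> alg_hom k A T" unfolding m_def by (rule cl[OF T i j\<pi>])
  define Z where "Z = {cf (m a) e | a e. a \<in> I}"
  have Z: "Z \<subseteq> carrier A"
    unfolding Z_def using is_tensor_cf_closed[OF t alg_hom_closed[OF m]] I by blast
  have main: "x \<in> cp (Idl\<^bsub>A\<^esub> Z) R \<longleftrightarrow>
      (\<forall>S f. algebra k S \<longrightarrow> f \<in> alg_hom k R S \<longrightarrow> (\<forall>h\<in>cp H S. \<mu> S (pull f x) h \<in> cp I S))"
    (is "?L \<longleftrightarrow> ?M") if R: "algebra k R" and x: "x \<in> alg_hom k A R" for R x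
  proof -
    obtain T' i' j' cf' where t': "is_tensor k R C cd T' i' j' cf'" using te[OF R] by blast
    note T' = is_tensor_algebra[OF t'] and i' = is_tensor_inl[OF t'] and j' = is_tensor_inr[OF t']
    have ix: "pull i' x \<in> alg_hom k A T'" by (rule alg_hom_compose[OF alg_A x i'])
    \<comment> \<open>h is x \<otimes> id, from A \<otimes> C to R \<otimes> C; it specialises the
      universal first argument to x and keeps the universal point of H.\<close>
    obtain h where h: "h \<in> alg_hom k T T'" "pull h i = pull i' x" "compose (carrier C) h j = j'"
      using is_tensor_factor[OF t T' ix j'] .
    let ?p = "compose (carrier A) j' \<pi>"
    have p: "?p \<in> cp H T'" by (rule quot_point[OF q Hc T' j'])
    have hp: "pull h (compose (carrier A) j \<pi>) = ?p" unfolding compose_alg_assoc[OF \<pi>] h(3) ..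
    have hm: "pull h m = \<mu> T' (pull i' x) ?p"
      unfolding m_def using nat[OF T T' h(1) i j\<pi>] unfolding h(2) hp .
    have co: "cf' (h (m a)) e = x (cf (m a) e)" if "a \<in> carrier A" for a e
      by (rule is_tensor_cf_natural[OF t t' alg_A R x h(1) h(2) h(3) alg_hom_closed[OF m that] cd])
    have zero_iff: "(\<forall>a\<in>I. pull h m a = \<zero>\<^bsub>T'\<^esub>) \<longleftrightarrow> ?L"
      unfolding cp_genideal[OF R x Z]
    proof
      assume hz: "\<forall>a\<in>I. pull h m a = \<zero>\<^bsub>T'\<^esub>"
      show "\<forall>z\<in>Z. x z = \<zero>\<^bsub>R\<^esub>"
      proof
        fix z assume "z \<in> Z"
        then obtain a e where a: "a \<in> I" "z = cf (m a) e" unfolding Z_def by blast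
        have ac: "a \<in> carrier A" using a(1) I by blast
        have "h (m a) = \<zero>\<^bsub>T'\<^esub>" using bspec[OF hz a(1)] ac by (simp add: compose_eq)
        then show "x z = \<zero>\<^bsub>R\<^esub>" using co[OF ac, of e] is_tensor_cf_of_zero[OF t' R] a(2) by simp
      qed
    next
      assume xz: "\<forall>z\<in>Z. x z = \<zero>\<^bsub>R\<^esub>"
      show "\<forall>a\<in>I. pull h m a = \<zero>\<^bsub>T'\<^esub>"
      proof
        fix a assume a: "a \<in> I"
        have ac: "a \<in> carrier A" using a I by blast
        have "x (cf (m a) e) = \<zero>\<^bsub>R\<^esub>" for e using xz a unfolding Z_def by blast
        then have "h (m a) = \<zero>\<^bsub>T'\<^esub>"
          using is_tensor_cf_zero[OF t' alg_hom_closed[OF h(1) alg_hom_closed[OF m ac]]] co[OF ac] by simp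
        then show "pull h m a = \<zero>\<^bsub>T'\<^esub>" using ac by (simp add: compose_eq)
      qed
    qed
    show ?thesis
    proof
      assume L: ?L
      then have hz: "\<forall>a\<in>I. pull h m a = \<zero>\<^bsub>T'\<^esub>" using zero_iff by blast
      show ?M
      proof (intro allI impI ballI)
        fix S f g assume S: "algebra k S" and f: "f \<in> alg_hom k R S" and g: "g \<in> cp H S"
        obtain y where y: "y \<in> alg_hom k C S" "compose (carrier A) y \<pi> = g" using cp_factor[OF q H S g] .
        obtain w where w: "w \<in> alg_hom k T' S" "compose (carrier R) w i' = f" "compose (carrier C) w j' = y"
          using is_tensor_factor[OF t' S f y(1)] .
        have "pull w (pull i' x) = pull f x" unfolding compose_alg_assoc[OF x] w(2) ..
        moreover have "pull w ?p = g" unfolding compose_alg_assoc[OF \<pi>] w(3) y(2) ..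
        ultimately have eq: "\<mu> S (pull f x) g = pull w (pull h m)"
          unfolding hm using nat[OF T' S w(1) ix cp_sub[OF p]] by simp
        have "pull h m \<in> cp I T'"
          using hz alg_hom_compose[OF alg_A m h(1)] by (simp add: closed_points_def)
        then show "\<mu> S (pull f x) g \<in> cp I S" unfolding eq by (rule pull_cp[OF T' S w(1) _ I])
      qed
    next
      assume M: ?M
      \<comment> \<open>A single instance of the condition suffices: the universal point of H over R
        \<otimes> C.\<close>
      have "\<mu> T' (pull i' x) ?p \<in> cp I T'" using M T' i' p by blast
      then have "\<forall>a\<in>I. pull h m a = \<zero>\<^bsub>T'\<^esub>" unfolding hm closed_points_def by blast
      then show ?L using zero_iff by blast
    qed
  qed
  have "ideal (Idl\<^bsub>A\<^esub> Z) A" by (rule A.genideal_ideal[OF Z])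
  then show ?thesis using main by blast
qed

corollary sends_locus:
  assumes H: "ideal H A" and I: "I \<subseteq> carrier A"
  shows "\<exists>J. ideal J A \<and> (\<forall>R x. algebra k R \<longrightarrow> x \<in> alg_hom k A R \<longrightarrow> x \<in> cp J R \<longleftrightarrow> sends R x H I)"
  unfolding sends_def by (rule closed_locus[where \<mu> = cj, OF H I cj_closed pull_cj])

lemma fg_quot:
  assumes q: "is_quot k A H C \<pi>"
  shows "fg_alg k C"
  using fg_alg_image[OF alg_A finitely_presented_fg[OF field_k fp_A]] q unfolding is_quot_def by blast

text \<open>
  Over the universal pair \<open>(x\<^sub>0, g\<^sub>0)\<close> of a point of the locus \<open>x G x\<inverse> \<subseteq> G\<close> and
  a point of \<open>G\<close>, the map \<open>(x, g) \<mapsto> (x, x g x\<inverse>)\<close> is given by a surjective endomorphism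
  \<open>\<theta>\<close> of a Noetherian ring, hence an injective one.  The value of \<open>\<theta>\<close> on
  \<open>x\<^sub>0\<inverse> g\<^sub>0 x\<^sub>0\<close> is \<open>g\<^sub>0\<close>.
\<close>

theorem sends_inv:
  assumes G: "ideal G A" and R: "algebra k R" and x: "x \<in> alg_hom k A R" and sx: "sends R x G G"
  shows "sends R (inv\<^bsub>Xf R\<^esub> x) G G"
proof -
  have Gc: "G \<subseteq> carrier A" using G by (simp add: additive_subgroup.a_subset ideal.axioms(1))
  obtain J where J: "ideal J A"
    and Js: "\<And>R x. algebra k R \<Longrightarrow> x \<in> alg_hom k A R \<Longrightarrow> x \<in> cp J R \<longleftrightarrow> sends R x G G"
    using sends_locus[OF G Gc] by blast
  have Jc: "J \<subseteq> carrier A" using J by (simp add: additive_subgroup.a_subset ideal.axioms(1))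
  obtain D :: "'u alg" and \<rho> where q: "is_quot k A J D \<rho>" using is_quot_exists[OF alg_A J] .
  then have D: "algebra k D" and \<rho>: "\<rho> \<in> alg_hom k A D" by (simp_all add: is_quot_def)
  obtain C :: "'u alg" and \<pi> where q': "is_quot k A G C \<pi>" using is_quot_exists[OF alg_A G] .
  then have C: "algebra k C" and \<pi>: "\<pi> \<in> alg_hom k A C" and sur: "\<pi> ` carrier A = carrier C"
    by (simp_all add: is_quot_def)
  obtain E cd where te: "\<And>R. algebra k R \<Longrightarrow> \<exists>T i j cf. is_tensor k R C cd T i j cf"
    using tensor_obtain[OF C] by metis
  obtain T i j cf where t: "is_tensor k D C cd T i j cf" using te[OF D] by blast
  note T = is_tensor_algebra[OF t] and i = is_tensor_inl[OF t] and j = is_tensor_inr[OF t]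
  interpret T: algebra k T by (rule T)
  define x0 where "x0 = compose (carrier A) i \<rho>"
  define g0 where "g0 = compose (carrier A) j \<pi>"
  have x0J: "x0 \<in> cp J T" unfolding x0_def by (rule quot_point[OF q Jc T i])
  have g0: "g0 \<in> cp G T" unfolding g0_def by (rule quot_point[OF q' Gc T j])
  note x0 = cp_sub[OF x0J] and g0h = cp_sub[OF g0]
  have s0: "sends T x0 G G" using Js[OF T x0] x0J by blast
  have g': "cj T x0 g0 \<in> cp G T" by (rule sends_cp[OF s0 T x0 g0])
  \<comment> \<open>By the choice of D the conjugate of g0 is again a point of G, hence factors
    through C. This is what lets \<theta> be an endomorphism of T.\<close>
  obtain g1 where g1: "g1 \<in> alg_hom k C T" "compose (carrier A) g1 \<pi> = cj T x0 g0"
    using cp_factor[OF q' G T g'] .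
  obtain \<theta> where \<theta>: "\<theta> \<in> alg_hom k T T" "compose (carrier D) \<theta> i = i" "compose (carrier C) \<theta> j = g1"
    using is_tensor_factor[OF t T i g1(1)] .
  have \<theta>x: "pull \<theta> x0 = x0" unfolding x0_def compose_alg_assoc[OF \<rho>] \<theta>(2) ..
  have \<theta>g: "pull \<theta> g0 = cj T x0 g0" unfolding g0_def compose_alg_assoc[OF \<pi>] \<theta>(3) using g1(2) unfolding g0_def .
  \<comment> \<open>At this stage y is only a point of X. Since \<theta> carries y to g0, which
    vanishes on G, injectivity of \<theta> will show that y vanishes on G as well.\<close>
  define y where "y = cj T (inv\<^bsub>Xf T\<^esub> x0) g0"
  have y: "y \<in> alg_hom k A T" unfolding y_def by (rule cj_closed[OF T pt_inv[OF T x0] g0h])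
  have "pull \<theta> y = cj T (inv\<^bsub>Xf T\<^esub> x0) (cj T x0 g0)"
    unfolding y_def pull_cj[OF T T \<theta>(1) pt_inv[OF T x0] g0h] pull_inv[OF T T \<theta>(1) x0] \<theta>x \<theta>g ..
  then have \<theta>y: "pull \<theta> y = g0" unfolding cj_inv_cj[OF T x0 g0h] .
  have \<theta>ya: "\<theta> (y a) = g0 a" if "a \<in> carrier A" for a
    using fun_cong[OF \<theta>y, of a] that by (simp add: compose_eq)
  \<comment> \<open>T is additively generated by the products of \<open>i d\<close> and
    \<open>j (\<pi> a)\<close>. Such a product is the image of \<open>i d\<close> times
    \<open>y a\<close>, because \<theta> fixes \<open>i d\<close> and sends \<open>y a\<close> to
    \<open>g0 a\<close>.\<close>
  have "\<theta> ` carrier T = carrier T"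
  proof
    show "\<theta> ` carrier T \<subseteq> carrier T" using alg_hom_closed[OF \<theta>(1)] by blast
    have "t' \<in> \<theta> ` carrier T" if "t' \<in> carrier T" for t'
    proof (rule is_tensor_induct[OF t that])
      fix d c assume d: "d \<in> carrier D" and c: "c \<in> carrier C"
      then obtain a where a: "a \<in> carrier A" "c = \<pi> a" using sur by blast
      have "\<theta> (i d) = i d" using fun_cong[OF \<theta>(2), of d] d by (simp add: compose_eq)
      moreover have "\<theta> (y a) = j c" using \<theta>ya[OF a(1)] a by (simp add: g0_def compose_eq)
      ultimately have "\<theta> (i d \<otimes>\<^bsub>T\<^esub> y a) = i d \<otimes>\<^bsub>T\<^esub> j c"
        using alg_hom_mult[OF \<theta>(1) alg_hom_closed[OF i d] alg_hom_closed[OF y a(1)]] by simp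
      moreover have "i d \<otimes>\<^bsub>T\<^esub> y a \<in> carrier T"
        using alg_hom_closed[OF i d] alg_hom_closed[OF y a(1)] by simp
      ultimately show "i d \<otimes>\<^bsub>T\<^esub> j c \<in> \<theta> ` carrier T" by (metis image_eqI)
    next
      fix u v assume "u \<in> \<theta> ` carrier T" "v \<in> \<theta> ` carrier T"
      then obtain u' v' where uv: "u' \<in> carrier T" "v' \<in> carrier T" "u = \<theta> u'" "v = \<theta> v'" by blast
      have "\<theta> (u' \<oplus>\<^bsub>T\<^esub> v') = u \<oplus>\<^bsub>T\<^esub> v" using alg_hom_add[OF \<theta>(1) uv(1,2)] uv(3,4) by simp
      moreover have "u' \<oplus>\<^bsub>T\<^esub> v' \<in> carrier T" using uv by simp
      ultimately show "u \<oplus>\<^bsub>T\<^esub> v \<in> \<theta> ` carrier T" by (metis image_eqI)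
    qed
    then show "carrier T \<subseteq> \<theta> ` carrier T" by blast
  qed
  note inj = noetherian_surj_endo_inj[OF fg_alg_noetherian[OF field_k T
        is_tensor_fg[OF t D fg_quot[OF q] C fg_quot[OF q']]] alg_hom_ring_hom[OF \<theta>(1)] this]
  have "y a = \<zero>\<^bsub>T\<^esub>" if a: "a \<in> G" for a
  proof (rule inj)
    have ac: "a \<in> carrier A" using a Gc by blast
    show "y a \<in> carrier T" by (rule alg_hom_closed[OF y ac])
    show "\<theta> (y a) = \<zero>\<^bsub>T\<^esub>" using \<theta>ya[OF ac] g0 a unfolding closed_points_def by simp
  qed
  then have yG: "y \<in> cp G T" using y by (simp add: closed_points_def)
  show ?thesis
  proof (rule sendsI)
    fix S f h assume S: "algebra k S" and f: "f \<in> alg_hom k R S" and h: "h \<in> cp G S"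
    note fx = pull_closed[OF R S f x]
    \<comment> \<open>The pair of x over S and h is a specialisation of (x0, g0) along a
      homomorphism w from T to S, so the statement about y specialises too.\<close>
    have "pull f x \<in> cp J S" using Js[OF S fx] sends_pull[OF sx R S f x] by blast
    then obtain u where u: "u \<in> alg_hom k D S" "compose (carrier A) u \<rho> = pull f x"
      using cp_factor[OF q J S] by metis
    obtain v where v: "v \<in> alg_hom k C S" "compose (carrier A) v \<pi> = h" using cp_factor[OF q' G S h] .
    obtain w where w: "w \<in> alg_hom k T S" "compose (carrier D) w i = u" "compose (carrier C) w j = v"
      using is_tensor_factor[OF t S u(1) v(1)] .
    have wx: "pull w x0 = pull f x" unfolding x0_def compose_alg_assoc[OF \<rho>] w(2) u(2) ..
    have wg: "pull w g0 = h" unfolding g0_def compose_alg_assoc[OF \<pi>] w(3) v(2) ..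
    have "pull w y = cj S (inv\<^bsub>Xf S\<^esub> pull f x) h"
      unfolding y_def pull_cj[OF T S w(1) pt_inv[OF T x0] g0h] pull_inv[OF T S w(1) x0] wx wg ..
    then show "cj S (pull f (inv\<^bsub>Xf R\<^esub> x)) h \<in> cp G S"
      unfolding pull_inv[OF R S f x] using pull_cp[OF T S w(1) yG Gc] by simp
  qed
qed

end

section \<open>Transporters and torsors under the normalizer\<close>

locale forms = affine_gs k A Xf for k :: "'u ring" and A :: "'u alg" and Xf :: "'u grp_functor" +
  fixes K :: "'u alg" and G :: "'u set"
  assumes field_K: "field K" and alg_K: "algebra k K" and fp_G: "fp_closed_subgroup_scheme k A Xf G"
begin

abbreviation N :: "'u grp_functor" where "N \<equiv> normalizer_scheme k A Xf G"

abbreviation Tr :: "'u set \<Rightarrow> 'u alg \<Rightarrow> 'u pt set" where "Tr H R \<equiv> transporter k A Xf H G R"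

lemma closed_subgroupD:
  assumes "closed_subgroup_scheme k A Xf H"
  shows "ideal H A" and "H \<subseteq> carrier A" and "algebra k R \<Longrightarrow> subgroup (cp H R) (Xf R)"
  using assms unfolding closed_subgroup_scheme_def
  by (simp_all add: additive_subgroup.a_subset ideal.axioms(1))

lemma closed_G: "closed_subgroup_scheme k A Xf G"
  using fp_G by (simp add: fp_closed_subgroup_scheme_def)

lemmas G_ideal = closed_subgroupD(1)[OF closed_G]
  and G_sub = closed_subgroupD(2)[OF closed_G]
  and G_subgroup = closed_subgroupD(3)[OF closed_G]

section \<open>The normalizer as a group functor\<close>

lemma N_mult: "m \<otimes>\<^bsub>N R\<^esub> n = m \<otimes>\<^bsub>Xf R\<^esub> n"
  by (simp add: normalizer_scheme_def)

lemma N_carrier: "algebra k R \<Longrightarrow> carrier (N R) = {x \<in> alg_hom k A R. sends R x G G}"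
  by (simp add: normalizer_scheme_def normalizer_points_eq)

lemma
  assumes R: "algebra k R" and n: "n \<in> carrier (N R)"
  shows N_pt: "n \<in> alg_hom k A R" and N_sends: "sends R n G G"
    and N_sends_inv: "sends R (inv\<^bsub>Xf R\<^esub> n) G G"
proof -
  show 1: "n \<in> alg_hom k A R" and 2: "sends R n G G" using n unfolding N_carrier[OF R] by simp_all
  show "sends R (inv\<^bsub>Xf R\<^esub> n) G G" by (rule sends_inv[OF G_ideal R 1 2])
qed

lemma N_inv: "algebra k R \<Longrightarrow> n \<in> carrier (N R) \<Longrightarrow> inv\<^bsub>Xf R\<^esub> n \<in> carrier (N R)"
  using N_sends_inv[of R n] N_pt[of R n] pt_inv[of R n] by (simp add: N_carrier)

lemma N_subgroup:
  assumes R: "algebra k R"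
  shows "subgroup (carrier (N R)) (Xf R)"
proof (rule subgroup.intro)
  show "carrier (N R) \<subseteq> carrier (Xf R)" unfolding N_carrier[OF R] pt_carrier[OF R] by blast
  show "m \<otimes>\<^bsub>Xf R\<^esub> n \<in> carrier (N R)" if "m \<in> carrier (N R)" "n \<in> carrier (N R)" for m n
    using sends_mult[OF N_sends[OF R that(1)] N_pt[OF R that(1)] N_sends[OF R that(2)] N_pt[OF R that(2)] R]
      pt_mult[OF R N_pt[OF R that(1)] N_pt[OF R that(2)]] by (simp add: N_carrier[OF R])
  show "\<one>\<^bsub>Xf R\<^esub> \<in> carrier (N R)" using sends_one[OF R] pt_one[OF R] by (simp add: N_carrier[OF R])
qed (rule N_inv[OF R])

lemma N_group:
  assumes R: "algebra k R"
  shows "group (N R)"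
proof -
  have "N R = (Xf R)\<lparr>carrier := carrier (N R)\<rparr>" by (simp add: normalizer_scheme_def)
  then show ?thesis using subgroup.subgroup_is_group[OF N_subgroup[OF R] pt_group[OF R]] by simp
qed

lemma N_pull:
  assumes R: "algebra k R" and S: "algebra k S" and f: "f \<in> alg_hom k R S" and n: "n \<in> carrier (N R)"
  shows "pull f n \<in> carrier (N S)"
  using sends_pull[OF N_sends[OF R n] R S f N_pt[OF R n]] pull_closed[OF R S f N_pt[OF R n]]
  by (simp add: N_carrier[OF S])

section \<open>Transporters under the two translations\<close>

lemma
  assumes R: "algebra k R" and x: "x \<in> Tr H R"
  shows Tr_pt: "x \<in> alg_hom k A R" and Tr_sends: "sends R x H G"
    and Tr_sends_inv: "sends R (inv\<^bsub>Xf R\<^esub> x) G H"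
  using x unfolding transporter_eq[OF R] by simp_all

lemma Tr_I: "algebra k R \<Longrightarrow> x \<in> alg_hom k A R \<Longrightarrow> sends R x H G \<Longrightarrow> sends R (inv\<^bsub>Xf R\<^esub> x) G H \<Longrightarrow> x \<in> Tr H R"
  by (simp add: transporter_eq)

lemma Tr_pull:
  assumes R: "algebra k R" and S: "algebra k S" and f: "f \<in> alg_hom k R S" and x: "x \<in> Tr H R"
  shows "pull f x \<in> Tr H S"
  using sends_pull[OF Tr_sends[OF R x] R S f Tr_pt[OF R x]]
    sends_pull[OF Tr_sends_inv[OF R x] R S f pt_inv[OF R Tr_pt[OF R x]]] pull_closed[OF R S f Tr_pt[OF R x]]
  by (intro Tr_I[OF S]) (simp_all add: pull_inv[OF R S f Tr_pt[OF R x]])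

lemma Tr_N_mult:
  assumes R: "algebra k R" and n: "n \<in> carrier (N R)" and x: "x \<in> Tr H R"
  shows "n \<otimes>\<^bsub>Xf R\<^esub> x \<in> Tr H R"
proof (rule Tr_I[OF R])
  note np = N_pt[OF R n] and xp = Tr_pt[OF R x]
  show "n \<otimes>\<^bsub>Xf R\<^esub> x \<in> alg_hom k A R" by (rule pt_mult[OF R np xp])
  show "sends R (n \<otimes>\<^bsub>Xf R\<^esub> x) H G" by (rule sends_mult[OF N_sends[OF R n] np Tr_sends[OF R x] xp R])
  show "sends R (inv\<^bsub>Xf R\<^esub> (n \<otimes>\<^bsub>Xf R\<^esub> x)) G H"
    unfolding pt_inv_mult[OF R np xp]
    by (rule sends_mult[OF Tr_sends_inv[OF R x] pt_inv[OF R xp] N_sends_inv[OF R n] pt_inv[OF R np] R])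
qed

lemma Tr_quotient:
  assumes R: "algebra k R" and x: "x \<in> Tr H R" and y: "y \<in> Tr H R"
  shows "y \<otimes>\<^bsub>Xf R\<^esub> inv\<^bsub>Xf R\<^esub> x \<in> carrier (N R)"
  using sends_mult[OF Tr_sends[OF R y] Tr_pt[OF R y] Tr_sends_inv[OF R x] pt_inv[OF R Tr_pt[OF R x]] R]
    pt_mult[OF R Tr_pt[OF R y] pt_inv[OF R Tr_pt[OF R x]]] by (simp add: N_carrier[OF R])

text \<open>Right translation by y leads from the transporter of H to that of H' when y H'
  y\<inverse> = H. With y defined over k this gives the morphism between the two torsors.\<close>

lemma Tr_conj:
  assumes R: "algebra k R" and x: "x \<in> Tr H R" and y: "y \<in> alg_hom k A R"
    and s: "sends R y H' H" "sends R (inv\<^bsub>Xf R\<^esub> y) H H'"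
  shows "x \<otimes>\<^bsub>Xf R\<^esub> y \<in> Tr H' R"
proof (rule Tr_I[OF R])
  note xp = Tr_pt[OF R x]
  show "x \<otimes>\<^bsub>Xf R\<^esub> y \<in> alg_hom k A R" by (rule pt_mult[OF R xp y])
  show "sends R (x \<otimes>\<^bsub>Xf R\<^esub> y) H' G" by (rule sends_mult[OF Tr_sends[OF R x] xp s(1) y R])
  show "sends R (inv\<^bsub>Xf R\<^esub> (x \<otimes>\<^bsub>Xf R\<^esub> y)) G H'"
    unfolding pt_inv_mult[OF R xp y]
    by (rule sends_mult[OF s(2) pt_inv[OF R y] Tr_sends_inv[OF R x] pt_inv[OF R xp] R])
qed

text \<open>The two inclusions x H x\<inverse> \<subseteq> G and x\<inverse> G x \<subseteq> H are
  separate closed conditions, from \<open>closed_locus\<close> with conjugation by x and by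
  x\<inverse>; the sum of their ideals cuts out the intersection.\<close>

lemma Tr_closed:
  assumes H: "ideal H A"
  shows "\<exists>J. ideal J A \<and> (\<forall>R. algebra k R \<longrightarrow> cp J R = Tr H R)"
proof -
  interpret A: algebra k A by (rule alg_A)
  have Hc: "H \<subseteq> carrier A" using H by (simp add: additive_subgroup.a_subset ideal.axioms(1))
  obtain J1 where J1: "ideal J1 A"
    "\<And>R x. algebra k R \<Longrightarrow> x \<in> alg_hom k A R \<Longrightarrow> x \<in> cp J1 R \<longleftrightarrow> sends R x H G"
    using sends_locus[OF H G_sub] by blast
  let ?\<mu> = "\<lambda>S x h. cj S (inv\<^bsub>Xf S\<^esub> x) h"
  have cl: "?\<mu> S x h \<in> alg_hom k A S" if "algebra k S" "x \<in> alg_hom k A S" "h \<in> alg_hom k A S" for S x h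
    by (rule cj_closed[OF that(1) pt_inv[OF that(1,2)] that(3)])
  have nat: "pull f (?\<mu> S x h) = ?\<mu> S' (pull f x) (pull f h)"
    if "algebra k S" "algebra k S'" "f \<in> alg_hom k S S'" "x \<in> alg_hom k A S" "h \<in> alg_hom k A S" for S S' f x h
    unfolding pull_cj[OF that(1-3) pt_inv[OF that(1,4)] that(5)] pull_inv[OF that(1-4)] ..
  obtain J2 where J2: "ideal J2 A" and J2': "\<And>R x. algebra k R \<Longrightarrow> x \<in> alg_hom k A R \<Longrightarrow>
      x \<in> cp J2 R \<longleftrightarrow> (\<forall>S f. algebra k S \<longrightarrow> f \<in> alg_hom k R S \<longrightarrow> (\<forall>h\<in>cp G S. ?\<mu> S (pull f x) h \<in> cp H S))"
    using closed_locus[where \<mu> = ?\<mu>, OF G_ideal Hc cl nat] by blast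
  have J2'': "x \<in> cp J2 R \<longleftrightarrow> sends R (inv\<^bsub>Xf R\<^esub> x) G H" if R: "algebra k R" and x: "x \<in> alg_hom k A R" for R x
  proof -
    have "pull f (inv\<^bsub>Xf R\<^esub> x) = inv\<^bsub>Xf S\<^esub> pull f x" if "algebra k S" "f \<in> alg_hom k R S" for S f
      by (rule pull_inv[OF R that x])
    then show ?thesis unfolding J2'[OF R x] sends_def by (metis (no_types, lifting))
  qed
  have Jc: "J1 \<union> J2 \<subseteq> carrier A"
    using J1(1) J2 by (simp add: additive_subgroup.a_subset ideal.axioms(1))
  have "cp (Idl\<^bsub>A\<^esub> (J1 \<union> J2)) R = Tr H R" if R: "algebra k R" for R
  proof (rule Set.set_eqI)
    fix x
    show "x \<in> cp (Idl\<^bsub>A\<^esub> (J1 \<union> J2)) R \<longleftrightarrow> x \<in> Tr H R"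
    proof (cases "x \<in> alg_hom k A R")
      case True
      have "x \<in> cp (Idl\<^bsub>A\<^esub> (J1 \<union> J2)) R \<longleftrightarrow> x \<in> cp J1 R \<and> x \<in> cp J2 R"
        unfolding cp_genideal[OF R True Jc] using True by (auto simp: closed_points_def)
      then show ?thesis
        unfolding J1(2)[OF R True] J2''[OF R True] transporter_eq[OF R] using True by blast
    next
      case False
      then show ?thesis using Tr_pt[OF R] cp_sub by blast
    qed
  qed
  then show ?thesis using A.genideal_ideal[OF Jc] by blast
qed

text \<open>An embedded split torsor seen from inside X, without a coordinate algebra or an action
  of its own. It mediates between the forms of G and the abstract embedded torsors.\<close>

definition torsor_ideal :: "'u set \<Rightarrow> bool" where
  "torsor_ideal P \<longleftrightarrow> ideal P A \<and> cp P K \<noteq> {} \<and>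
     (\<forall>R. algebra k R \<longrightarrow> (\<forall>n\<in>carrier (N R). \<forall>p\<in>cp P R. n \<otimes>\<^bsub>Xf R\<^esub> p \<in> cp P R) \<and>
        (\<forall>p\<in>cp P R. \<forall>q\<in>cp P R. q \<otimes>\<^bsub>Xf R\<^esub> inv\<^bsub>Xf R\<^esub> p \<in> carrier (N R)))"

lemma
  assumes "torsor_ideal P"
  shows torsor_ideal_ideal: "ideal P A"
    and torsor_ideal_sub: "P \<subseteq> carrier A"
    and torsor_ideal_K: "cp P K \<noteq> {}"
    and torsor_ideal_mult: "algebra k R \<Longrightarrow> n \<in> carrier (N R) \<Longrightarrow> p \<in> cp P R \<Longrightarrow> n \<otimes>\<^bsub>Xf R\<^esub> p \<in> cp P R"
    and torsor_ideal_quotient: "algebra k R \<Longrightarrow> p \<in> cp P R \<Longrightarrow> q \<in> cp P R \<Longrightarrow>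
      q \<otimes>\<^bsub>Xf R\<^esub> inv\<^bsub>Xf R\<^esub> p \<in> carrier (N R)"
  using assms unfolding torsor_ideal_def
  by (simp_all add: additive_subgroup.a_subset ideal.axioms(1))

lemma form_torsor_ideal:
  assumes H: "H \<in> form_subgroups k K A Xf G"
  obtains P where "torsor_ideal P" "\<And>R. algebra k R \<Longrightarrow> cp P R = Tr H R"
proof -
  have Hf: "fp_closed_subgroup_scheme k A Xf H" and cK: "conjugate_over k A Xf K G H"
    using H by (simp_all add: form_subgroups_def)
  have Hi: "ideal H A" using Hf closed_subgroupD(1) by (simp add: fp_closed_subgroup_scheme_def)
  obtain P where P: "ideal P A" "\<And>R. algebra k R \<Longrightarrow> cp P R = Tr H R" using Tr_closed[OF Hi] by blast
  obtain x where x: "x \<in> alg_hom k A K" "conjugates k A Xf K x G H"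
    using cK unfolding conjugate_over_def pt_carrier[OF alg_K] by blast
  have s: "sends K x G H" "sends K (inv\<^bsub>Xf K\<^esub> x) H G" using x(2) conjugates_iff[OF alg_K x(1)] by blast+
  \<comment> \<open>The conjugation over K leads from G to H, while points of the transporter lead
    from H to G; hence the inverse.\<close>
  have "inv\<^bsub>Xf K\<^esub> x \<in> Tr H K"
    by (rule Tr_I[OF alg_K pt_inv[OF alg_K x(1)] s(2)]) (simp add: pt_inv_inv[OF alg_K x(1)] s(1))
  then have "cp P K \<noteq> {}" using P(2)[OF alg_K] by blast
  then have "torsor_ideal P"
    unfolding torsor_ideal_def using P Tr_N_mult Tr_quotient by simp
  then show ?thesis using P(2) that by blast
qed

text \<open>A point over K is a homomorphism from B to a nonzero ring. That 1 \<noteq> 0 in B is the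
  condition for descent along k \<rightarrow> B.\<close>

lemma torsor_quot_nontrivial:
  fixes B :: "'u alg"
  assumes P: "torsor_ideal P" and q: "is_quot k A P B \<phi>"
  shows "alg_hom k B K \<noteq> {}" and "\<one>\<^bsub>B\<^esub> \<noteq> \<zero>\<^bsub>B\<^esub>"
proof -
  obtain x where x: "x \<in> cp P K" using torsor_ideal_K[OF P] by blast
  obtain e where e: "e \<in> alg_hom k B K" "pull e \<phi> = x"
    using cp_factor[OF q torsor_ideal_ideal[OF P] alg_K x] .
  then show "alg_hom k B K \<noteq> {}" by blast
  have B: "algebra k B" using q by (simp add: is_quot_def)
  interpret K: field K by (rule field_K)
  show "\<one>\<^bsub>B\<^esub> \<noteq> \<zero>\<^bsub>B\<^esub>"
    using alg_hom_one[OF e(1)] alg_hom_zero[OF e(1) B alg_K] K.one_not_zero by metis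
qed

text \<open>\<open>H\<close> consists of the points \<open>h\<close> with \<open>p h p\<inverse> \<in> G\<close> for all points \<open>p\<close> of the torsor.\<close>

lemma torsor_ideal_form:
  assumes P: "torsor_ideal P"
  obtains H where "H \<in> form_subgroups k K A Xf G" "\<And>R. algebra k R \<Longrightarrow> cp P R = Tr H R"
proof -
  note Pi = torsor_ideal_ideal[OF P] and Pc = torsor_ideal_sub[OF P]
  \<comment> \<open>In \<open>closed_locus\<close> the universally quantified argument now runs over
    P and conjugates, while the argument x, whose locus is sought, is conjugated.\<close>
  let ?\<mu> = "\<lambda>S x h. cj S h x"
  have cl: "?\<mu> S x h \<in> alg_hom k A S" if "algebra k S" "x \<in> alg_hom k A S" "h \<in> alg_hom k A S" for S x h
    by (rule cj_closed[OF that(1,3,2)])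
  have nat: "pull f (?\<mu> S x h) = ?\<mu> S' (pull f x) (pull f h)"
    if "algebra k S" "algebra k S'" "f \<in> alg_hom k S S'" "x \<in> alg_hom k A S" "h \<in> alg_hom k A S" for S S' f x h
    by (rule pull_cj[OF that(1-3,5,4)])
  obtain H where Hi: "ideal H A" and H: "\<And>R x. algebra k R \<Longrightarrow> x \<in> alg_hom k A R \<Longrightarrow>
      x \<in> cp H R \<longleftrightarrow> (\<forall>S f. algebra k S \<longrightarrow> f \<in> alg_hom k R S \<longrightarrow> (\<forall>p\<in>cp P S. cj S p (pull f x) \<in> cp G S))"
    using closed_locus[where \<mu> = ?\<mu>, OF Pi G_sub cl nat] by blast
  have Hc: "H \<subseteq> carrier A" using Hi by (simp add: additive_subgroup.a_subset ideal.axioms(1))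
  have HI: "x \<in> cp H R" if R: "algebra k R" and x: "x \<in> alg_hom k A R"
    and s: "\<And>S f p. algebra k S \<Longrightarrow> f \<in> alg_hom k R S \<Longrightarrow> p \<in> cp P S \<Longrightarrow> cj S p (pull f x) \<in> cp G S" for R x
    using H[OF R x] s by blast
  have HD: "cj S p (pull f x) \<in> cp G S"
    if R: "algebra k R" and x: "x \<in> cp H R" and S: "algebra k S" "f \<in> alg_hom k R S" "p \<in> cp P S" for R S x f p
    using H[OF R cp_sub[OF x]] x S by blast
  have sg: "subgroup (cp H R) (Xf R)" if R: "algebra k R" for R
  proof (rule subgroup.intro)
    show "cp H R \<subseteq> carrier (Xf R)" unfolding pt_carrier[OF R] using cp_sub by blast
    show "\<one>\<^bsub>Xf R\<^esub> \<in> cp H R"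
    proof (rule HI[OF R pt_one[OF R]])
      fix S f p assume S: "algebra k S" and f: "f \<in> alg_hom k R S" and p: "p \<in> cp P S"
      have "cj S p (pull f \<one>\<^bsub>Xf R\<^esub>) = \<one>\<^bsub>Xf S\<^esub>"
        unfolding pull_one[OF R S f] using cp_sub[OF p] by (simp add: pt_simps[OF S])
      then show "cj S p (pull f \<one>\<^bsub>Xf R\<^esub>) \<in> cp G S" using subgroup.one_closed[OF G_subgroup[OF S]] by simp
    qed
    fix x assume x: "x \<in> cp H R"
    show "inv\<^bsub>Xf R\<^esub> x \<in> cp H R"
    proof (rule HI[OF R pt_inv[OF R cp_sub[OF x]]])
      fix S f p assume S: "algebra k S" and f: "f \<in> alg_hom k R S" and p: "p \<in> cp P S"
      note fx = pull_closed[OF R S f cp_sub[OF x]]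
      have "cj S p (pull f (inv\<^bsub>Xf R\<^esub> x)) = inv\<^bsub>Xf S\<^esub> (cj S p (pull f x))"
        unfolding pull_inv[OF R S f cp_sub[OF x]] using cp_sub[OF p] fx by (simp add: pt_simps[OF S])
      then show "cj S p (pull f (inv\<^bsub>Xf R\<^esub> x)) \<in> cp G S"
        using subgroup.m_inv_closed[OF G_subgroup[OF S] HD[OF R x S f p]] by simp
    qed
    fix y assume y: "y \<in> cp H R"
    show "x \<otimes>\<^bsub>Xf R\<^esub> y \<in> cp H R"
    proof (rule HI[OF R pt_mult[OF R cp_sub[OF x] cp_sub[OF y]]])
      fix S f p assume S: "algebra k S" and f: "f \<in> alg_hom k R S" and p: "p \<in> cp P S"
      note fx = pull_closed[OF R S f cp_sub[OF x]] and fy = pull_closed[OF R S f cp_sub[OF y]]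
      have "cj S p (pull f (x \<otimes>\<^bsub>Xf R\<^esub> y)) = cj S p (pull f x) \<otimes>\<^bsub>Xf S\<^esub> cj S p (pull f y)"
        unfolding pull_mult[OF R S f cp_sub[OF x] cp_sub[OF y]]
        using cp_sub[OF p] fx fy by (simp add: pt_simps[OF S])
      then show "cj S p (pull f (x \<otimes>\<^bsub>Xf R\<^esub> y)) \<in> cp G S"
        using subgroup.m_closed[OF G_subgroup[OF S] HD[OF R x S f p] HD[OF R y S f p]] by simp
    qed
  qed
  have "closed_subgroup_scheme k A Xf H" using Hi sg by (simp add: closed_subgroup_scheme_def)
  moreover have "finitely_presented k (quot_alg A H)"
    by (rule finitely_presented_quotient[OF field_k fp_A quot_alg_algebra[OF alg_A Hi] quot_alg_hom[OF alg_A Hi]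
        quot_alg_surj[OF alg_A Hi]])
  ultimately have fpH: "fp_closed_subgroup_scheme k A Xf H" by (simp add: fp_closed_subgroup_scheme_def)
  have PTr: "p \<in> Tr H R" if R: "algebra k R" and p: "p \<in> cp P R" for R p
  proof (rule Tr_I[OF R cp_sub[OF p]])
    show "sends R p H G"
    proof (rule sendsI)
      fix S f h assume S: "algebra k S" and f: "f \<in> alg_hom k R S" and h: "h \<in> cp H S"
      have "cj S (pull f p) (pull (\<lambda>x\<in>carrier S. x) h) \<in> cp G S"
        by (rule HD[OF S h S alg_hom_id[OF S] pull_cp[OF R S f p Pc]])
      then show "cj S (pull f p) h \<in> cp G S" unfolding compose_alg_id[OF cp_sub[OF h]] .
    qed
    show "sends R (inv\<^bsub>Xf R\<^esub> p) G H"
    proof (rule sendsI)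
      fix S f g assume S: "algebra k S" and f: "f \<in> alg_hom k R S" and g: "g \<in> cp G S"
      let ?q = "pull f p"
      have q: "?q \<in> cp P S" by (rule pull_cp[OF R S f p Pc])
      note qh = cp_sub[OF q] and gh = cp_sub[OF g]
      show "cj S (pull f (inv\<^bsub>Xf R\<^esub> p)) g \<in> cp H S"
        unfolding pull_inv[OF R S f cp_sub[OF p]]
      proof (rule HI[OF S cj_closed[OF S pt_inv[OF S qh] gh]])
        fix S' f' p' assume S': "algebra k S'" and f': "f' \<in> alg_hom k S S'" and p': "p' \<in> cp P S'"
        let ?q' = "pull f' ?q" and ?g' = "pull f' g"
        have q': "?q' \<in> cp P S'" by (rule pull_cp[OF S S' f' q Pc])
        have g': "?g' \<in> cp G S'" by (rule pull_cp[OF S S' f' g G_sub])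
        \<comment> \<open>For a second point p' of P, conjugating q'\<inverse> g' q' by p' amounts
          to conjugating g' by p' q'\<inverse>, which normalizes G. Hence q'\<inverse> g' q' meets
          the condition defining H.\<close>
        have n: "p' \<otimes>\<^bsub>Xf S'\<^esub> inv\<^bsub>Xf S'\<^esub> ?q' \<in> carrier (N S')" by (rule torsor_ideal_quotient[OF P S' q' p'])
        have "cj S' p' (pull f' (cj S (inv\<^bsub>Xf S\<^esub> ?q) g)) = cj S' (p' \<otimes>\<^bsub>Xf S'\<^esub> inv\<^bsub>Xf S'\<^esub> ?q') ?g'"
          unfolding pull_cj[OF S S' f' pt_inv[OF S qh] gh] pull_inv[OF S S' f' qh]
          by (rule cj_mult[OF S' cp_sub[OF p'] pt_inv[OF S' cp_sub[OF q']] cp_sub[OF g'], symmetric])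
        then show "cj S' p' (pull f' (cj S (inv\<^bsub>Xf S\<^esub> ?q) g)) \<in> cp G S'"
          using sends_cp[OF N_sends[OF S' n] S' N_pt[OF S' n] g'] by simp
      qed
    qed
  qed
  obtain p where p: "p \<in> cp P K" using torsor_ideal_K[OF P] by blast
  note pK = PTr[OF alg_K p]
  have "conjugates k A Xf K (inv\<^bsub>Xf K\<^esub> p) G H"
    using conjugates_iff[OF alg_K pt_inv[OF alg_K cp_sub[OF p]]] Tr_sends[OF alg_K pK] Tr_sends_inv[OF alg_K pK]
    by (simp add: pt_inv_inv[OF alg_K cp_sub[OF p]])
  then have "conjugate_over k A Xf K G H"
    unfolding conjugate_over_def pt_carrier[OF alg_K] using pt_inv[OF alg_K cp_sub[OF p]] by blast
  then have "H \<in> form_subgroups k K A Xf G" using fpH by (simp add: form_subgroups_def)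
  moreover have "cp P R = Tr H R" if R: "algebra k R" for R
  proof
    show "cp P R \<subseteq> Tr H R" using PTr[OF R] by blast
    show "Tr H R \<subseteq> cp P R"
    proof
      fix x assume x: "x \<in> Tr H R"
      note xp = Tr_pt[OF R x]
      \<comment> \<open>P may have no point over R, but over R \<otimes> B it has the universal
        point p, and x = (x p\<inverse>) p with x p\<inverse> in the normalizer. The vanishing of x
        on P comes back to R because R \<rightarrow> R \<otimes> B is injective.\<close>
      obtain B :: "'u alg" and \<phi> where q: "is_quot k A P B \<phi>" using is_quot_exists[OF alg_A Pi] .
      have B: "algebra k B" using q by (simp add: is_quot_def)
      obtain E cd where b: "alg_basis k B E cd"
        and te: "\<And>R. algebra k R \<Longrightarrow> \<exists>T i j cf. is_tensor k R B cd T i j cf" using tensor_obtain[OF B] by metis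
      obtain T i j cf where t: "is_tensor k R B cd T i j cf" using te[OF R] by blast
      note T = is_tensor_algebra[OF t] and i = is_tensor_inl[OF t] and j = is_tensor_inr[OF t]
      let ?p = "pull j \<phi>" and ?x = "pull i x"
      have p: "?p \<in> cp P T" by (rule quot_point[OF q Pc T j])
      note xT = Tr_pull[OF R T i x] and xh = pull_closed[OF R T i xp]
      have n: "?x \<otimes>\<^bsub>Xf T\<^esub> inv\<^bsub>Xf T\<^esub> ?p \<in> carrier (N T)" by (rule Tr_quotient[OF T PTr[OF T p] xT])
      have "(?x \<otimes>\<^bsub>Xf T\<^esub> inv\<^bsub>Xf T\<^esub> ?p) \<otimes>\<^bsub>Xf T\<^esub> ?p \<in> cp P T" by (rule torsor_ideal_mult[OF P T n p])
      then have xP: "?x \<in> cp P T" using cp_sub[OF p] xh by (simp add: pt_simps[OF T])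
      have "x a = \<zero>\<^bsub>R\<^esub>" if a: "a \<in> P" for a
      proof (rule inj_onD[OF is_tensor_inl_inj[OF t field_k R B b torsor_quot_nontrivial(2)[OF P q]]])
        have ac: "a \<in> carrier A" using a Pc by blast
        show "x a \<in> carrier R" by (rule alg_hom_closed[OF xp ac])
        show "\<zero>\<^bsub>R\<^esub> \<in> carrier R" by (rule algebra_zero[OF R])
        have "?x a = \<zero>\<^bsub>T\<^esub>" using xP a by (simp add: closed_points_def)
        then show "i (x a) = i \<zero>\<^bsub>R\<^esub>" using ac alg_hom_zero[OF i R T] by (simp add: compose_eq)
      qed
      then show "x \<in> cp P R" using xp by (simp add: closed_points_def)
    qed
  qed
  ultimately show ?thesis using that by blast
qed

section \<open>Embedded torsors and their ideals\<close>

abbreviation torsors :: "('u alg \<times> 'u action) set" where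
  "torsors \<equiv> split_embedded_torsors k K A Xf N"

lemma surj_pull_eqD:
  assumes "\<phi> ` carrier A = carrier B" "e \<in> alg_hom k B R" "e' \<in> alg_hom k B R" "pull e \<phi> = pull e' \<phi>"
  shows "e = e'"
proof (rule alg_hom_eqI[OF assms(2,3)])
  fix b assume "b \<in> carrier B"
  then obtain a where "a \<in> carrier A" "b = \<phi> a" using assms(1) by blast
  then show "e b = e' b" using fun_cong[OF assms(4), of a] by (simp add: compose_eq)
qed

text \<open>Left multiplication in X carried back to points of B; surjectivity of the map from A to
  B makes the preimage unique. The restriction makes each map extensional, as membership in
  \<open>Bij\<close> requires.\<close>

definition trans_act :: "'u set \<Rightarrow> 'u alg \<Rightarrow> ('u \<Rightarrow> 'u) \<Rightarrow> 'u action" where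
  "trans_act P B \<phi> R n = (\<lambda>e\<in>alg_hom k B R. THE e'. e' \<in> alg_hom k B R \<and> pull e' \<phi> = n \<otimes>\<^bsub>Xf R\<^esub> pull e \<phi>)"

lemma trans_act:
  assumes P: "torsor_ideal P" and q: "is_quot k A P B \<phi>" and R: "algebra k R"
    and n: "n \<in> carrier (N R)" and e: "e \<in> alg_hom k B R"
  shows trans_act_closed: "trans_act P B \<phi> R n e \<in> alg_hom k B R"
    and trans_act_pull: "pull (trans_act P B \<phi> R n e) \<phi> = n \<otimes>\<^bsub>Xf R\<^esub> pull e \<phi>"
proof -
  have sur: "\<phi> ` carrier A = carrier B" using q by (simp add: is_quot_def)
  have "n \<otimes>\<^bsub>Xf R\<^esub> pull e \<phi> \<in> cp P R"
    by (rule torsor_ideal_mult[OF P R n quot_point[OF q torsor_ideal_sub[OF P] R e]])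
  then obtain e' where e': "e' \<in> alg_hom k B R" "pull e' \<phi> = n \<otimes>\<^bsub>Xf R\<^esub> pull e \<phi>"
    using cp_factor[OF q torsor_ideal_ideal[OF P] R] by metis
  have "\<exists>!e'. e' \<in> alg_hom k B R \<and> pull e' \<phi> = n \<otimes>\<^bsub>Xf R\<^esub> pull e \<phi>"
    using e' surj_pull_eqD[OF sur] by (metis (no_types, lifting))
  from theI'[OF this] show "trans_act P B \<phi> R n e \<in> alg_hom k B R"
    "pull (trans_act P B \<phi> R n e) \<phi> = n \<otimes>\<^bsub>Xf R\<^esub> pull e \<phi>"
    using e by (simp_all add: trans_act_def)
qed

lemma trans_act_action:
  assumes P: "torsor_ideal P" and q: "is_quot k A P B \<phi>"
  shows "scheme_action k A N B (trans_act P B \<phi>)"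
  unfolding scheme_action_def
proof (intro conjI allI impI ballI)
  have sur: "\<phi> ` carrier A = carrier B" and \<phi>: "\<phi> \<in> alg_hom k A B" using q by (simp_all add: is_quot_def)
  show "algebra k B" using q by (simp add: is_quot_def)
  note cl = trans_act_closed[OF P q] and pl = trans_act_pull[OF P q]
  { fix R :: "'u alg" assume R: "algebra k R"
    let ?a = "trans_act P B \<phi> R" and ?E = "alg_hom k B R"
    have \<phi>e: "pull e \<phi> \<in> alg_hom k A R" if "e \<in> ?E" for e by (rule alg_hom_compose[OF alg_A \<phi> that])
    have am: "?a (m \<otimes>\<^bsub>Xf R\<^esub> n) e = ?a m (?a n e)"
      if m: "m \<in> carrier (N R)" and n: "n \<in> carrier (N R)" and e: "e \<in> ?E" for m n e
    proof (rule surj_pull_eqD[OF sur])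
      have mn: "m \<otimes>\<^bsub>Xf R\<^esub> n \<in> carrier (N R)" by (rule subgroup.m_closed[OF N_subgroup[OF R] m n])
      show "?a (m \<otimes>\<^bsub>Xf R\<^esub> n) e \<in> ?E" by (rule cl[OF R mn e])
      show "?a m (?a n e) \<in> ?E" by (rule cl[OF R m cl[OF R n e]])
      show "pull (?a (m \<otimes>\<^bsub>Xf R\<^esub> n) e) \<phi> = pull (?a m (?a n e)) \<phi>"
        unfolding pl[OF R mn e] pl[OF R m cl[OF R n e]] pl[OF R n e]
        by (rule pt_assoc[OF R N_pt[OF R m] N_pt[OF R n] \<phi>e[OF e]])
    qed
    have one: "\<one>\<^bsub>Xf R\<^esub> \<in> carrier (N R)" by (rule subgroup.one_closed[OF N_subgroup[OF R]])
    have a1: "?a \<one>\<^bsub>Xf R\<^esub> e = e" if e: "e \<in> ?E" for e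
      by (rule surj_pull_eqD[OF sur cl[OF R one e] e]) (simp add: pl[OF R one e] pt_simps[OF R] \<phi>e[OF e])
    have bij: "?a n \<in> Bij ?E" if n: "n \<in> carrier (N R)" for n
    proof -
      note ni = N_inv[OF R n] and np = N_pt[OF R n]
      have inv1: "?a (inv\<^bsub>Xf R\<^esub> n) (?a n e) = e" if e: "e \<in> ?E" for e
        using am[OF ni n e] a1[OF e] pt_cancel(4)[OF R np] by simp
      have inv2: "?a n (?a (inv\<^bsub>Xf R\<^esub> n) e) = e" if e: "e \<in> ?E" for e
        using am[OF n ni e] a1[OF e] pt_cancel(3)[OF R np] by simp
      have "bij_betw (?a n) ?E ?E"
        by (rule bij_betw_byWitness[where f' = "?a (inv\<^bsub>Xf R\<^esub> n)"])
          (use inv1 inv2 cl[OF R n] cl[OF R ni] in blast)+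
      then show ?thesis unfolding Bij_def by (simp add: trans_act_def)
    qed
    show "group_action (N R) ?E ?a"
    proof (rule group_action.intro, unfold group_hom_def group_hom_axioms_def, intro conjI N_group[OF R] group_BijGroup)
      show "?a \<in> hom (N R) (BijGroup ?E)"
      proof (rule homI)
        show "?a n \<in> carrier (BijGroup ?E)" if "n \<in> carrier (N R)" for n
          using bij[OF that] by (simp add: BijGroup_def)
        show "?a (m \<otimes>\<^bsub>N R\<^esub> n) = ?a m \<otimes>\<^bsub>BijGroup ?E\<^esub> ?a n"
          if m: "m \<in> carrier (N R)" and n: "n \<in> carrier (N R)" for m n
        proof -
          have "?a (m \<otimes>\<^bsub>Xf R\<^esub> n) = compose ?E (?a m) (?a n)"
            by (rule extensionalityI[of _ ?E]) (simp_all add: compose_eq am[OF m n], simp add: trans_act_def)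
          then show ?thesis using bij[OF m] bij[OF n] by (simp add: BijGroup_def N_mult)
        qed
      qed
    qed }
  fix R S :: "'u alg" and f n e
  assume R: "algebra k R" and S: "algebra k S" and f: "f \<in> alg_hom k R S"
    and n: "n \<in> carrier (N R)" and e: "e \<in> alg_hom k B R"
  have B: "algebra k B" using q by (simp add: is_quot_def)
  have fe: "compose (carrier B) f e \<in> alg_hom k B S" by (rule alg_hom_compose[OF B e f])
  note fn = N_pull[OF R S f n] and ce = cl[OF R n e]
  show "trans_act P B \<phi> S (pull f n) (compose (carrier B) f e) = compose (carrier B) f (trans_act P B \<phi> R n e)"
  proof (rule surj_pull_eqD[OF sur cl[OF S fn fe] alg_hom_compose[OF B ce f]])
    have "pull (compose (carrier B) f e) \<phi> = pull f (pull e \<phi>)"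
      by (rule compose_alg_assoc[OF \<phi>, symmetric])
    moreover have "pull (compose (carrier B) f (trans_act P B \<phi> R n e)) \<phi> = pull f (n \<otimes>\<^bsub>Xf R\<^esub> pull e \<phi>)"
      unfolding pl[OF R n e, symmetric] by (rule compose_alg_assoc[OF \<phi>, symmetric])
    ultimately show "pull (trans_act P B \<phi> S (pull f n) (compose (carrier B) f e)) \<phi> =
        pull (compose (carrier B) f (trans_act P B \<phi> R n e)) \<phi>"
      unfolding pl[OF S fn fe] using pull_mult[OF R S f N_pt[OF R n] alg_hom_compose[OF alg_A \<phi> e]] by simp
  qed
qed

lemma image_points_quot:
  assumes q: "is_quot k A P B \<phi>" and P: "ideal P A" and R: "algebra k R"
  shows "image_points k A B \<phi> R = cp P R"
proof
  have Pc: "P \<subseteq> carrier A" using P by (simp add: additive_subgroup.a_subset ideal.axioms(1))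
  show "image_points k A B \<phi> R \<subseteq> cp P R"
    unfolding image_points_def using quot_point[OF q Pc R] by blast
  show "cp P R \<subseteq> image_points k A B \<phi> R"
  proof
    fix x assume "x \<in> cp P R"
    then obtain e where "e \<in> alg_hom k B R" "pull e \<phi> = x" using cp_factor[OF q P R] by blast
    then show "x \<in> image_points k A B \<phi> R" unfolding image_points_def by blast
  qed
qed

lemma torsor_ideal_torsor:
  assumes P: "torsor_ideal P"
  obtains E \<phi> where "E \<in> torsors" "equivariant_closed_immersion k A Xf N E \<phi>"
    "\<And>R. algebra k R \<Longrightarrow> image_points k A (fst E) \<phi> R = cp P R"
proof -
  note Pi = torsor_ideal_ideal[OF P] and Pc = torsor_ideal_sub[OF P]
  obtain B :: "'u alg" and \<phi> where q: "is_quot k A P B \<phi>" using is_quot_exists[OF alg_A Pi] .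
  have sur: "\<phi> ` carrier A = carrier B" and \<phi>: "\<phi> \<in> alg_hom k A B" and B: "algebra k B"
    using q by (simp_all add: is_quot_def)
  let ?a = "trans_act P B \<phi>"
  note cl = trans_act_closed[OF P q] and pl = trans_act_pull[OF P q]
  have unique: "\<exists>!n. n \<in> carrier (N R) \<and> ?a R n e = e'"
    if R: "algebra k R" and e: "e \<in> alg_hom k B R" and e': "e' \<in> alg_hom k B R" for R e e'
  proof
    let ?n = "pull e' \<phi> \<otimes>\<^bsub>Xf R\<^esub> inv\<^bsub>Xf R\<^esub> pull e \<phi>"
    note p = alg_hom_compose[OF alg_A \<phi> e] and p' = alg_hom_compose[OF alg_A \<phi> e']
    have n: "?n \<in> carrier (N R)"
      by (rule torsor_ideal_quotient[OF P R quot_point[OF q Pc R e] quot_point[OF q Pc R e']])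
    have "?a R ?n e = e'"
      by (rule surj_pull_eqD[OF sur cl[OF R n e] e']) (simp add: pl[OF R n e] pt_simps[OF R] p p')
    with n show "?n \<in> carrier (N R) \<and> ?a R ?n e = e'" by blast
    fix m assume m: "m \<in> carrier (N R) \<and> ?a R m e = e'"
    then have "pull e' \<phi> = m \<otimes>\<^bsub>Xf R\<^esub> pull e \<phi>" using pl[OF R conjunct1[OF m] e] by simp
    then show "m = ?n" using N_pt[OF R conjunct1[OF m]] p by (simp add: pt_simps[OF R])
  qed
  \<comment> \<open>The torsor is trivialised by its own coordinate algebra: the identity of B is a
    point over B, and B is nonzero.\<close>
  have "finitely_presented k B" by (rule finitely_presented_quotient[OF field_k fp_A B \<phi> sur])
  moreover have "alg_hom k B B \<noteq> {}" using alg_hom_id[OF B] by blast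
  ultimately have cover: "\<exists>R :: 'u alg. finitely_presented k R \<and> \<one>\<^bsub>R\<^esub> \<noteq> \<zero>\<^bsub>R\<^esub> \<and> alg_hom k B R \<noteq> {}"
    using torsor_quot_nontrivial(2)[OF P q] by blast
  have "left_torsor k A N B ?a"
    unfolding left_torsor_def using trans_act_action[OF P q] unique cover by blast
  moreover have eci: "equivariant_closed_immersion k A Xf N (B, ?a) \<phi>"
    unfolding equivariant_closed_immersion_def equivariant_def fst_conv snd_conv using \<phi> sur pl by blast
  ultimately have "(B, ?a) \<in> torsors"
    unfolding split_embedded_torsors_def using torsor_quot_nontrivial(1)[OF P q] by blast
  then show ?thesis using that[OF _ eci] image_points_quot[OF q Pi] by simp
qed

text \<open>The ideal is the kernel of the immersion. If n takes e to e', equivariance shows that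
  the image of e' times the inverse of the image of e is n itself, so such quotients lie in the
  normalizer.\<close>

lemma torsor_embedding:
  assumes E: "(B, act) \<in> torsors" and \<phi>: "equivariant_closed_immersion k A Xf N (B, act) \<phi>"
  obtains P where "torsor_ideal P" "is_quot k A P B \<phi>"
proof -
  let ?P = "{a \<in> carrier A. \<phi> a = \<zero>\<^bsub>B\<^esub>}"
  have tor: "left_torsor k A N B act" and split: "alg_hom k B K \<noteq> {}"
    using E by (simp_all add: split_embedded_torsors_def)
  have sa: "scheme_action k A N B act"
    and trans: "\<And>R e e'. algebra k R \<Longrightarrow> e \<in> alg_hom k B R \<Longrightarrow> e' \<in> alg_hom k B R \<Longrightarrow>
      \<exists>!n. n \<in> carrier (N R) \<and> act R n e = e'"
    using tor unfolding left_torsor_def by blast+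
  have B: "algebra k B" using sa by (simp add: scheme_action_def)
  have ph: "\<phi> \<in> alg_hom k A B" and sur: "\<phi> ` carrier A = carrier B"
    and eq: "\<And>R n e. algebra k R \<Longrightarrow> n \<in> carrier (N R) \<Longrightarrow> e \<in> alg_hom k B R \<Longrightarrow>
      pull (act R n e) \<phi> = n \<otimes>\<^bsub>Xf R\<^esub> pull e \<phi>"
    using \<phi> unfolding equivariant_closed_immersion_def equivariant_def fst_conv snd_conv by blast+
  interpret A: algebra k A by (rule alg_A)
  interpret B: algebra k B by (rule B)
  interpret \<phi>: ring_hom_ring A B \<phi>
    by (intro ring_hom_ringI2 A.ring_axioms B.ring_axioms alg_hom_ring_hom[OF ph])
  have Pi: "ideal ?P A" using \<phi>.kernel_is_ideal unfolding a_kernel_def' .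
  have q: "is_quot k A ?P B \<phi>" using B ph sur by (simp add: is_quot_def)
  have Pc: "?P \<subseteq> carrier A" by blast
  obtain e where "e \<in> alg_hom k B K" using split by blast
  then have "cp ?P K \<noteq> {}" using quot_point[OF q Pc alg_K] by blast
  moreover have "n \<otimes>\<^bsub>Xf R\<^esub> p \<in> cp ?P R"
    if R: "algebra k R" and n: "n \<in> carrier (N R)" and p: "p \<in> cp ?P R" for R n p
  proof -
    obtain e where e: "e \<in> alg_hom k B R" "pull e \<phi> = p" using cp_factor[OF q Pi R p] .
    have "group_action (N R) (alg_hom k B R) (act R)" using sa R by (simp add: scheme_action_def)
    then have "act R n e \<in> alg_hom k B R" using n e(1) by (rule group_action.element_image) simp
    from quot_point[OF q Pc R this] show ?thesis unfolding eq[OF R n e(1)] e(2) .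
  qed
  moreover have "p' \<otimes>\<^bsub>Xf R\<^esub> inv\<^bsub>Xf R\<^esub> p \<in> carrier (N R)"
    if R: "algebra k R" and p: "p \<in> cp ?P R" and p': "p' \<in> cp ?P R" for R p p'
  proof -
    obtain e where e: "e \<in> alg_hom k B R" "pull e \<phi> = p" using cp_factor[OF q Pi R p] .
    obtain e' where e': "e' \<in> alg_hom k B R" "pull e' \<phi> = p'" using cp_factor[OF q Pi R p'] .
    obtain n where n: "n \<in> carrier (N R)" "act R n e = e'" using trans[OF R e(1) e'(1)] by blast
    have "p' = n \<otimes>\<^bsub>Xf R\<^esub> p" using eq[OF R n(1) e(1)] n(2) e(2) e'(2) by simp
    then have "p' \<otimes>\<^bsub>Xf R\<^esub> inv\<^bsub>Xf R\<^esub> p = n" using N_pt[OF R n(1)] cp_sub[OF p] by (simp add: pt_simps[OF R])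
    then show ?thesis using n(1) by simp
  qed
  ultimately have "torsor_ideal ?P" unfolding torsor_ideal_def using Pi by blast
  then show ?thesis using that q by blast
qed

section \<open>Existence in both directions\<close>

lemma form_has_torsor:
  assumes H: "H \<in> form_subgroups k K A Xf G"
  shows "\<exists>E\<in>torsors. transporter_torsor k A Xf G H E"
proof -
  obtain P where P: "torsor_ideal P" "\<And>R. algebra k R \<Longrightarrow> cp P R = Tr H R" using form_torsor_ideal[OF H] by blast
  obtain E \<phi> where "E \<in> torsors" "equivariant_closed_immersion k A Xf N E \<phi>"
    "\<And>R. algebra k R \<Longrightarrow> image_points k A (fst E) \<phi> R = cp P R" using torsor_ideal_torsor[OF P(1)] by blast
  then show ?thesis unfolding transporter_torsor_def using P(2) by metis
qed

lemma torsor_has_form: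
  assumes E: "E \<in> torsors"
  shows "\<exists>H\<in>form_subgroups k K A Xf G. transporter_torsor k A Xf G H E"
proof -
  obtain B act where Ba: "E = (B, act)" by (cases E)
  obtain \<phi> where \<phi>: "equivariant_closed_immersion k A Xf N (B, act) \<phi>"
    using E unfolding Ba split_embedded_torsors_def by blast
  obtain P where P: "torsor_ideal P" "is_quot k A P B \<phi>" using torsor_embedding[OF E[unfolded Ba] \<phi>] .
  obtain H where H: "H \<in> form_subgroups k K A Xf G" "\<And>R. algebra k R \<Longrightarrow> cp P R = Tr H R"
    using torsor_ideal_form[OF P(1)] by blast
  have "transporter_torsor k A Xf G H E"
    unfolding transporter_torsor_def Ba fst_conv
    using \<phi> image_points_quot[OF P(2) torsor_ideal_ideal[OF P(1)]] H(2) by metis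
  then show ?thesis using H(1) by blast
qed

end

section \<open>Points over the base field\<close>

definition struct_map :: "'k ring \<Rightarrow> ('k, 'a) module \<Rightarrow> 'k \<Rightarrow> 'a" where
  "struct_map k R = (\<lambda>c\<in>carrier k. c \<odot>\<^bsub>R\<^esub> \<one>\<^bsub>R\<^esub>)"

lemma self_alg_simps: "carrier (self_alg k) = carrier k" "\<one>\<^bsub>self_alg k\<^esub> = \<one>\<^bsub>k\<^esub>" "\<zero>\<^bsub>self_alg k\<^esub> = \<zero>\<^bsub>k\<^esub>"
  "x \<otimes>\<^bsub>self_alg k\<^esub> y = x \<otimes>\<^bsub>k\<^esub> y" "x \<oplus>\<^bsub>self_alg k\<^esub> y = x \<oplus>\<^bsub>k\<^esub> y" "x \<odot>\<^bsub>self_alg k\<^esub> y = x \<otimes>\<^bsub>k\<^esub> y"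
  by (simp_all add: self_alg_def)

lemma self_alg_algebra:
  assumes "field k"
  shows "algebra k (self_alg k)"
proof -
  interpret field k by fact
  have "cring (self_alg k)"
  proof (rule cringI)
    show "abelian_group (self_alg k)"
      by (rule abelian_groupI) (auto simp: self_alg_simps a_ac intro: l_neg bexI[of _ "\<ominus>\<^bsub>k\<^esub> _"])
    show "comm_monoid (self_alg k)"
      by (rule comm_monoidI) (simp_all add: self_alg_simps m_assoc, simp add: m_comm)
  qed (simp add: self_alg_simps l_distr)
  then show ?thesis
    by (intro algebraI) (simp_all add: self_alg_simps l_distr r_distr m_assoc is_cring)
qed

lemma struct_map_hom:
  assumes R: "algebra k R"
  shows "struct_map k R \<in> alg_hom k (self_alg k) R"
proof -
  interpret R: algebra k R by fact
  show ?thesis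
    by (rule alg_homI)
      (simp_all add: struct_map_def self_alg_simps R.smult_l_distr R.smult_assoc2 R.smult_assoc1)
qed

text \<open>The base field is initial among k-algebras, so a point over k has exactly one pullback
  to each R, written \<open>const_pt\<close> below.\<close>

lemma struct_map_unique:
  assumes k: "field k" and f: "f \<in> alg_hom k (self_alg k) R"
  shows "f = struct_map k R"
proof (rule extensionalityI[of _ "carrier k"])
  interpret field k by fact
  show "f \<in> extensional (carrier k)" using alg_hom_extensional[OF f] by (simp add: self_alg_simps)
  fix c assume c: "c \<in> carrier k"
  have "f (c \<odot>\<^bsub>self_alg k\<^esub> \<one>\<^bsub>self_alg k\<^esub>) = c \<odot>\<^bsub>R\<^esub> f \<one>\<^bsub>self_alg k\<^esub>"
    using c by (intro alg_hom_smult[OF f]) (simp_all add: self_alg_simps)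
  then show "f c = struct_map k R c"
    using c alg_hom_one[OF f] by (simp add: self_alg_simps struct_map_def)
qed (simp add: struct_map_def)

context affine_gs
begin

lemma alg_k: "algebra k (self_alg k)"
  by (rule self_alg_algebra[OF field_k])

abbreviation const_pt :: "'u alg \<Rightarrow> 'u pt \<Rightarrow> 'u pt" where
  "const_pt R x \<equiv> pull (struct_map k R) x"

lemma pull_const_pt:
  assumes R: "algebra k R" and f: "f \<in> alg_hom k R S" and x: "x \<in> alg_hom k A (self_alg k)"
  shows "pull f (const_pt R x) = const_pt S x"
  unfolding compose_alg_assoc[OF x]
  using struct_map_unique[OF field_k alg_hom_compose[OF alg_k struct_map_hom[OF R] f]] by simp

lemma const_pt_closed: "algebra k R \<Longrightarrow> x \<in> alg_hom k A (self_alg k) \<Longrightarrow> const_pt R x \<in> alg_hom k A R"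
  by (rule alg_hom_compose[OF alg_A _ struct_map_hom])

lemma conjugate_over_k_iff:
  "conjugate_over k A Xf (self_alg k) H H' \<longleftrightarrow>
     (\<exists>x\<in>alg_hom k A (self_alg k). sends (self_alg k) x H H' \<and> sends (self_alg k) (inv\<^bsub>Xf (self_alg k)\<^esub> x) H' H)"
  unfolding conjugate_over_def pt_carrier[OF alg_k] using conjugates_iff[OF alg_k] by blast

text \<open>As B is nonzero, k \<rightarrow> B is injective. The scalars behind the values of \<xi>
  are therefore unique, and this uniqueness makes their choice a homomorphism.\<close>

lemma constant_point:
  assumes B: "algebra k B" and ne: "\<one>\<^bsub>B\<^esub> \<noteq> \<zero>\<^bsub>B\<^esub>" and \<xi>: "\<xi> \<in> alg_hom k A B"
    and const: "\<And>a. a \<in> carrier A \<Longrightarrow> \<exists>c\<in>carrier k. \<xi> a = c \<odot>\<^bsub>B\<^esub> \<one>\<^bsub>B\<^esub>"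
  obtains x where "x \<in> alg_hom k A (self_alg k)" "const_pt B x = \<xi>"
proof -
  interpret k: field k by (rule field_k)
  interpret A: algebra k A by (rule alg_A)
  interpret B: algebra k B by fact
  let ?s = "struct_map k B"
  note s = struct_map_hom[OF B]
  have inj: "c = d" if cd: "c \<in> carrier k" "d \<in> carrier k" and eq: "?s c = ?s d" for c d
  proof (rule ccontr)
    assume "c \<noteq> d"
    let ?e = "c \<oplus>\<^bsub>k\<^esub> (\<ominus>\<^bsub>k\<^esub> d)"
    have "?e \<noteq> \<zero>\<^bsub>k\<^esub>"
    proof
      assume "?e = \<zero>\<^bsub>k\<^esub>"
      then have "\<ominus>\<^bsub>k\<^esub> (\<ominus>\<^bsub>k\<^esub> d) = c" using cd by (intro k.minus_equality) auto
      then show False using \<open>c \<noteq> d\<close> cd by simp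
    qed
    then have u: "?e \<in> Units k" using cd k.field_Units by simp
    have "?e \<odot>\<^bsub>B\<^esub> \<one>\<^bsub>B\<^esub> = \<zero>\<^bsub>B\<^esub>"
      using cd eq by (simp add: struct_map_def B.smult_l_distr B.smult_l_minus B.M.r_neg)
    then have "inv\<^bsub>k\<^esub> ?e \<odot>\<^bsub>B\<^esub> (?e \<odot>\<^bsub>B\<^esub> \<one>\<^bsub>B\<^esub>) = \<zero>\<^bsub>B\<^esub>" using u by simp
    moreover have "inv\<^bsub>k\<^esub> ?e \<odot>\<^bsub>B\<^esub> (?e \<odot>\<^bsub>B\<^esub> \<one>\<^bsub>B\<^esub>) = \<one>\<^bsub>B\<^esub>"
      using u k.Units_closed[OF u] by (simp add: B.smult_assoc1[symmetric] del: B.smult_l_distr)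
    ultimately show False using ne by simp
  qed
  define x where "x = (\<lambda>a\<in>carrier A. SOME c. c \<in> carrier k \<and> ?s c = \<xi> a)"
  have x: "x a \<in> carrier k" "?s (x a) = \<xi> a" if a: "a \<in> carrier A" for a
  proof -
    have "\<exists>c. c \<in> carrier k \<and> ?s c = \<xi> a" using const[OF a] by (force simp: struct_map_def)
    from someI_ex[OF this] show "x a \<in> carrier k" "?s (x a) = \<xi> a" using a by (simp_all add: x_def)
  qed
  have "x \<in> alg_hom k A (self_alg k)"
  proof (rule alg_homI, unfold self_alg_simps)
    fix a b assume a: "a \<in> carrier A" and b: "b \<in> carrier A"
    show "x a \<in> carrier k" by (rule x(1)[OF a])
    have "?s (x a \<oplus>\<^bsub>k\<^esub> x b) = ?s (x (a \<oplus>\<^bsub>A\<^esub> b))"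
      using alg_hom_add[OF s, of "x a" "x b"] a b x by (simp add: self_alg_simps alg_hom_add[OF \<xi>])
    then show "x (a \<oplus>\<^bsub>A\<^esub> b) = x a \<oplus>\<^bsub>k\<^esub> x b"
      by (rule inj[rotated 2, THEN sym]) (simp_all add: a b x(1))
    have "?s (x a \<otimes>\<^bsub>k\<^esub> x b) = ?s (x (a \<otimes>\<^bsub>A\<^esub> b))"
      using alg_hom_mult[OF s, of "x a" "x b"] a b x by (simp add: self_alg_simps alg_hom_mult[OF \<xi>])
    then show "x (a \<otimes>\<^bsub>A\<^esub> b) = x a \<otimes>\<^bsub>k\<^esub> x b"
      by (rule inj[rotated 2, THEN sym]) (simp_all add: a b x(1))
    fix c assume c: "c \<in> carrier k"
    have "?s (c \<otimes>\<^bsub>k\<^esub> x a) = ?s (x (c \<odot>\<^bsub>A\<^esub> a))"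
      using alg_hom_smult[OF s, of c "x a"] a c x by (simp add: self_alg_simps alg_hom_smult[OF \<xi>])
    then show "x (c \<odot>\<^bsub>A\<^esub> a) = c \<otimes>\<^bsub>k\<^esub> x a"
      by (rule inj[rotated 2, THEN sym]) (simp_all add: a c x(1))
  next
    have "?s \<one>\<^bsub>k\<^esub> = ?s (x \<one>\<^bsub>A\<^esub>)" using alg_hom_one[OF s] x by (simp add: self_alg_simps alg_hom_one[OF \<xi>])
    then show "x \<one>\<^bsub>A\<^esub> = \<one>\<^bsub>k\<^esub>"
      by (rule inj[rotated 2, THEN sym]) (simp_all add: x(1))
  qed (simp add: x_def)
  moreover have "const_pt B x = \<xi>"
    using alg_hom_extensional[OF \<xi>] x by (intro extensionalityI[of _ "carrier A"]) (simp_all add: compose_eq)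
  ultimately show ?thesis using that by blast
qed

end

context forms
begin

section \<open>Conjugate subgroups and isomorphic torsors\<close>

lemma transporter_torsor_data:
  assumes E: "(B, act) \<in> torsors" and T: "transporter_torsor k A Xf G H (B, act)"
  obtains P \<phi> where "torsor_ideal P" "is_quot k A P B \<phi>" "\<And>R. algebra k R \<Longrightarrow> cp P R = Tr H R"
    "equivariant_closed_immersion k A Xf N (B, act) \<phi>"
proof -
  obtain \<phi> where \<phi>: "equivariant_closed_immersion k A Xf N (B, act) \<phi>"
    and im: "\<And>R. algebra k R \<Longrightarrow> image_points k A B \<phi> R = Tr H R"
    using T unfolding transporter_torsor_def fst_conv by blast
  obtain P where P: "torsor_ideal P" "is_quot k A P B \<phi>" using torsor_embedding[OF E \<phi>] .
  show ?thesis
    by (rule that[OF P _ \<phi>]) (simp add: im[symmetric] image_points_quot[OF P(2) torsor_ideal_ideal[OF P(1)]])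
qed

lemma torsor_act_closed:
  assumes E: "(B, act) \<in> torsors" and R: "algebra k R" and n: "n \<in> carrier (N R)" and e: "e \<in> alg_hom k B R"
  shows "act R n e \<in> alg_hom k B R"
proof -
  have "group_action (N R) (alg_hom k B R) (act R)"
    using E R unfolding split_embedded_torsors_def left_torsor_def scheme_action_def by blast
  then show ?thesis using n e by (rule group_action.element_image) simp
qed

lemma immersionD:
  assumes "equivariant_closed_immersion k A Xf N (B, act) \<phi>"
  shows "\<phi> \<in> alg_hom k A B" and "\<phi> ` carrier A = carrier B"
    and "algebra k R \<Longrightarrow> n \<in> carrier (N R) \<Longrightarrow> e \<in> alg_hom k B R \<Longrightarrow> pull (act R n e) \<phi> = n \<otimes>\<^bsub>Xf R\<^esub> pull e \<phi>"
  using assms unfolding equivariant_closed_immersion_def equivariant_def fst_conv snd_conv by blast+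

text \<open>A Yoneda argument: \<phi> is the universal point of P, over B. Its translate is a point
  of P' over B, that is, a homomorphism from B' to B, and naturality of y extends the formula to all
  points.\<close>

lemma translate_hom:
  assumes q: "is_quot k A P B \<phi>" and Pc: "P \<subseteq> carrier A" and q': "is_quot k A P' B' \<phi>'" and Pi': "ideal P' A"
    and y: "\<And>R. algebra k R \<Longrightarrow> y R \<in> alg_hom k A R"
    and ynat: "\<And>R S f. algebra k R \<Longrightarrow> algebra k S \<Longrightarrow> f \<in> alg_hom k R S \<Longrightarrow> pull f (y R) = y S"
    and tr: "\<And>R p. algebra k R \<Longrightarrow> p \<in> cp P R \<Longrightarrow> p \<otimes>\<^bsub>Xf R\<^esub> y R \<in> cp P' R"
  obtains \<psi> where "\<psi> \<in> alg_hom k B' B"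
    "\<And>R e. algebra k R \<Longrightarrow> e \<in> alg_hom k B R \<Longrightarrow>
      pull (compose (carrier B') e \<psi>) \<phi>' = pull e \<phi> \<otimes>\<^bsub>Xf R\<^esub> y R"
proof -
  have B: "algebra k B" and \<phi>: "\<phi> \<in> alg_hom k A B" and \<phi>': "\<phi>' \<in> alg_hom k A B'"
    using q q' by (simp_all add: is_quot_def)
  have "pull (\<lambda>b\<in>carrier B. b) \<phi> \<in> cp P B" by (rule quot_point[OF q Pc B alg_hom_id[OF B]])
  then have "\<phi> \<in> cp P B" unfolding compose_alg_id[OF \<phi>] .
  then obtain \<psi> where \<psi>: "\<psi> \<in> alg_hom k B' B" "pull \<psi> \<phi>' = \<phi> \<otimes>\<^bsub>Xf B\<^esub> y B"
    using cp_factor[OF q' Pi' B tr[OF B]] by metis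
  have "pull (compose (carrier B') e \<psi>) \<phi>' = pull e \<phi> \<otimes>\<^bsub>Xf R\<^esub> y R"
    if R: "algebra k R" and e: "e \<in> alg_hom k B R" for R e
    unfolding compose_alg_assoc[OF \<phi>', symmetric] \<psi>(2) pull_mult[OF B R e \<phi> y[OF B]] ynat[OF B R e] ..
  then show ?thesis using that \<psi>(1) by blast
qed

lemma conjugate_imp_torsor_iso:
  assumes E: "E \<in> torsors" "transporter_torsor k A Xf G H E"
    and E': "E' \<in> torsors" "transporter_torsor k A Xf G H' E'"
    and conj: "conjugate_over k A Xf (self_alg k) H H'"
  shows "torsor_iso k N E E'"
proof -
  obtain B act B' act' where Eq: "E = (B, act)" "E' = (B', act')" by (cases E; cases E')
  obtain P \<phi> where P: "torsor_ideal P" and q: "is_quot k A P B \<phi>"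
    and PT: "\<And>R. algebra k R \<Longrightarrow> cp P R = Tr H R" and im: "equivariant_closed_immersion k A Xf N (B, act) \<phi>"
    using transporter_torsor_data[OF E[unfolded Eq]] by metis
  obtain P' \<phi>' where P': "torsor_ideal P'" and q': "is_quot k A P' B' \<phi>'"
    and PT': "\<And>R. algebra k R \<Longrightarrow> cp P' R = Tr H' R" and im': "equivariant_closed_immersion k A Xf N (B', act') \<phi>'"
    using transporter_torsor_data[OF E'[unfolded Eq]] by metis
  have B: "algebra k B" and B': "algebra k B'" using q q' by (simp_all add: is_quot_def)
  note \<phi> = immersionD[OF im] and \<phi>' = immersionD[OF im']
  obtain x where x: "x \<in> alg_hom k A (self_alg k)" "sends (self_alg k) x H H'"
    "sends (self_alg k) (inv\<^bsub>Xf (self_alg k)\<^esub> x) H' H" using conj unfolding conjugate_over_k_iff by blast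
  let ?x = "\<lambda>R. const_pt R x" and ?y = "\<lambda>R. inv\<^bsub>Xf R\<^esub> const_pt R x"
  have xc: "?x R \<in> alg_hom k A R" and xs: "sends R (?x R) H H'" and ys: "sends R (?y R) H' H"
    if R: "algebra k R" for R
  proof -
    note s = struct_map_hom[OF R]
    show "?x R \<in> alg_hom k A R" by (rule const_pt_closed[OF R x(1)])
    show "sends R (?x R) H H'" by (rule sends_pull[OF x(2) alg_k R s x(1)])
    show "sends R (?y R) H' H"
      using sends_pull[OF x(3) alg_k R s pt_inv[OF alg_k x(1)]] unfolding pull_inv[OF alg_k R s x(1)] .
  qed
  have yc: "?y R \<in> alg_hom k A R" if "algebra k R" for R by (rule pt_inv[OF that xc[OF that]])
  have xnat: "pull f (?x R) = ?x S" if "algebra k R" "algebra k S" "f \<in> alg_hom k R S" for R S f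
    by (rule pull_const_pt[OF that(1,3) x(1)])
  have ynat: "pull f (?y R) = ?y S" if "algebra k R" "algebra k S" "f \<in> alg_hom k R S" for R S f
    unfolding pull_inv[OF that xc[OF that(1)]] xnat[OF that] ..
  \<comment> \<open>From x H x\<inverse> = H' and p H p\<inverse> = G it follows that p x\<inverse>
    conjugates H' to G.\<close>
  have tr: "p \<otimes>\<^bsub>Xf R\<^esub> ?y R \<in> cp P' R" if R: "algebra k R" and p: "p \<in> cp P R" for R p
    using Tr_conj[OF R _ yc[OF R] ys[OF R]] p xs[OF R] unfolding PT[OF R] PT'[OF R]
    by (simp add: pt_inv_inv[OF R xc[OF R]])
  have tr': "p \<otimes>\<^bsub>Xf R\<^esub> ?x R \<in> cp P R" if R: "algebra k R" and p: "p \<in> cp P' R" for R p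
    using Tr_conj[OF R _ xc[OF R] xs[OF R] ys[OF R]] p unfolding PT[OF R] PT'[OF R] by simp
  obtain \<psi> where \<psi>: "\<psi> \<in> alg_hom k B' B" and \<psi>e: "\<And>R e. algebra k R \<Longrightarrow> e \<in> alg_hom k B R \<Longrightarrow>
      pull (compose (carrier B') e \<psi>) \<phi>' = pull e \<phi> \<otimes>\<^bsub>Xf R\<^esub> ?y R"
    using translate_hom[where y = ?y, OF q torsor_ideal_sub[OF P] q' torsor_ideal_ideal[OF P'] yc ynat tr] by blast
  obtain \<psi>' where \<psi>': "\<psi>' \<in> alg_hom k B B'" and \<psi>e': "\<And>R e. algebra k R \<Longrightarrow> e \<in> alg_hom k B' R \<Longrightarrow>
      pull (compose (carrier B) e \<psi>') \<phi> = pull e \<phi>' \<otimes>\<^bsub>Xf R\<^esub> ?x R"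
    using translate_hom[where y = ?x, OF q' torsor_ideal_sub[OF P'] q torsor_ideal_ideal[OF P] xc xnat tr'] by blast
  have \<psi>\<phi>: "pull \<psi> \<phi>' = \<phi> \<otimes>\<^bsub>Xf B\<^esub> ?y B"
    using \<psi>e[OF B alg_hom_id[OF B]] by (simp add: compose_alg_id[OF \<psi>] compose_alg_id[OF \<phi>(1)])
  have \<psi>\<phi>': "pull \<psi>' \<phi> = \<phi>' \<otimes>\<^bsub>Xf B'\<^esub> ?x B'"
    using \<psi>e'[OF B' alg_hom_id[OF B']] by (simp add: compose_alg_id[OF \<psi>'] compose_alg_id[OF \<phi>'(1)])
  have c1: "compose (carrier B) \<psi> \<psi>' = (\<lambda>b\<in>carrier B. b)"
  proof (rule surj_pull_eqD[OF \<phi>(2) alg_hom_compose[OF B \<psi>' \<psi>] alg_hom_id[OF B]])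
    show "pull (compose (carrier B) \<psi> \<psi>') \<phi> = pull (\<lambda>b\<in>carrier B. b) \<phi>"
      unfolding \<psi>e'[OF B \<psi>] \<psi>\<phi> compose_alg_id[OF \<phi>(1)] by (simp add: pt_simps[OF B] \<phi>(1) xc[OF B])
  qed
  have c2: "compose (carrier B') \<psi>' \<psi> = (\<lambda>b\<in>carrier B'. b)"
  proof (rule surj_pull_eqD[OF \<phi>'(2) alg_hom_compose[OF B' \<psi> \<psi>'] alg_hom_id[OF B']])
    show "pull (compose (carrier B') \<psi>' \<psi>) \<phi>' = pull (\<lambda>b\<in>carrier B'. b) \<phi>'"
      unfolding \<psi>e[OF B' \<psi>'] \<psi>\<phi>' compose_alg_id[OF \<phi>'(1)] by (simp add: pt_simps[OF B'] \<phi>'(1) xc[OF B'])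
  qed
  have "bij_betw \<psi> (carrier B') (carrier B)"
  proof (rule bij_betw_byWitness[where f' = \<psi>'])
    show "\<forall>b\<in>carrier B'. \<psi>' (\<psi> b) = b"
    proof
      fix b assume "b \<in> carrier B'"
      then show "\<psi>' (\<psi> b) = b" using fun_cong[OF c2, of b] by (simp add: compose_eq)
    qed
    show "\<forall>b\<in>carrier B. \<psi> (\<psi>' b) = b"
    proof
      fix b assume "b \<in> carrier B"
      then show "\<psi> (\<psi>' b) = b" using fun_cong[OF c1, of b] by (simp add: compose_eq)
    qed
  qed (use alg_hom_closed[OF \<psi>] alg_hom_closed[OF \<psi>'] in blast)+
  moreover have "equivariant k N B act B' act' \<psi>"
    unfolding equivariant_def
  proof (intro conjI allI impI ballI \<psi>)
    fix R n e assume R: "algebra k R" and n: "n \<in> carrier (N R)" and e: "e \<in> alg_hom k B R"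
    note ne = torsor_act_closed[OF E(1)[unfolded Eq] R n e]
    have e\<psi>: "compose (carrier B') e \<psi> \<in> alg_hom k B' R" by (rule alg_hom_compose[OF B' \<psi> e])
    show "compose (carrier B') (act R n e) \<psi> = act' R n (compose (carrier B') e \<psi>)"
    proof (rule surj_pull_eqD[OF \<phi>'(2) alg_hom_compose[OF B' \<psi> ne] torsor_act_closed[OF E'(1)[unfolded Eq] R n e\<psi>]])
      show "pull (compose (carrier B') (act R n e) \<psi>) \<phi>' = pull (act' R n (compose (carrier B') e \<psi>)) \<phi>'"
        unfolding \<psi>e[OF R ne] \<phi>(3)[OF R n e] \<phi>'(3)[OF R n e\<psi>] \<psi>e[OF R e]
        by (rule pt_assoc[OF R N_pt[OF R n] alg_hom_compose[OF alg_A \<phi>(1) e] yc[OF R]])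
    qed
  qed
  ultimately show ?thesis unfolding torsor_iso_def Eq fst_conv snd_conv by blast
qed

text \<open>
  For the universal point \<open>p\<close> of \<open>E\<close> and its image \<open>p'\<close> in \<open>E'\<close>, the point
  \<open>p\<inverse> p'\<close> of the group is invariant under the normalizer, so by descent it is defined over \<open>k\<close>.
\<close>

lemma torsor_iso_imp_conjugate:
  assumes E: "E \<in> torsors" "transporter_torsor k A Xf G H E"
    and E': "E' \<in> torsors" "transporter_torsor k A Xf G H' E'"
    and Hi: "ideal H A" "ideal H' A" and iso: "torsor_iso k N E E'"
  shows "conjugate_over k A Xf (self_alg k) H H'"
proof -
  obtain B act B' act' where Eq: "E = (B, act)" "E' = (B', act')" by (cases E; cases E')
  obtain P \<phi> where P: "torsor_ideal P" and q: "is_quot k A P B \<phi>"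
    and PT: "\<And>R. algebra k R \<Longrightarrow> cp P R = Tr H R" and im: "equivariant_closed_immersion k A Xf N (B, act) \<phi>"
    using transporter_torsor_data[OF E[unfolded Eq]] by metis
  obtain P' \<phi>' where P': "torsor_ideal P'" and q': "is_quot k A P' B' \<phi>'"
    and PT': "\<And>R. algebra k R \<Longrightarrow> cp P' R = Tr H' R" and im': "equivariant_closed_immersion k A Xf N (B', act') \<phi>'"
    using transporter_torsor_data[OF E'[unfolded Eq]] by metis
  have B: "algebra k B" and B': "algebra k B'" using q q' by (simp_all add: is_quot_def)
  note \<phi> = immersionD[OF im] and \<phi>' = immersionD[OF im'] and ne = torsor_quot_nontrivial(2)[OF P q]
  note Pc = torsor_ideal_sub[OF P] and Pc' = torsor_ideal_sub[OF P']
  obtain \<psi> where \<psi>: "\<psi> \<in> alg_hom k B' B"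
    and eqv: "\<And>R n e. algebra k R \<Longrightarrow> n \<in> carrier (N R) \<Longrightarrow> e \<in> alg_hom k B R \<Longrightarrow>
      compose (carrier B') (act R n e) \<psi> = act' R n (compose (carrier B') e \<psi>)"
    using iso unfolding torsor_iso_def equivariant_def Eq fst_conv snd_conv by blast
  have \<psi>\<phi>: "pull \<psi> \<phi>' \<in> alg_hom k A B" by (rule alg_hom_compose[OF alg_A \<phi>'(1) \<psi>])
  \<comment> \<open>Here \<phi> is the universal point p of E, over B, and
    \<open>pull \<psi> \<phi>'\<close> is its image p' under the isomorphism.\<close>
  define \<xi> where "\<xi> = inv\<^bsub>Xf B\<^esub> \<phi> \<otimes>\<^bsub>Xf B\<^esub> pull \<psi> \<phi>'"
  have \<xi>: "\<xi> \<in> alg_hom k A B" unfolding \<xi>_def by (rule pt_mult[OF B pt_inv[OF B \<phi>(1)] \<psi>\<phi>])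
  have pull_\<xi>: "pull f \<xi> = inv\<^bsub>Xf R\<^esub> pull f \<phi> \<otimes>\<^bsub>Xf R\<^esub> pull (compose (carrier B') f \<psi>) \<phi>'"
    if R: "algebra k R" and f: "f \<in> alg_hom k B R" for R f
    unfolding \<xi>_def pull_mult[OF B R f pt_inv[OF B \<phi>(1)] \<psi>\<phi>] pull_inv[OF B R f \<phi>(1)]
      compose_alg_assoc[OF \<phi>'(1)] ..
  obtain E cd where b: "alg_basis k B E cd"
    and te: "\<And>R. algebra k R \<Longrightarrow> \<exists>T i j cf. is_tensor k R B cd T i j cf" using tensor_obtain[OF B] by metis
  \<comment> \<open>Two points of E over R differ by some n in the normalizer. By equivariance n
    multiplies both p and p' from the left, and it cancels in (n p)\<inverse> (n p').\<close>
  have inv_pt: "pull f \<xi> = pull g \<xi>" if R: "algebra k R" and f: "f \<in> alg_hom k B R" and g: "g \<in> alg_hom k B R" for R f g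
  proof -
    have pf: "pull f \<phi> \<in> alg_hom k A R" by (rule alg_hom_compose[OF alg_A \<phi>(1) f])
    have f\<psi>: "compose (carrier B') f \<psi> \<in> alg_hom k B' R" by (rule alg_hom_compose[OF B' \<psi> f])
    have pf': "pull (compose (carrier B') f \<psi>) \<phi>' \<in> alg_hom k A R" by (rule alg_hom_compose[OF alg_A \<phi>'(1) f\<psi>])
    have "left_torsor k A N B act" using assms(1) unfolding Eq split_embedded_torsors_def by blast
    then obtain n where n: "n \<in> carrier (N R)" "act R n f = g"
      using R f g unfolding left_torsor_def by blast
    have "pull g \<phi> = n \<otimes>\<^bsub>Xf R\<^esub> pull f \<phi>" using \<phi>(3)[OF R n(1) f] n(2) by simp
    moreover have "pull (compose (carrier B') g \<psi>) \<phi>' = n \<otimes>\<^bsub>Xf R\<^esub> pull (compose (carrier B') f \<psi>) \<phi>'"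
      using eqv[OF R n(1) f] \<phi>'(3)[OF R n(1) f\<psi>] n(2) by simp
    ultimately show ?thesis
      unfolding pull_\<xi>[OF R f] pull_\<xi>[OF R g] using N_pt[OF R n(1)] pf pf' by (simp add: pt_simps[OF R])
  qed
  have "\<exists>c\<in>carrier k. \<xi> a = c \<odot>\<^bsub>B\<^esub> \<one>\<^bsub>B\<^esub>" if a: "a \<in> carrier A" for a
  proof -
    obtain T i j cf where t: "is_tensor k B B cd T i j cf" using te[OF B] by blast
    \<comment> \<open>Applied to the two inclusions of B into B \<otimes> B, invariance is exactly
      the descent condition for each value of \<xi>.\<close>
    have eq: "pull i \<xi> = pull j \<xi>" by (rule inv_pt[OF is_tensor_algebra[OF t] is_tensor_inl[OF t] is_tensor_inr[OF t]])
    have "i (\<xi> a) = j (\<xi> a)" using fun_cong[OF eq, of a] a by (simp add: compose_eq)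
    then show ?thesis by (rule is_tensor_descent[OF t field_k B b ne alg_hom_closed[OF \<xi> a]])
  qed
  then obtain x where x: "x \<in> alg_hom k A (self_alg k)" "const_pt B x = \<xi>"
    using constant_point[OF B ne \<xi>] by blast
  \<comment> \<open>Over S \<otimes> B the constant point x equals p\<inverse> p', where p'
    conjugates H' to G and p\<inverse> conjugates G to H. Membership in H and H' descends along the
    injection S \<rightarrow> S \<otimes> B.\<close>
  have key: "(\<forall>h\<in>cp H S. cj S (inv\<^bsub>Xf S\<^esub> const_pt S x) h \<in> cp H' S) \<and>
      (\<forall>h'\<in>cp H' S. cj S (const_pt S x) h' \<in> cp H S)" if S: "algebra k S" for S
  proof -
    obtain T i j cf where t: "is_tensor k S B cd T i j cf" using te[OF S] by blast
    note T = is_tensor_algebra[OF t] and i = is_tensor_inl[OF t] and j = is_tensor_inr[OF t]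
    have Hc: "H \<subseteq> carrier A" "H' \<subseteq> carrier A"
      using Hi by (simp_all add: additive_subgroup.a_subset ideal.axioms(1))
    let ?p = "pull j \<phi>" and ?p' = "pull (compose (carrier B') j \<psi>) \<phi>'" and ?y = "const_pt T x"
    have p: "?p \<in> Tr H T" using quot_point[OF q Pc T j] PT[OF T] by simp
    have j\<psi>: "compose (carrier B') j \<psi> \<in> alg_hom k B' T" by (rule alg_hom_compose[OF B' \<psi> j])
    have p': "?p' \<in> Tr H' T" using quot_point[OF q' Pc' T j\<psi>] PT'[OF T] by simp
    note pc = Tr_pt[OF T p] and pc' = Tr_pt[OF T p']
    have "?y = pull j \<xi>" unfolding x(2)[symmetric] by (rule pull_const_pt[OF B j x(1), symmetric])
    then have y: "?y = inv\<^bsub>Xf T\<^esub> ?p \<otimes>\<^bsub>Xf T\<^esub> ?p'" unfolding pull_\<xi>[OF T j] .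
    have yi: "inv\<^bsub>Xf T\<^esub> ?y = inv\<^bsub>Xf T\<^esub> ?p' \<otimes>\<^bsub>Xf T\<^esub> ?p" unfolding y using pc pc' by (simp add: pt_simps[OF T])
    have s: "sends T (inv\<^bsub>Xf T\<^esub> ?y) H H'" unfolding yi
      by (rule sends_mult[OF Tr_sends_inv[OF T p'] pt_inv[OF T pc'] Tr_sends[OF T p] pc T])
    have s': "sends T ?y H' H" unfolding y
      by (rule sends_mult[OF Tr_sends_inv[OF T p] pt_inv[OF T pc] Tr_sends[OF T p'] pc' T])
    note yS = const_pt_closed[OF S x(1)] and yT = const_pt_closed[OF T x(1)]
    have des: "u \<in> cp I S" if u: "u \<in> alg_hom k A S" and iu: "pull i u \<in> cp I T" and I: "I \<subseteq> carrier A" for u I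
    proof -
      have "u a = \<zero>\<^bsub>S\<^esub>" if a: "a \<in> I" for a
      proof (rule inj_onD[OF is_tensor_inl_inj[OF t field_k S B b ne]])
        have ac: "a \<in> carrier A" using a I by blast
        show "u a \<in> carrier S" by (rule alg_hom_closed[OF u ac])
        show "\<zero>\<^bsub>S\<^esub> \<in> carrier S" by (rule algebra_zero[OF S])
        have "pull i u a = \<zero>\<^bsub>T\<^esub>" using iu a by (simp add: closed_points_def)
        then show "i (u a) = i \<zero>\<^bsub>S\<^esub>" using ac alg_hom_zero[OF i S T] by (simp add: compose_eq)
      qed
      then show ?thesis using u by (simp add: closed_points_def)
    qed
    show ?thesis
    proof (intro conjI ballI)
      fix h assume h: "h \<in> cp H S"
      show "cj S (inv\<^bsub>Xf S\<^esub> const_pt S x) h \<in> cp H' S"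
      proof (rule des[OF cj_closed[OF S pt_inv[OF S yS] cp_sub[OF h]] _ Hc(2)])
        show "pull i (cj S (inv\<^bsub>Xf S\<^esub> const_pt S x) h) \<in> cp H' T"
          unfolding pull_cj[OF S T i pt_inv[OF S yS] cp_sub[OF h]] pull_inv[OF S T i yS] pull_const_pt[OF S i x(1)]
          by (rule sends_cp[OF s T pt_inv[OF T yT] pull_cp[OF S T i h Hc(1)]])
      qed
    next
      fix h assume h: "h \<in> cp H' S"
      show "cj S (const_pt S x) h \<in> cp H S"
      proof (rule des[OF cj_closed[OF S yS cp_sub[OF h]] _ Hc(1)])
        show "pull i (cj S (const_pt S x) h) \<in> cp H T"
          unfolding pull_cj[OF S T i yS cp_sub[OF h]] pull_const_pt[OF S i x(1)]
          by (rule sends_cp[OF s' T yT pull_cp[OF S T i h Hc(2)]])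
      qed
    qed
  qed
  let ?k = "self_alg k"
  let ?xi = "inv\<^bsub>Xf ?k\<^esub> x"
  have "sends ?k ?xi H H'"
  proof (rule sendsI)
    fix S f h assume S: "algebra k S" and f: "f \<in> alg_hom k ?k S" and h: "h \<in> cp H S"
    have "pull f ?xi = inv\<^bsub>Xf S\<^esub> const_pt S x"
      unfolding struct_map_unique[OF field_k f] by (rule pull_inv[OF alg_k S struct_map_hom[OF S] x(1)])
    then show "cj S (pull f ?xi) h \<in> cp H' S" using key[OF S] h by simp
  qed
  moreover have "sends ?k x H' H"
  proof (rule sendsI)
    fix S f h assume S: "algebra k S" and f: "f \<in> alg_hom k ?k S" and h: "h \<in> cp H' S"
    show "cj S (pull f x) h \<in> cp H S"
      unfolding struct_map_unique[OF field_k f] using key[OF S] h by simp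
  qed
  \<comment> \<open>The point x conjugates H' to H, so the witness is its inverse.\<close>
  ultimately show ?thesis
    unfolding conjugate_over_k_iff using pt_inv[OF alg_k x(1)] pt_inv_inv[OF alg_k x(1)] by metis
qed

end

lemma bij_alg_hom_inverse:
  assumes B: "algebra k B" and \<psi>: "\<psi> \<in> alg_hom k B B'" and bij: "bij_betw \<psi> (carrier B) (carrier B')"
  obtains \<psi>' where "\<psi>' \<in> alg_hom k B' B" "\<And>b. b \<in> carrier B \<Longrightarrow> \<psi>' (\<psi> b) = b"
proof -
  let ?v = "\<lambda>b\<in>carrier B'. inv_into (carrier B) \<psi> b"
  have v: "?v (\<psi> b) = b" if "b \<in> carrier B" for b
    using that alg_hom_closed[OF \<psi> that] bij by (simp add: bij_betw_def)
  have el: "\<exists>b\<in>carrier B. x = \<psi> b" if "x \<in> carrier B'" for x using that bij by (auto simp: bij_betw_def)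
  have "?v \<in> alg_hom k B' B"
  proof (rule alg_homI)
    fix x y assume "x \<in> carrier B'" "y \<in> carrier B'"
    then obtain a b where ab: "a \<in> carrier B" "b \<in> carrier B" "x = \<psi> a" "y = \<psi> b" using el by metis
    note cl = algebra_closed[OF B]
    show "?v x \<in> carrier B" unfolding ab(3) v[OF ab(1)] by (rule ab(1))
    show "?v (x \<oplus>\<^bsub>B'\<^esub> y) = ?v x \<oplus>\<^bsub>B\<^esub> ?v y"
      unfolding ab(3,4) alg_hom_add[OF \<psi> ab(1,2), symmetric] v[OF ab(1)] v[OF ab(2)] v[OF cl(1)[OF ab(1,2)]] ..
    show "?v (x \<otimes>\<^bsub>B'\<^esub> y) = ?v x \<otimes>\<^bsub>B\<^esub> ?v y"
      unfolding ab(3,4) alg_hom_mult[OF \<psi> ab(1,2), symmetric] v[OF ab(1)] v[OF ab(2)] v[OF cl(2)[OF ab(1,2)]] ..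
    fix c assume c: "c \<in> carrier k"
    show "?v (c \<odot>\<^bsub>B'\<^esub> x) = c \<odot>\<^bsub>B\<^esub> ?v x"
      unfolding ab(3) alg_hom_smult[OF \<psi> c ab(1), symmetric] v[OF ab(1)] v[OF cl(5)[OF c ab(1)]] ..
  next
    show "?v \<one>\<^bsub>B'\<^esub> = \<one>\<^bsub>B\<^esub>" unfolding alg_hom_one[OF \<psi>, symmetric] by (rule v[OF algebra_one[OF B]])
  qed simp
  then show ?thesis using that v by blast
qed

text \<open>A relation that is total on both sides and matches the two equivalences induces a
  bijection of classes. The last hypothesis makes the relation hold for every member of the image
  class, not only for the chosen representative, which is how the bijection is seen to be
  natural.\<close>

lemma quotient_correspondence:
  assumes r: "equiv F r" and s: "equiv T s"
    and total: "\<And>x. x \<in> F \<Longrightarrow> \<exists>y\<in>T. P x y" and surj: "\<And>y. y \<in> T \<Longrightarrow> \<exists>x\<in>F. P x y"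
    and corr: "\<And>x x' y y'. x \<in> F \<Longrightarrow> x' \<in> F \<Longrightarrow> y \<in> T \<Longrightarrow> y' \<in> T \<Longrightarrow> P x y \<Longrightarrow> P x' y' \<Longrightarrow>
      (x, x') \<in> r \<longleftrightarrow> (y, y') \<in> s"
    and inv: "\<And>x y y'. x \<in> F \<Longrightarrow> (y, y') \<in> s \<Longrightarrow> P x y' \<Longrightarrow> P x y"
  shows "\<exists>\<Phi>. bij_betw \<Phi> (F // r) (T // s) \<and> (\<forall>x\<in>F. \<forall>y\<in>\<Phi> (r `` {x}). P x y)"
proof -
  define t where "t x = (SOME y. y \<in> T \<and> P x y)" for x
  have t: "t x \<in> T" "P x (t x)" if "x \<in> F" for x
  proof -
    have "\<exists>y. y \<in> T \<and> P x y" using total[OF that] by blast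
    from someI_ex[OF this] show "t x \<in> T" "P x (t x)" by (simp_all add: t_def)
  qed
  define \<Phi> where "\<Phi> c = s `` {t (SOME x. x \<in> c)}" for c
  have cong: "(x, x') \<in> r \<longleftrightarrow> (t x, t x') \<in> s" if "x \<in> F" "x' \<in> F" for x x'
    using corr[OF that t(1)[OF that(1)] t(1)[OF that(2)] t(2)[OF that(1)] t(2)[OF that(2)]] .
  have \<Phi>: "\<Phi> (r `` {x}) = s `` {t x}" if x: "x \<in> F" for x
  proof -
    have "x \<in> r `` {x}" by (rule equiv_class_self[OF r x])
    then have "(SOME x'. x' \<in> r `` {x}) \<in> r `` {x}" by (rule someI)
    then have *: "(x, SOME x'. x' \<in> r `` {x}) \<in> r" by blast
    then have "(SOME x'. x' \<in> r `` {x}) \<in> F" using equiv_class_eq_iff[OF r] by blast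
    then have "(t x, t (SOME x'. x' \<in> r `` {x})) \<in> s" using cong[OF x] * by blast
    then show ?thesis unfolding \<Phi>_def by (rule equiv_class_eq[OF s, symmetric])
  qed
  have "bij_betw \<Phi> (F // r) (T // s)"
  proof (rule bij_betw_imageI)
    show "inj_on \<Phi> (F // r)"
    proof (rule inj_onI)
      fix c d assume "c \<in> F // r" "d \<in> F // r" and eq: "\<Phi> c = \<Phi> d"
      then obtain x x' where x: "x \<in> F" "c = r `` {x}" "x' \<in> F" "d = r `` {x'}" by (auto elim!: quotientE)
      have "s `` {t x} = s `` {t x'}" using eq unfolding x(2,4) \<Phi>[OF x(1)] \<Phi>[OF x(3)] .
      then have "(t x, t x') \<in> s" using eq_equiv_class[OF _ s t(1)[OF x(3)]] by blast
      then show "c = d" unfolding x(2,4) using cong[OF x(1,3)] equiv_class_eq[OF r] by blast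
    qed
    show "\<Phi> ` (F // r) = T // s"
    proof
      show "\<Phi> ` (F // r) \<subseteq> T // s"
      proof
        fix c assume "c \<in> \<Phi> ` (F // r)"
        then obtain x where x: "x \<in> F" "c = \<Phi> (r `` {x})" by (auto elim!: quotientE)
        show "c \<in> T // s" unfolding x(2) \<Phi>[OF x(1)] by (rule quotientI[OF t(1)[OF x(1)]])
      qed
      show "T // s \<subseteq> \<Phi> ` (F // r)"
      proof
        fix c assume "c \<in> T // s"
        then obtain y where y: "y \<in> T" "c = s `` {y}" by (auto elim!: quotientE)
        obtain x where x: "x \<in> F" "P x y" using surj[OF y(1)] by blast
        have "(x, x) \<in> r" using equiv_class_self[OF r x(1)] by blast
        then have "(t x, y) \<in> s" using corr[OF x(1) x(1) t(1)[OF x(1)] y(1) t(2)[OF x(1)] x(2)] by blast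
        then have "c = \<Phi> (r `` {x})" unfolding y(2) \<Phi>[OF x(1)] by (rule equiv_class_eq[OF s, symmetric])
        then show "c \<in> \<Phi> ` (F // r)" using quotientI[OF x(1)] by blast
      qed
    qed
  qed
  moreover have "P x y" if x: "x \<in> F" and y: "y \<in> \<Phi> (r `` {x})" for x y
  proof -
    have "(t x, y) \<in> s" using y unfolding \<Phi>[OF x] by blast
    then have "(y, t x) \<in> s" using s by (meson equivE symE)
    then show ?thesis using inv[OF x _ t(2)[OF x]] by blast
  qed
  ultimately show ?thesis by blast
qed

context affine_gs
begin

section \<open>The two equivalence relations and the bijection of classes\<close>

lemma conjugate_refl: "conjugate_over k A Xf (self_alg k) H H"
  unfolding conjugate_over_k_iff
  using pt_one[OF alg_k] sends_one[OF alg_k] pt_cancel(7)[OF alg_k] by metis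

lemma conjugate_sym:
  assumes "conjugate_over k A Xf (self_alg k) H H'"
  shows "conjugate_over k A Xf (self_alg k) H' H"
proof -
  obtain x where x: "x \<in> alg_hom k A (self_alg k)" "sends (self_alg k) x H H'"
    "sends (self_alg k) (inv\<^bsub>Xf (self_alg k)\<^esub> x) H' H" using assms unfolding conjugate_over_k_iff by blast
  then show ?thesis unfolding conjugate_over_k_iff
    by (intro bexI[of _ "inv\<^bsub>Xf (self_alg k)\<^esub> x"]) (simp_all add: pt_inv_inv[OF alg_k] pt_inv[OF alg_k])
qed

lemma conjugate_trans:
  assumes "conjugate_over k A Xf (self_alg k) H H'" "conjugate_over k A Xf (self_alg k) H' H''"
  shows "conjugate_over k A Xf (self_alg k) H H''"
proof -
  let ?k = "self_alg k"
  obtain x where x: "x \<in> alg_hom k A ?k" "sends ?k x H H'" "sends ?k (inv\<^bsub>Xf ?k\<^esub> x) H' H"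
    using assms(1) unfolding conjugate_over_k_iff by blast
  obtain y where y: "y \<in> alg_hom k A ?k" "sends ?k y H' H''" "sends ?k (inv\<^bsub>Xf ?k\<^esub> y) H'' H'"
    using assms(2) unfolding conjugate_over_k_iff by blast
  have "sends ?k (y \<otimes>\<^bsub>Xf ?k\<^esub> x) H H''" by (rule sends_mult[OF y(2,1) x(2,1) alg_k])
  moreover have "sends ?k (inv\<^bsub>Xf ?k\<^esub> (y \<otimes>\<^bsub>Xf ?k\<^esub> x)) H'' H"
    unfolding pt_inv_mult[OF alg_k y(1) x(1)]
    by (rule sends_mult[OF x(3) pt_inv[OF alg_k x(1)] y(3) pt_inv[OF alg_k y(1)] alg_k])
  ultimately show ?thesis unfolding conjugate_over_k_iff using pt_mult[OF alg_k y(1) x(1)] by blast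
qed

end

context forms
begin

text \<open>Preceding the immersion of E' by the isomorphism gives an immersion of E with the same
  image. Hence corresponding to H is a property of the whole isomorphism class.\<close>

lemma transporter_torsor_iso:
  assumes E: "E \<in> torsors" and E': "E' \<in> torsors" and iso: "torsor_iso k N E E'"
    and T: "transporter_torsor k A Xf G H E'"
  shows "transporter_torsor k A Xf G H E"
proof -
  obtain B act B' act' where Eq: "E = (B, act)" "E' = (B', act')" by (cases E; cases E')
  obtain P' \<phi>' where q': "is_quot k A P' B' \<phi>'" and im': "equivariant_closed_immersion k A Xf N (B', act') \<phi>'"
    using transporter_torsor_data[OF E'[unfolded Eq] T[unfolded Eq]] by metis
  obtain \<phi>' where im': "equivariant_closed_immersion k A Xf N (B', act') \<phi>'"
    and im: "\<And>R. algebra k R \<Longrightarrow> image_points k A B' \<phi>' R = Tr H R"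
    using T unfolding transporter_torsor_def Eq fst_conv by blast
  have B': "algebra k B'" using q' by (simp add: is_quot_def)
  note \<phi>' = immersionD[OF im']
  obtain \<psi> where \<psi>: "\<psi> \<in> alg_hom k B' B" and bij: "bij_betw \<psi> (carrier B') (carrier B)"
    and eqv: "\<And>R n e. algebra k R \<Longrightarrow> n \<in> carrier (N R) \<Longrightarrow> e \<in> alg_hom k B R \<Longrightarrow>
      compose (carrier B') (act R n e) \<psi> = act' R n (compose (carrier B') e \<psi>)"
    using iso unfolding torsor_iso_def equivariant_def Eq fst_conv snd_conv by blast
  have B: "algebra k B"
    using E unfolding Eq split_embedded_torsors_def left_torsor_def scheme_action_def by blast
  obtain \<psi>' where \<psi>': "\<psi>' \<in> alg_hom k B B'" "\<And>b. b \<in> carrier B' \<Longrightarrow> \<psi>' (\<psi> b) = b"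
    using bij_alg_hom_inverse[OF B' \<psi> bij] by blast
  let ?\<phi> = "pull \<psi> \<phi>'"
  have ph: "?\<phi> \<in> alg_hom k A B" by (rule alg_hom_compose[OF alg_A \<phi>'(1) \<psi>])
  have "?\<phi> ` carrier A = \<psi> ` (\<phi>' ` carrier A)" unfolding image_image by (rule image_cong) (simp_all add: compose_eq)
  then have sur: "?\<phi> ` carrier A = carrier B" unfolding \<phi>'(2) using bij by (simp add: bij_betw_def)
  have pe: "pull e ?\<phi> = pull (compose (carrier B') e \<psi>) \<phi>'" for e by (rule compose_alg_assoc[OF \<phi>'(1)])
  have "pull (act R n e) ?\<phi> = n \<otimes>\<^bsub>Xf R\<^esub> pull e ?\<phi>"
    if R: "algebra k R" and n: "n \<in> carrier (N R)" and e: "e \<in> alg_hom k B R" for R n e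
    unfolding pe eqv[OF R n e] by (rule \<phi>'(3)[OF R n alg_hom_compose[OF B' \<psi> e]])
  then have eci: "equivariant_closed_immersion k A Xf N (B, act) ?\<phi>"
    unfolding equivariant_closed_immersion_def equivariant_def fst_conv snd_conv using ph sur by blast
  have "image_points k A B ?\<phi> R = Tr H R" if R: "algebra k R" for R
    unfolding im[OF R, symmetric] image_points_def
  proof
    show "(\<lambda>e. pull e ?\<phi>) ` alg_hom k B R \<subseteq> (\<lambda>e. pull e \<phi>') ` alg_hom k B' R"
      unfolding pe using alg_hom_compose[OF B' \<psi>] by blast
    show "(\<lambda>e. pull e \<phi>') ` alg_hom k B' R \<subseteq> (\<lambda>e. pull e ?\<phi>) ` alg_hom k B R"
    proof
      fix y assume "y \<in> (\<lambda>e. pull e \<phi>') ` alg_hom k B' R"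
      then obtain e where e: "e \<in> alg_hom k B' R" "y = pull e \<phi>'" by blast
      let ?e = "compose (carrier B) e \<psi>'"
      have "compose (carrier B') ?e \<psi> = e"
        using alg_hom_extensional[OF e(1)] alg_hom_closed[OF \<psi>]
        by (intro extensionalityI[of _ "carrier B'"]) (simp_all add: compose_eq \<psi>'(2))
      then have "y = pull ?e ?\<phi>" unfolding pe e(2) by simp
      then show "y \<in> (\<lambda>e. pull e ?\<phi>) ` alg_hom k B R" using alg_hom_compose[OF B \<psi>'(1) e(1)] by blast
    qed
  qed
  then show ?thesis unfolding transporter_torsor_def Eq fst_conv using eci by blast
qed

lemma form_ideal: "H \<in> form_subgroups k K A Xf G \<Longrightarrow> ideal H A"
  by (simp add: form_subgroups_def fp_closed_subgroup_scheme_def closed_subgroupD(1))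

lemma torsor_iso_iff:
  assumes "H \<in> form_subgroups k K A Xf G" "H' \<in> form_subgroups k K A Xf G"
    and "E \<in> torsors" "E' \<in> torsors"
    and "transporter_torsor k A Xf G H E" "transporter_torsor k A Xf G H' E'"
  shows "conjugate_over k A Xf (self_alg k) H H' \<longleftrightarrow> torsor_iso k N E E'"
  using conjugate_imp_torsor_iso[OF assms(3,5,4,6)]
    torsor_iso_imp_conjugate[OF assms(3,5,4,6) form_ideal[OF assms(1)] form_ideal[OF assms(2)]] by blast

lemma equiv_conjugacy: "equiv (form_subgroups k K A Xf G) (conjugacy_rel k K A Xf G)"
proof (rule equivI)
  show "refl_on (form_subgroups k K A Xf G) (conjugacy_rel k K A Xf G)"
    by (rule refl_onI) (auto simp: conjugacy_rel_def conjugate_refl)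
  show "sym (conjugacy_rel k K A Xf G)"
    by (rule symI) (auto simp: conjugacy_rel_def intro: conjugate_sym)
  show "trans (conjugacy_rel k K A Xf G)"
    by (rule transI) (auto simp: conjugacy_rel_def intro: conjugate_trans)
qed (auto simp: conjugacy_rel_def)

text \<open>Every embedded torsor corresponds to some form, and \<open>torsor_iso_iff\<close> makes
  isomorphism match conjugacy over k. The laws are inherited from conjugacy, without composing or
  inverting isomorphisms.\<close>

lemma equiv_torsor_iso: "equiv torsors (torsor_iso_rel k K A Xf N)"
proof (rule equivI)
  have *: "\<exists>H. H \<in> form_subgroups k K A Xf G \<and> transporter_torsor k A Xf G H E" if "E \<in> torsors" for E
    using torsor_has_form[OF that] by blast
  show "refl_on torsors (torsor_iso_rel k K A Xf N)"
  proof (rule refl_onI)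
    fix E assume E: "E \<in> torsors"
    obtain H where H: "H \<in> form_subgroups k K A Xf G" "transporter_torsor k A Xf G H E" using *[OF E] by blast
    have "torsor_iso k N E E" using torsor_iso_iff[OF H(1) H(1) E E H(2) H(2)] conjugate_refl by blast
    then show "(E, E) \<in> torsor_iso_rel k K A Xf N" using E by (simp add: torsor_iso_rel_def)
  qed
  show "sym (torsor_iso_rel k K A Xf N)"
  proof (rule symI)
    fix E E' assume "(E, E') \<in> torsor_iso_rel k K A Xf N"
    then have E: "E \<in> torsors" "E' \<in> torsors" and iso: "torsor_iso k N E E'" by (simp_all add: torsor_iso_rel_def)
    obtain H where H: "H \<in> form_subgroups k K A Xf G" "transporter_torsor k A Xf G H E" using *[OF E(1)] by blast
    obtain H' where H': "H' \<in> form_subgroups k K A Xf G" "transporter_torsor k A Xf G H' E'" using *[OF E(2)] by blast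
    have "torsor_iso k N E' E"
      using torsor_iso_iff[OF H(1) H'(1) E H(2) H'(2)] torsor_iso_iff[OF H'(1) H(1) E(2,1) H'(2) H(2)]
        iso conjugate_sym by blast
    then show "(E', E) \<in> torsor_iso_rel k K A Xf N" using E by (simp add: torsor_iso_rel_def)
  qed
  show "trans (torsor_iso_rel k K A Xf N)"
  proof (rule transI)
    fix E E' E'' assume "(E, E') \<in> torsor_iso_rel k K A Xf N" "(E', E'') \<in> torsor_iso_rel k K A Xf N"
    then have E: "E \<in> torsors" "E' \<in> torsors" "E'' \<in> torsors"
      and iso: "torsor_iso k N E E'" "torsor_iso k N E' E''" by (simp_all add: torsor_iso_rel_def)
    obtain H where H: "H \<in> form_subgroups k K A Xf G" "transporter_torsor k A Xf G H E" using *[OF E(1)] by blast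
    obtain H' where H': "H' \<in> form_subgroups k K A Xf G" "transporter_torsor k A Xf G H' E'" using *[OF E(2)] by blast
    obtain H'' where H'': "H'' \<in> form_subgroups k K A Xf G" "transporter_torsor k A Xf G H'' E''"
      using *[OF E(3)] by blast
    have "conjugate_over k A Xf (self_alg k) H H''"
      using torsor_iso_iff[OF H(1) H'(1) E(1,2) H(2) H'(2)] torsor_iso_iff[OF H'(1) H''(1) E(2,3) H'(2) H''(2)]
        iso conjugate_trans by blast
    then have "torsor_iso k N E E''" using torsor_iso_iff[OF H(1) H''(1) E(1,3) H(2) H''(2)] by blast
    then show "(E, E'') \<in> torsor_iso_rel k K A Xf N" using E by (simp add: torsor_iso_rel_def)
  qed
qed (auto simp: torsor_iso_rel_def)

theorem forms_torsors_correspondence: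
  "\<exists>\<Phi>. bij_betw \<Phi> (form_subgroups k K A Xf G // conjugacy_rel k K A Xf G) (torsors // torsor_iso_rel k K A Xf N) \<and>
     (\<forall>H\<in>form_subgroups k K A Xf G. \<forall>E\<in>\<Phi> (conjugacy_rel k K A Xf G `` {H}). transporter_torsor k A Xf G H E)"
proof (rule quotient_correspondence[OF equiv_conjugacy equiv_torsor_iso form_has_torsor torsor_has_form])
  fix H H' E E'
  assume *: "H \<in> form_subgroups k K A Xf G" "H' \<in> form_subgroups k K A Xf G" "E \<in> torsors" "E' \<in> torsors"
    "transporter_torsor k A Xf G H E" "transporter_torsor k A Xf G H' E'"
  show "(H, H') \<in> conjugacy_rel k K A Xf G \<longleftrightarrow> (E, E') \<in> torsor_iso_rel k K A Xf N"
    using torsor_iso_iff[OF *] *(1-4) by (simp add: conjugacy_rel_def torsor_iso_rel_def)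
next
  fix H E E'
  assume "(E, E') \<in> torsor_iso_rel k K A Xf N" "transporter_torsor k A Xf G H E'"
  then show "transporter_torsor k A Xf G H E"
    using transporter_torsor_iso[of E E' H] by (simp add: torsor_iso_rel_def)
qed

end

theorem theorem1p4:
  fixes k :: "'u ring"
    and K :: "('u, 'u) module"
    and A :: "('u, 'u) module"
    and Xf :: "('u, 'u) module \<Rightarrow> ('u \<Rightarrow> 'u) monoid"
    and G :: "'u set"
  assumes universe: "infinite (UNIV :: 'u set)"
    and field_k: "field k"
    and field_K: "field K"
    and extension: "algebra k K"
    and group_scheme_X: "affine_group_scheme k A Xf"
    and fp_X: "finitely_presented k A"
    and subgroup_G: "fp_closed_subgroup_scheme k A Xf G"
  shows "\<exists>\<Phi>. bij_betw \<Phi>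
            (form_subgroups k K A Xf G // conjugacy_rel k K A Xf G)
            (split_embedded_torsors k K A Xf (normalizer_scheme k A Xf G)
               // torsor_iso_rel k K A Xf (normalizer_scheme k A Xf G)) \<and>
          (\<forall>H\<in>form_subgroups k K A Xf G. \<forall>E\<in>\<Phi> (conjugacy_rel k K A Xf G `` {H}).
             transporter_torsor k A Xf G H E)"
proof -
  interpret forms k A Xf K G
    using universe field_k field_K extension group_scheme_X fp_X subgroup_G
    by (simp add: forms_def forms_axioms_def affine_gs_def)
  show ?thesis by (rule forms_torsors_correspondence)
qed

end
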